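(* Let $H\le \mathrm{GL}_2(\mathbb{Z}_2)$ be any finite-index subgroup with $\det(H)=\mathbb{Z}_2^\times$. Then there is a minimal subgroup $M\le H$ with $|H:M|<\infty$.
   Context: $\mathbb{Z}_2$ denotes the ring of $2$-adic integers and $\mathrm{GL}_2(\mathbb{Z}_2)$ carries its profinite topology. A finite-index subgroup $M\subseteq \mathrm{GL}_2(\mathbb{Z}_2)$ is called minimal if $\det(M)=\mathbb{Z}_2^\times$, but for every maximal closed subgroup $K\subsetneq M$ one has $\det(K)\subsetneq \mathbb{Z}_2^\times$. *)

theory Defs
  imports "HOL-Analysis.Analysis" "HOL-Algebra.Coset"
begin

section \<open>The ring of 2-adic integers\<close>

text \<open>
  The inverse limit of the rings \<open>\<int>/2\<^sup>n\<int>\<close>: an element is a compatible sequence of residues, the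
  residue modulo \<open>2\<^sup>n\<close> being represented by its canonical representative in \<open>{0..<2\<^sup>n}\<close>.
\<close>

typedef padic2 = "{f :: nat \<Rightarrow> int. \<forall>n. f n \<in> {0..<2 ^ n} \<and> f (Suc n) mod 2 ^ n = f n}"
  morphisms residue Abs_padic2
  by (rule exI[of _ "\<lambda>_. 0"]) simp

lemma residue_mod [simp]: "residue x n mod 2 ^ n = residue x n"
  using residue[of x] by (simp add: mod_pos_pos_trivial)

lemma residue_Suc_mod: "residue x (Suc n) mod 2 ^ n = residue x n"
  using residue[of x] by simp

lemma residue_0 [simp]: "residue x 0 = 0"
  using residue_mod[of x 0] by (simp del: residue_mod)

lemma residue_eq_mono:
  assumes "residue x n = residue y n" "m \<le> n"
  shows "residue x m = residue y m"
  using assms(2,1)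
proof (induction rule: dec_induct)
  case (step k)
  then show ?case by (metis residue_Suc_mod)
qed simp

lemma padic2_eqI: "(\<And>n. residue x n = residue y n) \<Longrightarrow> x = y"
  by (meson ext residue_inject)

definition padic2_of :: "(nat \<Rightarrow> int) \<Rightarrow> padic2" where
  "padic2_of f = Abs_padic2 (\<lambda>n. f n mod 2 ^ n)"

lemma residue_padic2_of:
  assumes "\<And>n. f (Suc n) mod 2 ^ n = f n mod 2 ^ n"
  shows "residue (padic2_of f) n = f n mod 2 ^ n"
proof -
  have "(\<lambda>n. f n mod 2 ^ n) \<in> {f. \<forall>n. f n \<in> {0..<2 ^ n} \<and> f (Suc n) mod 2 ^ n = f n}"
    using assms by (auto simp: mod_mod_cancel)
  then show ?thesis
    by (simp add: padic2_of_def Abs_padic2_inverse)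
qed

instantiation padic2 :: comm_ring_1
begin

definition "0 = padic2_of (\<lambda>_. 0)"
definition "1 = padic2_of (\<lambda>_. 1)"
definition "x + y = padic2_of (\<lambda>n. residue x n + residue y n)"
definition "x - y = padic2_of (\<lambda>n. residue x n - residue y n)"
definition "- x = padic2_of (\<lambda>n. - residue x n)"
definition "x * y = padic2_of (\<lambda>n. residue x n * residue y n)"

lemma residue_zero [simp]: "residue 0 n = 0"
  by (simp add: zero_padic2_def residue_padic2_of)

lemma residue_one: "residue 1 n = 1 mod 2 ^ n"
  by (simp add: one_padic2_def residue_padic2_of)

lemma residue_add: "residue (x + y) n = (residue x n + residue y n) mod 2 ^ n"
  unfolding plus_padic2_def
  by (rule residue_padic2_of) (metis mod_add_eq residue_Suc_mod)

lemma residue_diff: "residue (x - y) n = (residue x n - residue y n) mod 2 ^ n"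
  unfolding minus_padic2_def
  by (rule residue_padic2_of) (metis mod_diff_eq residue_Suc_mod)

lemma residue_minus: "residue (- x) n = (- residue x n) mod 2 ^ n"
  unfolding uminus_padic2_def
  by (rule residue_padic2_of) (metis mod_minus_eq residue_Suc_mod)

lemma residue_mult: "residue (x * y) n = (residue x n * residue y n) mod 2 ^ n"
  unfolding times_padic2_def
  by (rule residue_padic2_of) (metis mod_mult_eq residue_Suc_mod)

instance
proof
  fix a b c :: padic2
  show "a * b * c = a * (b * c)"
    by (rule padic2_eqI) (simp add: residue_mult mod_mult_left_eq mod_mult_right_eq mult.assoc)
  show "a * b = b * a"
    by (rule padic2_eqI) (simp add: residue_mult mult.commute)
  show "1 * a = a"
    by (rule padic2_eqI) (simp add: residue_mult residue_one mod_mult_left_eq)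
  show "a + b + c = a + (b + c)"
    by (rule padic2_eqI) (simp add: residue_add mod_add_left_eq mod_add_right_eq add.assoc)
  show "a + b = b + a"
    by (rule padic2_eqI) (simp add: residue_add add.commute)
  show "0 + a = a"
    by (rule padic2_eqI) (simp add: residue_add)
  show "- a + a = 0"
    by (rule padic2_eqI) (simp add: residue_add residue_minus mod_add_left_eq)
  show "a - b = a + - b"
    by (rule padic2_eqI) (simp add: residue_add residue_minus residue_diff mod_add_right_eq)
  show "(a + b) * c = a * c + b * c"
    by (rule padic2_eqI)
       (simp add: residue_add residue_mult mod_add_eq mod_mult_left_eq distrib_right)
  show "(0 :: padic2) \<noteq> 1"
  proof
    assume "(0 :: padic2) = 1"
    then have "residue 0 1 = residue 1 1" by simp
    then show False by (simp add: residue_one)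
  qed
qed

end

text \<open>The 2-adic topology, with the residue classes modulo the powers of 2 as basic open sets.\<close>

instantiation padic2 :: topological_space
begin

definition "open (U :: padic2 set) \<longleftrightarrow>
  (\<forall>x\<in>U. \<exists>n. \<forall>y. residue y n = residue x n \<longrightarrow> y \<in> U)"

instance
proof
  show "open (UNIV :: padic2 set)"
    by (simp add: open_padic2_def)
next
  fix K :: "padic2 set set"
  assume "\<forall>S\<in>K. open S"
  then show "open (\<Union>K)"
    unfolding open_padic2_def by (meson Union_iff)
next
  fix S T :: "padic2 set"
  assume S: "open S" and T: "open T"
  show "open (S \<inter> T)"
    unfolding open_padic2_def
  proof
    fix x assume "x \<in> S \<inter> T"
    then obtain m n where "\<forall>y. residue y m = residue x m \<longrightarrow> y \<in> S"
        "\<forall>y. residue y n = residue x n \<longrightarrow> y \<in> T"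
      using S T unfolding open_padic2_def by blast
    then show "\<exists>n. \<forall>y. residue y n = residue x n \<longrightarrow> y \<in> S \<inter> T"
      by (intro exI[of _ "max m n"]) (meson IntI max.cobounded1 max.cobounded2 residue_eq_mono)
  qed
qed

end

definition Z2_units :: "padic2 set" where
  "Z2_units = {u. u dvd 1}"

section \<open>The group \<open>GL\<^sub>2(\<int>\<^sub>2)\<close> and its profinite topology\<close>

type_synonym mat2 = "padic2 ^ 2 ^ 2"

definition GL2 :: "mat2 monoid" where
  "GL2 = \<lparr>carrier = {A. invertible A}, mult = (**), one = mat 1\<rparr>"

lemma group_GL2: "group GL2"
proof (rule groupI)
  fix A B assume "A \<in> carrier GL2" "B \<in> carrier GL2"
  then obtain A' B' :: mat2 where
      "A ** A' = mat 1" "A' ** A = mat 1" "B ** B' = mat 1" "B' ** B = mat 1"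
    by (auto simp: GL2_def invertible_def)
  then have "(A ** B) ** (B' ** A') = mat 1" "(B' ** A') ** (A ** B) = mat 1"
    by (metis matrix_mul_assoc matrix_mul_rid)+
  then show "A \<otimes>\<^bsub>GL2\<^esub> B \<in> carrier GL2"
    by (auto simp: GL2_def invertible_def)
next
  fix A assume "A \<in> carrier GL2"
  then obtain B :: mat2 where "A ** B = mat 1" "B ** A = mat 1"
    by (auto simp: GL2_def invertible_def)
  then show "\<exists>B\<in>carrier GL2. B \<otimes>\<^bsub>GL2\<^esub> A = \<one>\<^bsub>GL2\<^esub>"
    by (auto simp: GL2_def invertible_def)
qed (auto simp: GL2_def matrix_mul_assoc invertible_def)

text \<open>
  The topology induced by the product topology on 2 by 2 matrices. Lemma
  \<open>openin_GL2_topology\<close> shows that this is the profinite topology, i.e. the inverse limit topology for the reductions modulo \<open>2\<^sup>n\<close>.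
\<close>

definition GL2_topology :: "mat2 topology" where
  "GL2_topology = top_of_set (carrier GL2)"

definition mat_residue :: "nat \<Rightarrow> mat2 \<Rightarrow> int ^ 2 ^ 2" where
  "mat_residue n A = (\<chi> i j. residue (A $ i $ j) n)"

lemma mat_residue_eq_iff:
  "mat_residue n A = mat_residue n B \<longleftrightarrow> (\<forall>i j. residue (A $ i $ j) n = residue (B $ i $ j) n)"
  by (simp add: mat_residue_def vec_eq_iff)

lemma open_mat2_iff:
  fixes S :: "mat2 set"
  shows "open S \<longleftrightarrow> (\<forall>A\<in>S. \<exists>n. \<forall>B. mat_residue n B = mat_residue n A \<longrightarrow> B \<in> S)"
proof
  assume S: "open S"
  show "\<forall>A\<in>S. \<exists>n. \<forall>B. mat_residue n B = mat_residue n A \<longrightarrow> B \<in> S"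
  proof
    fix A assume "A \<in> S"
    then obtain F where F: "\<And>i. open (F i)" "\<And>i. A $ i \<in> F i" "\<And>B. (\<forall>i. B $ i \<in> F i) \<Longrightarrow> B \<in> S"
      using S unfolding open_vec_def by metis
    have "\<exists>G. (\<forall>j. open (G j) \<and> A $ i $ j \<in> G j) \<and> (\<forall>v. (\<forall>j. v $ j \<in> G j) \<longrightarrow> v \<in> F i)" for i
      using F(1,2)[of i] unfolding open_vec_def by blast
    then obtain G where G: "\<And>i j. open (G i j)" "\<And>i j. A $ i $ j \<in> G i j"
        "\<And>i v. (\<forall>j. v $ j \<in> G i j) \<Longrightarrow> v \<in> F i"
      by metis
    have "\<forall>i j. \<exists>m. \<forall>y. residue y m = residue (A $ i $ j) m \<longrightarrow> y \<in> G i j"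
      using G(1,2) unfolding open_padic2_def by blast
    then obtain k where k: "\<And>i j y. residue y (k i j) = residue (A $ i $ j) (k i j) \<Longrightarrow> y \<in> G i j"
      by metis
    define n where "n = Max (range (\<lambda>(i, j). k i j))"
    have n: "k i j \<le> n" for i j
      unfolding n_def by (rule Max_ge) (auto intro: rev_image_eqI[of "(i, j)"])
    have "B \<in> S" if "mat_residue n B = mat_residue n A" for B
      using that n by (intro F(3) G(3) allI k) (metis mat_residue_eq_iff residue_eq_mono)
    then show "\<exists>n. \<forall>B. mat_residue n B = mat_residue n A \<longrightarrow> B \<in> S" by blast
  qed
next
  assume S: "\<forall>A\<in>S. \<exists>n. \<forall>B. mat_residue n B = mat_residue n A \<longrightarrow> B \<in> S"
  have "open {y. residue y n = c}" for n c
    unfolding open_padic2_def by auto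
  then have "open ((\<lambda>B::mat2. B $ i $ j) -` {y. residue y n = c})" for i j n c
    using open_vimage_vec_nth[OF open_vimage_vec_nth, of "{y. residue y n = c}" i j]
    by (simp add: vimage_def)
  then have "open (\<Inter>i. \<Inter>j. (\<lambda>B::mat2. B $ i $ j) -` {y. residue y n = residue (A $ i $ j) n})"
    for n and A :: mat2
    by (intro open_INT) auto
  moreover have "(\<Inter>i. \<Inter>j. (\<lambda>B::mat2. B $ i $ j) -` {y. residue y n = residue (A $ i $ j) n})
      = {B. mat_residue n B = mat_residue n A}" for n and A :: mat2
    by (auto simp: mat_residue_eq_iff)
  ultimately have cyl: "open {B. mat_residue n B = mat_residue n A}" for n and A :: mat2
    by simp
  show "open S"
    unfolding open_subopen[of S]
  proof
    fix A assume "A \<in> S"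
    then obtain n where "\<forall>B. mat_residue n B = mat_residue n A \<longrightarrow> B \<in> S" using S by blast
    then show "\<exists>T. open T \<and> A \<in> T \<and> T \<subseteq> S"
      using cyl[of n A] by blast
  qed
qed

lemma openin_GL2_topology:
  "openin GL2_topology U \<longleftrightarrow> U \<subseteq> carrier GL2 \<and>
     (\<forall>A\<in>U. \<exists>n. \<forall>B\<in>carrier GL2. mat_residue n B = mat_residue n A \<longrightarrow> B \<in> U)"
    (is "_ \<longleftrightarrow> ?R")
proof
  assume "openin GL2_topology U"
  then obtain S where "open S" "U = carrier GL2 \<inter> S"
    by (auto simp: GL2_topology_def openin_open)
  then show ?R unfolding open_mat2_iff by blast
next
  assume R: ?R
  define S where "S = {B. \<exists>A\<in>U. \<exists>n. mat_residue n B = mat_residue n A \<and>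
    (\<forall>C\<in>carrier GL2. mat_residue n C = mat_residue n A \<longrightarrow> C \<in> U)}"
  have "open S"
    unfolding open_mat2_iff
  proof
    fix B assume "B \<in> S"
    then obtain A n where "A \<in> U" "mat_residue n B = mat_residue n A"
        "\<forall>C\<in>carrier GL2. mat_residue n C = mat_residue n A \<longrightarrow> C \<in> U"
      unfolding S_def by blast
    then have "\<forall>D. mat_residue n D = mat_residue n B \<longrightarrow> D \<in> S"
      unfolding S_def by auto
    then show "\<exists>n. \<forall>D. mat_residue n D = mat_residue n B \<longrightarrow> D \<in> S" by blast
  qed
  moreover have "U = carrier GL2 \<inter> S"
    using R unfolding S_def by blast
  ultimately show "openin GL2_topology U"
    by (auto simp: GL2_topology_def openin_open)
qed

definition closed_subgroup :: "mat2 set \<Rightarrow> bool" where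
  "closed_subgroup K \<longleftrightarrow> subgroup K GL2 \<and> closedin GL2_topology K"

definition maximal_closed_subgroup :: "mat2 set \<Rightarrow> mat2 set \<Rightarrow> bool" where
  "maximal_closed_subgroup K M \<longleftrightarrow>
     closed_subgroup K \<and> K \<subset> M \<and>
     (\<forall>L. closed_subgroup L \<and> K \<subseteq> L \<and> L \<subset> M \<longrightarrow> L = K)"

text \<open>Finite index of abstract groups, without any topological condition on \<open>M\<close>.\<close>

definition finite_index :: "('a, 'b) monoid_scheme \<Rightarrow> 'a set \<Rightarrow> bool" where
  "finite_index G M \<longleftrightarrow> subgroup M G \<and> finite (rcosets\<^bsub>G\<^esub> M)"

definition minimal_subgroup :: "mat2 set \<Rightarrow> bool" where
  "minimal_subgroup M \<longleftrightarrow>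
     finite_index GL2 M \<and> det ` M = Z2_units \<and>
     (\<forall>K. maximal_closed_subgroup K M \<longrightarrow> det ` K \<subset> Z2_units)"

end

theory Submission
  imports Defs "HOL-Algebra.Generated_Groups"
begin

text \<open>
  The subgroup \<open>M\<close> is the closure of the group generated by two suitable elements \<open>a\<close>, \<open>b\<close> of \<open>H\<close>.

  Why two generators give minimality. Suppose that \<open>a\<close> and \<open>b\<close> lie in one Sylow pro-2 subgroup of
  \<open>GL\<^sub>2(\<int>\<^sub>2)\<close>, that is, that they stabilise a common line modulo 2, and that \<open>det a \<equiv> 3 (mod 4)\<close> and
  \<open>det b \<equiv> 5 (mod 8)\<close>. Then \<open>M\<close> is a pro-2 group with two topological generators, so its Frattini
  quotient has at most four elements. The determinant maps this quotient onto the units modulo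
  squares, which have exactly four classes. Hence the kernel of the determinant lies in the Frattini
  subgroup, and no proper closed subgroup of \<open>M\<close> has every unit as a determinant. The proof replaces
  Frattini theory by a central filtration with elementary abelian quotients, the conjugates of the
  Iwahori filtration: a proper closed subgroup \<open>K\<close> of \<open>M\<close> lies in a proper subgroup \<open>N\<close> that contains
  all squares of \<open>M\<close> and a neighbourhood of 1 (\<open>proper_subgroup_containing_squares\<close>), and if
  \<open>det a\<close> and \<open>det b\<close> are determinants of elements of \<open>K\<close>, then \<open>a\<close> and \<open>b\<close> lie in \<open>N\<close>
  (\<open>no_proper_closed_subgroup_with_full_det\<close>).

  Why \<open>M\<close> has finite index. Let \<open>W = ab - ba\<close>. A power \<open>a\<^sup>m\<close> has the form \<open>x + ya\<close>, a power \<open>b\<^sup>n\<close> the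
  form \<open>x' + y'b\<close>, so the group commutator of the two is \<open>1 + yy' W a\<^sup>-\<^sup>m b\<^sup>-\<^sup>n\<close>. With \<open>m\<close> and \<open>n\<close> large powers
  of 2 it is a small multiple of \<open>W\<close> away from 1, up to a much smaller error. Conjugation by \<open>a\<close> and
  by \<open>b\<close> yields the directions \<open>aWa\<^sup>-\<^sup>1\<close> and \<open>bWb\<^sup>-\<^sup>1\<close>. If \<open>a\<close> and \<open>b\<close> have nonzero trace and
  \<open>det W \<noteq> 0\<close>, the three directions span all trace-zero matrices over the fraction field
  (\<open>det3_conjugates\<close>), and successive approximation shows that \<open>M\<close> contains all matrices of
  determinant 1 that are close to 1 (\<open>full_level_dense\<close>). Powers of \<open>b\<close> supply the missing
  direction, and \<open>M\<close> contains a congruence subgroup (\<open>closure_contains_congruence_subgroup\<close>).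

  Why such \<open>a\<close> and \<open>b\<close> exist in \<open>H\<close>. Start with elements of determinant \<open>-1\<close> and \<open>5\<close>. Their images in
  \<open>GL\<^sub>2(\<int>/2)\<close>, a symmetric group on three lines, are moved into one subgroup of order 2 by passing to
  cubes and products (\<open>common_stable_line\<close>). Since \<open>H\<close> contains a congruence subgroup
  (\<open>finite_index_contains_congruence_subgroup\<close>), a small change of entries stays in \<open>H\<close>, and it
  achieves the nonvanishing of the traces and of \<open>det W\<close> (\<open>generic_perturbation\<close>).
\<close>

section \<open>Arithmetic of the 2-adic integers\<close>

lemma residue_of_nat: "residue (of_nat k) n = int k mod 2 ^ n"
  by (induction k) (simp_all add: residue_add residue_one mod_simps)

lemma residue_power2: "residue (2 ^ m) n = 2 ^ m mod 2 ^ n"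
  using residue_of_nat[of "2 ^ m" n] by simp

lemma residue_nonneg: "0 \<le> residue x n" and residue_less: "residue x n < 2 ^ n"
  using residue[of x] by auto

lemma residue_mod_le:
  assumes "m \<le> n"
  shows "residue x n mod 2 ^ m = residue x m"
  using assms
proof (induction rule: dec_induct)
  case (step k)
  then show ?case
    by (metis residue_Suc_mod mod_mod_cancel le_imp_power_dvd)
qed simp

text \<open>
  Divisibility by powers of 2 replaces residues in all later arguments, so that congruences can
  be handled by ring algebra.
\<close>

lemma power2_dvd_iff: "2 ^ n dvd x \<longleftrightarrow> residue x n = 0"
proof
  assume "2 ^ n dvd x"
  then obtain y where "x = 2 ^ n * y" by (elim dvdE)
  then show "residue x n = 0"
    by (simp add: residue_mult residue_power2)
next
  assume 0: "residue x n = 0"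
  define f where "f k = residue x (n + k) div 2 ^ n" for k
  have x: "residue x (n + k) = 2 ^ n * f k" for k
  proof -
    have "residue x (n + k) mod 2 ^ n = 0"
      using residue_mod_le[of n "n + k" x] 0 by simp
    then show ?thesis unfolding f_def by auto
  qed
  have f: "f (Suc k) mod 2 ^ k = f k mod 2 ^ k" for k
  proof -
    have "2 ^ n * (f (Suc k) mod 2 ^ k) = residue x (n + Suc k) mod 2 ^ (n + k)"
      unfolding x power_add by (rule mult_mod_right)
    also have "\<dots> = 2 ^ n * f k mod 2 ^ (n + k)"
      using residue_Suc_mod[of x "n + k"] residue_mod[of x "n + k"] x[of k] by simp
    also have "\<dots> = 2 ^ n * (f k mod 2 ^ k)"
      unfolding power_add by (rule mult_mod_right[symmetric])
    finally show ?thesis by simp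
  qed
  have "x = 2 ^ n * padic2_of f"
  proof (rule padic2_eqI)
    fix k
    have "residue (2 ^ n * padic2_of f) k = (2 ^ n * f k) mod 2 ^ k"
      by (simp add: residue_mult residue_power2 residue_padic2_of[OF f] mod_mult_eq)
    also have "\<dots> = residue x k"
      unfolding x[symmetric] by (simp add: residue_mod_le)
    finally show "residue x k = residue (2 ^ n * padic2_of f) k" by simp
  qed
  then show "2 ^ n dvd x" by (rule dvdI)
qed

lemma residue_eq_iff: "residue x n = residue y n \<longleftrightarrow> 2 ^ n dvd x - y"
proof -
  have "residue (x - y) n = 0 \<longleftrightarrow> residue x n mod 2 ^ n = residue y n mod 2 ^ n"
    unfolding residue_diff by (metis mod_eq_dvd_iff dvd_eq_mod_eq_0)
  then show ?thesis by (simp add: power2_dvd_iff)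
qed

lemma padic2_eq_0I:
  assumes "\<And>n. 2 ^ n dvd (x :: padic2)"
  shows "x = 0"
  using assms by (intro padic2_eqI) (simp add: power2_dvd_iff)

lemma padic2_nat_approx: "\<exists>c. 2 ^ n dvd (x :: padic2) - of_nat c"
proof
  show "2 ^ n dvd x - of_nat (nat (residue x n))"
    unfolding residue_eq_iff[symmetric] residue_of_nat by (simp only: nat_0_le residue_nonneg residue_mod)
qed

lemma padic2_parity:
  fixes x :: padic2
  obtains "2 dvd x" | "2 dvd x - 1"
proof -
  have "0 \<le> residue x 1" "residue x 1 < 2" using residue_nonneg[of x 1] residue_less[of x 1] by simp_all
  then have "residue x 1 = residue 0 1 \<or> residue x 1 = residue 1 1"
    unfolding residue_one residue_zero by auto
  then show thesis
    unfolding residue_eq_iff using that by auto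
qed

text \<open>
  Completeness: the limit is read off from the diagonal of residues.
\<close>

lemma padic2_complete:
  fixes x :: "nat \<Rightarrow> padic2"
  assumes "\<And>n. 2 ^ n dvd x (Suc n) - x n"
  obtains y where "\<And>n. 2 ^ n dvd y - x n"
proof
  fix n
  have "residue (padic2_of (\<lambda>n. residue (x n) n)) n = residue (x n) n"
    by (subst residue_padic2_of) (use assms in \<open>simp_all add: residue_eq_iff[symmetric] residue_Suc_mod\<close>)
  then show "2 ^ n dvd padic2_of (\<lambda>n. residue (x n) n) - x n"
    by (simp add: residue_eq_iff)
qed

lemma two_not_dvd_one: "\<not> 2 dvd (1 :: padic2)"
  using power2_dvd_iff[of 1 1] by (simp add: residue_one)

text \<open>
  The inverse of an odd number \<open>1 - q\<close> is the limit of the geometric sums of \<open>q\<close>.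
\<close>

lemma padic2_unit_iff: "u dvd 1 \<longleftrightarrow> \<not> 2 dvd (u :: padic2)"
proof
  assume "u dvd 1"
  then show "\<not> 2 dvd u" using two_not_dvd_one dvd_trans by blast
next
  assume "\<not> 2 dvd u"
  then have "2 dvd u - 1" by (meson padic2_parity)
  then obtain w where w: "u - 1 = 2 * w" by (elim dvdE)
  define q where "q = - 2 * w"
  have u: "u = 1 - q" using w by (simp add: q_def algebra_simps)
  have q: "2 ^ n dvd q ^ n" for n
    unfolding q_def by (intro dvd_power_same) simp
  obtain y where y: "\<And>n. 2 ^ n dvd y - (\<Sum>i<n. q ^ i)"
    by (rule padic2_complete[of "\<lambda>n. \<Sum>i<n. q ^ i"]) (use q in \<open>simp, blast\<close>)
  have "u * y - 1 = 0"
  proof (rule padic2_eq_0I)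
    fix n
    have "1 - q ^ n = (1 - q) * (\<Sum>i<n. q ^ i)" by (rule one_diff_power_eq)
    then have "u * y - 1 = u * (y - (\<Sum>i<n. q ^ i)) - q ^ n"
      unfolding u by (simp add: algebra_simps)
    then show "2 ^ n dvd u * y - 1" using y[of n] q[of n] by (simp add: dvd_diff)
  qed
  then show "u dvd 1" by (metis dvdI eq_iff_diff_eq_0)
qed

lemma padic2_valuation:
  fixes x :: padic2
  assumes "x \<noteq> 0"
  obtains v u where "x = 2 ^ v * u" "u dvd 1"
proof -
  have ex: "\<exists>n. \<not> 2 ^ n dvd x" using padic2_eq_0I assms by blast
  define n where "n = (LEAST n. \<not> 2 ^ n dvd x)"
  have n: "\<not> 2 ^ n dvd x" unfolding n_def by (rule LeastI_ex[OF ex])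
  then obtain v where v: "n = Suc v" by (cases n) auto
  have "2 ^ v dvd x" using not_less_Least[of v "\<lambda>n. \<not> 2 ^ n dvd x"] v unfolding n_def by auto
  then obtain u where u: "x = 2 ^ v * u" by (elim dvdE)
  have "\<not> 2 dvd u"
  proof
    assume "2 dvd u"
    then show False using n unfolding u v by (simp add: mult.commute mult_dvd_mono)
  qed
  then show thesis using that u padic2_unit_iff by blast
qed

lemma padic2_power2_nonzero: "(2 :: padic2) ^ n \<noteq> 0"
proof
  assume "(2 :: padic2) ^ n = 0"
  then have "residue (2 ^ n) (Suc n) = 0" by simp
  then show False by (simp add: residue_power2)
qed

instance padic2 :: idom
proof
  fix x y :: padic2
  assume "x \<noteq> 0" "y \<noteq> 0"
  obtain v u where x: "x = 2 ^ v * u" "u dvd 1"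
    using \<open>x \<noteq> 0\<close> by (rule padic2_valuation)
  obtain w t where y: "y = 2 ^ w * t" "t dvd 1"
    using \<open>y \<noteq> 0\<close> by (rule padic2_valuation)
  from x(2) y(2) obtain u' t' where inv: "1 = u * u'" "1 = t * t'" by (elim dvdE) blast
  have "x * y * (u' * t') = 2 ^ (v + w)"
  proof -
    have "x * y * (u' * t') = 2 ^ (v + w) * ((u * u') * (t * t'))"
      unfolding x(1) y(1) power_add by (simp only: ac_simps)
    then show ?thesis by (simp only: inv[symmetric] mult_1_right)
  qed
  then show "x * y \<noteq> 0" using padic2_power2_nonzero[of "v + w"] by auto
qed

lemma unit_inverse: "\<exists>v. u * v = 1" if "u dvd (1 :: 'a :: comm_ring_1)"
  using that by (auto simp: dvd_def)

lemma padic2_even_add: "2 dvd x + y \<longleftrightarrow> (2 dvd x \<longleftrightarrow> 2 dvd (y :: padic2))"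
proof -
  have odd: "2 dvd z - 1" if "\<not> 2 dvd z" for z :: padic2 using padic2_parity[of z] that by blast
  have "2 dvd x + y" if "\<not> 2 dvd x" "\<not> 2 dvd y"
  proof -
    have "2 dvd (x - 1) + (y - 1) + 2" using odd[OF that(1)] odd[OF that(2)] by (intro dvd_add dvd_refl)
    then show ?thesis by simp
  qed
  then show ?thesis by (cases "2 dvd x") (auto simp: dvd_add_right_iff dvd_add_left_iff)
qed

lemma padic2_even_diff: "2 dvd x - y \<longleftrightarrow> (2 dvd x \<longleftrightarrow> 2 dvd (y :: padic2))"
  using padic2_even_add[of x "- y"] by simp

lemma padic2_even_mult: "2 dvd x * y \<longleftrightarrow> 2 dvd x \<or> 2 dvd (y :: padic2)"
proof -
  have "x * y dvd 1" if "x dvd 1" "y dvd 1" using mult_dvd_mono[OF that] by simp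
  then show ?thesis using padic2_unit_iff[of x] padic2_unit_iff[of y] padic2_unit_iff[of "x * y"] by auto
qed

lemmas padic2_even_simps = padic2_even_add padic2_even_diff padic2_even_mult two_not_dvd_one

lemma power2_odd_decomposition:
  fixes n :: nat assumes "n > 0" obtains k m where "n = 2 ^ k * m" "odd m"
proof -
  have "\<exists>k m. n = 2 ^ k * m \<and> odd m" using assms
  proof (induction n rule: less_induct)
    case (less n)
    show ?case
    proof (cases "odd n")
      case True then show ?thesis by (intro exI[of _ 0] exI[of _ n]) simp
    next
      case False
      then have "n div 2 < n" "n div 2 > 0" using less.prems by auto
      from less.IH[OF this] obtain k m where "n div 2 = 2 ^ k * m" "odd m" by blast
      then show ?thesis using False by (intro exI[of _ "Suc k"] exI[of _ m]) auto
    qed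
  qed
  then show thesis using that by blast
qed

text \<open>
  Hensel's lemma for \<open>x\<^sup>m = u\<close>. The derivative \<open>m x\<^sup>m\<^sup>-\<^sup>1\<close> is \<open>2\<^sup>k\<close> times a unit, so a solution modulo
  \<open>2\<^sup>i\<^sup>+\<^sup>2\<^sup>k\<^sup>+\<^sup>1\<close> can be improved by one digit by a correction divisible by \<open>2\<^sup>i\<^sup>+\<^sup>k\<^sup>+\<^sup>1\<close>.
\<close>

lemma padic2_hensel_power:
  fixes u :: padic2
  assumes m: "m = 2 ^ k * m'" "odd m'" and u: "2 ^ (2 * k + 1) dvd u - 1"
  obtains x where "x ^ m = u"
proof -
  define P where "P i x \<longleftrightarrow> \<not> 2 dvd x \<and> 2 ^ (i + k + k + 1) dvd u - x ^ m" for i and x :: padic2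
  have "\<exists>x. \<forall>i. P i (x i) \<and> 2 ^ (i + k + 1) dvd x (Suc i) - x i"
  proof (rule dependent_nat_choice)
    have "P 0 1"
      using u two_not_dvd_one unfolding P_def power_one add_0 mult_2 by blast
    then show "\<exists>x. P 0 x" ..
  next
    fix x i assume "P i x"
    then have x: "\<not> 2 dvd x" and "2 ^ (i + k + k + 1) dvd u - x ^ m" by (auto simp: P_def)
    then obtain c where c: "u - x ^ m = 2 ^ (i + k + k + 1) * c" by (elim dvdE)
    have "\<not> 2 dvd of_nat m' * x ^ (m - 1)"
    proof -
      have "\<not> 2 dvd (of_nat m' :: padic2)"
        using m(2) power2_dvd_iff[of 1 "of_nat m'"]
        by (simp add: residue_of_nat) presburger
      moreover have "x ^ (m - 1) dvd 1"
        using x unfolding padic2_unit_iff[symmetric] by (metis dvd_power_same power_one)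
      ultimately show ?thesis
        unfolding padic2_unit_iff[symmetric] using mult_dvd_mono[of "of_nat m'" 1 "x ^ (m - 1)" 1] by simp
    qed
    then obtain w where w: "of_nat m' * x ^ (m - 1) * w = 1"
      unfolding padic2_unit_iff[symmetric] by (metis dvdE)
    \<comment> \<open>The Newton step: it cancels the error \<open>2\<^sup>i\<^sup>+\<^sup>2\<^sup>k\<^sup>+\<^sup>1 c\<close> against the linear term.\<close>
    define z where "z = 2 ^ (i + k + 1) * (c * w)"
    have "m > 0" using m by (auto simp: odd_pos)
    obtain R where R: "(x + z) ^ m = x ^ m + of_nat m * x ^ (m - 1) * z + z\<^sup>2 * R"
    proof -
      have "\<exists>R. (x + z) ^ n = x ^ n + of_nat n * x ^ (n - 1) * z + z\<^sup>2 * R" for n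
      proof (induction n)
        case 0 show ?case by (intro exI[of _ 0]) simp
      next
        case (Suc n)
        then obtain R where R: "(x + z) ^ n = x ^ n + of_nat n * x ^ (n - 1) * z + z\<^sup>2 * R" ..
        have x: "of_nat n * x ^ (n - 1) * x = of_nat n * x ^ n" by (cases n) simp_all
        have "(x + z) ^ Suc n = x ^ Suc n + (of_nat n * x ^ (n - 1) * x) * z + x ^ n * z + z\<^sup>2 * (R * x + of_nat n * x ^ (n - 1) + R * z)"
          by (simp add: R algebra_simps power2_eq_square)
        then show ?case unfolding x
          by (intro exI[of _ "R * x + of_nat n * x ^ (n - 1) + R * z"]) (simp add: algebra_simps)
      qed
      then show thesis using that by blast
    qed
    have "of_nat m * x ^ (m - 1) * z = 2 ^ (i + k + k + 1) * c * (of_nat m' * x ^ (m - 1) * w)"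
      by (simp add: m(1) z_def power_add)
    then have eq: "u - (x + z) ^ m = - (z\<^sup>2 * R)"
      unfolding R w using c by (simp add: algebra_simps)
    have "2 ^ (Suc i + k + k + 1) dvd (2 ^ (i + k + 1) :: padic2) ^ 2"
      unfolding power_mult[symmetric] by (rule le_imp_power_dvd) simp
    also have "(2 ^ (i + k + 1) :: padic2) ^ 2 dvd z\<^sup>2"
      unfolding z_def by (intro dvd_power_same) simp
    finally have "2 ^ (Suc i + k + k + 1) dvd u - (x + z) ^ m" unfolding eq by simp
    moreover have z2: "2 ^ (i + k + 1) dvd z" unfolding z_def by simp
    have "2 dvd z" unfolding z_def by simp
    then have "\<not> 2 dvd x + z" using x by (simp add: dvd_add_left_iff)
    ultimately show "\<exists>y. P (Suc i) y \<and> 2 ^ (i + k + 1) dvd y - x"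
      using z2 by (intro exI[of _ "x + z"]) (simp add: P_def)
  qed
  then obtain x where x: "\<And>i. P i (x i)" "\<And>i. 2 ^ (i + k + 1) dvd x (Suc i) - x i" by blast
  have "2 ^ n dvd x (Suc n) - x n" for n
    using x(2)[of n] by (rule power_le_dvd) simp
  then obtain y where y: "\<And>n. 2 ^ n dvd y - x n" by (rule padic2_complete) blast
  have "y ^ m - u = 0"
  proof (rule padic2_eq_0I)
    fix n
    have "2 ^ n dvd y ^ m - x n ^ m"
      using y[of n] by (metis dvd_trans dvd_triv_left power_diff_sumr2)
    moreover have "2 ^ n dvd u - x n ^ m"
      using conjunct2[OF x(1)[of n, unfolded P_def]] by (rule power_le_dvd) simp
    ultimately have "2 ^ n dvd (y ^ m - x n ^ m) - (u - x n ^ m)" by (rule dvd_diff)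
    then show "2 ^ n dvd y ^ m - u" by simp
  qed
  then show thesis using that by simp
qed

text \<open>
  Squaring raises the distance of a number from 1 by exactly one power of 2, as soon as the number
  is congruent to 1 modulo 4.
\<close>

lemma power_two_power_odd:
  fixes v :: padic2
  assumes v: "v = 1 + 2 ^ i * c" "\<not> 2 dvd c" and i: "i \<ge> 2"
  shows "\<exists>c'. v ^ 2 ^ j = 1 + 2 ^ (i + j) * c' \<and> \<not> 2 dvd c'"
proof (induction j)
  case 0
  show ?case using v by (intro exI[of _ c]) simp
next
  case (Suc j)
  then obtain c' where c': "v ^ 2 ^ j = 1 + 2 ^ (i + j) * c'" "\<not> 2 dvd c'" by blast
  define l where "l = i + j - 2"
  have l: "i + j = Suc (Suc l)" using i by (simp add: l_def)
  define y :: padic2 where "y = 2 ^ l"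
  have pow: "2 ^ (i + j) = 4 * y" "2 ^ (i + Suc j) = 8 * y"
    unfolding add_Suc_right l y_def by simp_all
  have "v ^ 2 ^ Suc j = (1 + 4 * y * c') * (1 + 4 * y * c')"
    using c'(1) unfolding pow by (simp add: mult_2 power_add)
  also have "\<dots> = 1 + 2 ^ (i + Suc j) * (c' + 2 * (y * c' * c'))"
    unfolding pow by (simp add: algebra_simps)
  finally have "v ^ 2 ^ Suc j = 1 + 2 ^ (i + Suc j) * (c' + 2 * (y * c' * c'))" .
  moreover have "\<not> 2 dvd c' + 2 * (y * c' * c')" using c'(2) by (simp add: dvd_add_left_iff)
  ultimately show ?case by blast
qed

text \<open>
  The powers of a number at distance exactly \<open>2\<^sup>i\<close> from 1 are dense in \<open>1 + 2\<^sup>i\<int>\<^sub>2\<close>: if \<open>v\<^sup>e\<close> agrees with \<open>w\<close>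
  modulo \<open>2\<^sup>i\<^sup>+\<^sup>j\<close> but not one digit further, multiplication by \<open>v\<close> to the power \<open>2\<^sup>j\<close> flips the wrong digit.
\<close>

lemma power_dense:
  fixes v w :: padic2
  assumes v: "v = 1 + 2 ^ i * c" "\<not> 2 dvd c" and i: "i \<ge> 2" and w: "2 ^ i dvd w - 1"
  shows "\<exists>e. 2 ^ n dvd v ^ e - w"
proof -
  have vu: "\<not> 2 dvd v"
  proof -
    have "2 dvd 2 ^ i * c" using i by (intro dvd_mult2) simp
    then show ?thesis using two_not_dvd_one unfolding v(1) by (simp add: dvd_add_left_iff)
  qed
  have "\<exists>e. 2 ^ (i + j) dvd v ^ e - w" for j
  proof (induction j)
    case 0
    have "2 ^ i dvd v ^ 0 - w" using w dvd_minus_iff[of "2 ^ i" "w - 1"] by simp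
    then show ?case unfolding add_0_right ..
  next
    case (Suc j)
    then obtain e t where t: "v ^ e - w = 2 ^ (i + j) * t" by (meson dvdE)
    show ?case
    proof (cases "2 dvd t")
      case True
      then have "2 ^ (i + j) * 2 dvd v ^ e - w" unfolding t by (rule mult_dvd_mono[OF dvd_refl])
      then show ?thesis by (auto simp: mult.commute)
    next
      case False
      obtain c' where c': "v ^ 2 ^ j = 1 + 2 ^ (i + j) * c'" "\<not> 2 dvd c'"
        using power_two_power_odd[OF v i, of j] by blast
      have odd: "2 dvd x - 1" if "\<not> 2 dvd x" for x :: padic2 using padic2_parity[of x] that by blast
      have "\<not> 2 dvd v ^ e"
        using vu unfolding padic2_unit_iff[symmetric] by (metis dvd_power_same power_one)
      from odd[OF this] odd[OF False] odd[OF c'(2)]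
      have "2 dvd (t - 1) + (v ^ e - 1) * c' + (c' - 1) + 2"
        by (intro dvd_add dvd_mult2) (assumption | rule dvd_refl)+
      also have "(t - 1) + (v ^ e - 1) * c' + (c' - 1) + 2 = t + v ^ e * c'" by (simp add: algebra_simps)
      finally have "2 ^ (i + j) * 2 dvd 2 ^ (i + j) * (t + v ^ e * c')" by (rule mult_dvd_mono[OF dvd_refl])
      also have "2 ^ (i + j) * (t + v ^ e * c') = (v ^ e - w) + v ^ e * (2 ^ (i + j) * c')"
        unfolding t by (simp add: algebra_simps)
      also have "\<dots> = v ^ (e + 2 ^ j) - w" unfolding power_add c'(1) by (simp add: algebra_simps)
      finally show ?thesis by (auto simp: mult.commute)
    qed
  qed
  then obtain e where "2 ^ (i + n) dvd v ^ e - w" by blast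
  then show ?thesis by (meson power_le_dvd le_add2)
qed

lemma unit_square_mod_8:
  assumes "\<not> 2 dvd (u :: padic2)"
  shows "8 dvd u * u - 1"
proof -
  obtain t where t: "u - 1 = 2 * t" using padic2_parity[of u] assms by (metis dvdE)
  then have u: "u = 1 + 2 * t" by (simp add: algebra_simps)
  have "2 dvd t * (t + 1)"
  proof (rule padic2_parity[of t])
    assume "2 dvd t - 1"
    then have "2 dvd (t - 1) + 2" by (rule dvd_add) simp
    also have "(t - 1) + 2 = t + 1" by simp
    finally show ?thesis by (rule dvd_mult)
  qed simp
  then have "4 * 2 dvd 4 * (t * (t + 1))" by (rule mult_dvd_mono[OF dvd_refl])
  then show ?thesis unfolding u by (simp add: algebra_simps)
qed

lemma four_not_dvd_two: "\<not> 4 dvd (2 :: padic2)"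
proof
  assume "4 dvd (2 :: padic2)"
  then have "(2 :: padic2) * 2 dvd 2 * 1" by simp
  then have "(2 :: padic2) dvd 1"
    unfolding dvd_mult_cancel_left using padic2_power2_nonzero[of 1] by simp
  then show False using two_not_dvd_one by blast
qed

text \<open>
  The two determinants are independent in the group of units modulo squares, that is, modulo 8.
  The last part is the form in which \<open>power_two_power_odd\<close> and \<open>power_dense\<close> use \<open>v\<close>.
\<close>

lemma generator_dets_mod_8:
  fixes u v :: padic2
  assumes u: "4 dvd u - 3" and v: "8 dvd v - 5"
  shows "\<not> 8 dvd u - 1" "\<not> 8 dvd v - 1" "\<not> 8 dvd u * v - 1" "\<exists>c. v = 1 + 4 * c \<and> \<not> 2 dvd c"
proof -
  have 48: "4 dvd x" if "8 dvd x" for x :: padic2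
    using that by (rule dvd_trans[rotated]) (rule dvdI[of _ _ 2], simp)
  have u1: "\<not> 4 dvd u - 1"
  proof
    assume "4 dvd u - 1"
    then have "4 dvd (u - 1) - (u - 3)" using u by (rule dvd_diff)
    then show False using four_not_dvd_two by simp
  qed
  then show "\<not> 8 dvd u - 1" using 48 by blast
  obtain t where "v - 5 = 8 * t" using v by (elim dvdE)
  then have vt: "v = 1 + 4 * (1 + 2 * t)" by (simp add: algebra_simps)
  have odd: "\<not> 2 dvd 1 + 2 * t" by (simp add: padic2_even_simps)
  then show "\<exists>c. v = 1 + 4 * c \<and> \<not> 2 dvd c" using vt by blast
  show "\<not> 8 dvd v - 1"
  proof
    assume "8 dvd v - 1"
    then have "4 * 2 dvd 4 * (1 + 2 * t)" unfolding vt by simp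
    then have "2 dvd 1 + 2 * t"
      unfolding dvd_mult_cancel_left using padic2_power2_nonzero[of 2] by simp
    then show False using odd by blast
  qed
  show "\<not> 8 dvd u * v - 1"
  proof
    assume "8 dvd u * v - 1"
    from dvd_diff[OF 48[OF this] dvd_mult[OF dvd_triv_left]]
    have "4 dvd (u * v - 1) - u * (4 * (1 + 2 * t))" .
    then have "4 dvd u - 1" unfolding vt by (simp add: algebra_simps)
    then show False using u1 by blast
  qed
qed

section \<open>Matrices and their congruences\<close>

definition M2 :: "padic2 \<Rightarrow> padic2 \<Rightarrow> padic2 \<Rightarrow> padic2 \<Rightarrow> mat2" where
  "M2 p q r s = vector [vector [p, q], vector [r, s]]"

lemma M2_nth [simp]:
  "M2 p q r s $ 1 $ 1 = p" "M2 p q r s $ 1 $ 2 = q" "M2 p q r s $ 2 $ 1 = r" "M2 p q r s $ 2 $ 2 = s"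
  by (simp_all add: M2_def vector_def)

lemma M2_cases [case_names M2]:
  obtains p q r s where "A = M2 p q r s"
proof
  show "A = M2 (A $ 1 $ 1) (A $ 1 $ 2) (A $ 2 $ 1) (A $ 2 $ 2)"
    by (simp add: vec_eq_iff forall_2)
qed

lemma M2_eq_iff [simp]: "M2 p q r s = M2 p' q' r' s' \<longleftrightarrow> p = p' \<and> q = q' \<and> r = r' \<and> s = s'"
  by (auto simp: vec_eq_iff forall_2)

lemma mat1_M2: "mat 1 = M2 1 0 0 1"
  by (simp add: vec_eq_iff forall_2 mat_def)

lemma M2_mult: "M2 p q r s ** M2 p' q' r' s' =
    M2 (p * p' + q * r') (p * q' + q * s') (r * p' + s * r') (r * q' + s * s')"
  by (simp add: vec_eq_iff forall_2 matrix_matrix_mult_def sum_2)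

lemma det_M2: "det (M2 p q r s) = p * s - q * r"
  by (simp add: det_2)

lemma M2_adjugate:
  assumes "e * (p * s - q * r) = 1"
  shows "M2 p q r s ** M2 (e * s) (- e * q) (- e * r) (e * p) = mat 1"
    and "M2 (e * s) (- e * q) (- e * r) (e * p) ** M2 p q r s = mat 1"
  using assms by (simp_all add: M2_mult mat1_M2 algebra_simps)

interpretation GL2: group GL2
  by (rule group_GL2)

lemma GL2_simps [simp]: "A \<otimes>\<^bsub>GL2\<^esub> B = A ** B" "\<one>\<^bsub>GL2\<^esub> = mat 1"
  by (simp_all add: GL2_def)

lemma carrier_GL2_iff: "A \<in> carrier GL2 \<longleftrightarrow> det A dvd 1"
proof
  assume "A \<in> carrier GL2"
  then obtain B where "A ** B = mat 1"
    by (auto simp: GL2_def invertible_def)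
  then have "det A * det B = 1" by (metis det_mul det_I)
  then show "det A dvd 1" by (metis dvdI)
next
  assume d: "det A dvd 1"
  obtain p q r s where A: "A = M2 p q r s" by (rule M2_cases)
  obtain e where "1 = (p * s - q * r) * e" using d unfolding A det_M2 by (elim dvdE)
  then have "e * (p * s - q * r) = 1" by (simp add: mult.commute)
  from M2_adjugate[OF this] show "A \<in> carrier GL2"
    unfolding A by (auto simp: GL2_def invertible_def)
qed

lemma M2_carrier_iff: "M2 p q r s \<in> carrier GL2 \<longleftrightarrow> p * s - q * r dvd 1"
  by (simp add: carrier_GL2_iff det_M2)

lemma carrier_GL2_M2_odd: "M2 p q r s \<in> carrier GL2 \<longleftrightarrow> \<not> 2 dvd p * s - q * r"
  by (simp add: M2_carrier_iff padic2_unit_iff)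

lemma inv_M2:
  assumes "e * (p * s - q * r) = 1"
  shows "inv\<^bsub>GL2\<^esub> (M2 p q r s) = M2 (e * s) (- e * q) (- e * r) (e * p)"
proof (rule GL2.inv_equality)
  show "M2 (e * s) (- e * q) (- e * r) (e * p) \<otimes>\<^bsub>GL2\<^esub> M2 p q r s = \<one>\<^bsub>GL2\<^esub>"
    using M2_adjugate(2)[OF assms] by simp
  have "p * s - q * r dvd 1" using assms by (metis dvdI mult.commute)
  then show "M2 p q r s \<in> carrier GL2" by (simp add: carrier_GL2_iff det_M2)
  have "det (M2 (e * s) (- e * q) (- e * r) (e * p)) * det (M2 p q r s) = 1"
    using M2_adjugate(2)[OF assms] by (metis det_mul det_I)
  then show "M2 (e * s) (- e * q) (- e * r) (e * p) \<in> carrier GL2"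
    unfolding carrier_GL2_iff by (metis dvdI)
qed

lemma GL2_inv [simp]:
  assumes "A \<in> carrier GL2"
  shows "A ** inv\<^bsub>GL2\<^esub> A = mat 1" "inv\<^bsub>GL2\<^esub> A ** A = mat 1"
  using GL2.r_inv[OF assms] GL2.l_inv[OF assms] by simp_all

lemma GL2_mult_closed [intro]: "A \<in> carrier GL2 \<Longrightarrow> B \<in> carrier GL2 \<Longrightarrow> A ** B \<in> carrier GL2"
  using GL2.m_closed[of A B] by simp

lemma det_inv_GL2: "A \<in> carrier GL2 \<Longrightarrow> det A * det (inv\<^bsub>GL2\<^esub> A) = 1"
  by (metis GL2_inv(1) det_mul det_I)

text \<open>
  Congruence modulo an arbitrary element, since the moduli below are often products of a power of 2 and
  a scalar that is given only up to a unit.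
\<close>

definition mcong :: "padic2 \<Rightarrow> mat2 \<Rightarrow> mat2 \<Rightarrow> bool" where
  "mcong m A B \<longleftrightarrow> (\<forall>i j. m dvd A $ i $ j - B $ i $ j)"

lemma mcong_M2: "mcong m (M2 p q r s) (M2 p' q' r' s') \<longleftrightarrow>
    m dvd p - p' \<and> m dvd q - q' \<and> m dvd r - r' \<and> m dvd s - s'"
  by (auto simp: mcong_def forall_2)

lemma mcong_refl [simp]: "mcong m A A"
  by (simp add: mcong_def)

lemma mcong_sym: "mcong m A B \<Longrightarrow> mcong m B A"
  unfolding mcong_def using dvd_minus_iff[of m "A $ i $ j - B $ i $ j" for i j] by simp

lemma mcong_trans [trans]: "mcong m A B \<Longrightarrow> mcong m B C \<Longrightarrow> mcong m A C"
  unfolding mcong_def using dvd_add[of m "A $ i $ j - B $ i $ j" "B $ i $ j - C $ i $ j" for i j] by simp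

lemma mcong_dvd: "mcong m A B \<Longrightarrow> k dvd m \<Longrightarrow> mcong k A B"
  unfolding mcong_def by (meson dvd_trans)

lemma mcong_power_le: "mcong (2 ^ n) A B \<Longrightarrow> k \<le> n \<Longrightarrow> mcong (2 ^ k) A B"
  by (erule mcong_dvd) (rule le_imp_power_dvd)

lemma mcong_mult:
  assumes "mcong m A A'" "mcong m B B'"
  shows "mcong m (A ** B) (A' ** B')"
proof -
  have "(A ** B) $ i $ j - (A' ** B') $ i $ j =
      (\<Sum>k\<in>UNIV. (A $ i $ k - A' $ i $ k) * B $ k $ j + A' $ i $ k * (B $ k $ j - B' $ k $ j))" for i j
    by (simp add: matrix_matrix_mult_def sum_subtractf [symmetric] algebra_simps)
  then show ?thesis
    using assms unfolding mcong_def by (auto intro!: dvd_sum dvd_add)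
qed

lemma mcong_det: "mcong m A B \<Longrightarrow> m dvd det A - det B"
proof -
  assume "mcong m A B"
  moreover have "det A - det B = (A $ 1 $ 1 - B $ 1 $ 1) * A $ 2 $ 2 + B $ 1 $ 1 * (A $ 2 $ 2 - B $ 2 $ 2)
      - ((A $ 1 $ 2 - B $ 1 $ 2) * A $ 2 $ 1 + B $ 1 $ 2 * (A $ 2 $ 1 - B $ 2 $ 1))"
    by (simp add: det_2 algebra_simps)
  ultimately show ?thesis by (simp add: mcong_def)
qed

lemma mcong_inv:
  assumes "mcong m A B" and A: "A \<in> carrier GL2" and B: "B \<in> carrier GL2"
  shows "mcong m (inv\<^bsub>GL2\<^esub> A) (inv\<^bsub>GL2\<^esub> B)"
proof -
  have "mcong m (inv\<^bsub>GL2\<^esub> A ** (B ** inv\<^bsub>GL2\<^esub> B)) (inv\<^bsub>GL2\<^esub> A ** (A ** inv\<^bsub>GL2\<^esub> B))"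
    by (intro mcong_mult mcong_refl mcong_sym[OF assms(1)])
  moreover have "inv\<^bsub>GL2\<^esub> A ** (A ** inv\<^bsub>GL2\<^esub> B) = inv\<^bsub>GL2\<^esub> B"
    using A by (simp add: matrix_mul_assoc)
  ultimately show ?thesis using B by simp
qed

lemma mat_residue_eq_iff_mcong: "mat_residue n A = mat_residue n B \<longleftrightarrow> mcong (2 ^ n) A B"
  by (simp add: mat_residue_eq_iff mcong_def residue_eq_iff)

section \<open>Closures and congruence subgroups\<close>

definition GL2_closure :: "mat2 set \<Rightarrow> mat2 set" where
  "GL2_closure S = {A \<in> carrier GL2. \<forall>n. \<exists>B\<in>S. mcong (2 ^ n) A B}"

text \<open>
  Links the topology of the statement to the approximation closure used throughout.
\<close>

lemma closedin_GL2_topology: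
  "closedin GL2_topology K \<longleftrightarrow> K \<subseteq> carrier GL2 \<and> GL2_closure K \<subseteq> K"
proof -
  have top: "topspace GL2_topology = carrier GL2"
    by (simp add: GL2_topology_def)
  have sym: "(\<exists>B\<in>K. mcong m B A) \<longleftrightarrow> (\<exists>B\<in>K. mcong m A B)" for m A
    by (rule bex_cong) (auto intro: mcong_sym)
  have "openin GL2_topology (carrier GL2 - K) \<longleftrightarrow>
      (\<forall>A\<in>carrier GL2. (\<forall>n. \<exists>B\<in>carrier GL2 \<inter> K. mcong (2 ^ n) B A) \<longrightarrow> A \<in> K)"
  proof -
    have "(\<exists>n. \<forall>B\<in>carrier GL2. mcong (2 ^ n) B A \<longrightarrow> B \<in> carrier GL2 - K) \<longleftrightarrow>
        \<not> (\<forall>n. \<exists>B\<in>carrier GL2 \<inter> K. mcong (2 ^ n) B A)" for A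
      by auto
    moreover have "X - K \<subseteq> X \<and> (\<forall>A\<in>X - K. \<not> P A) \<longleftrightarrow> (\<forall>A\<in>X. P A \<longrightarrow> A \<in> K)" for X P
      by blast
    ultimately show ?thesis
      unfolding openin_GL2_topology mat_residue_eq_iff_mcong by (simp only:)
  qed
  note * = this
  show ?thesis
  proof (cases "K \<subseteq> carrier GL2")
    case True
    then have "carrier GL2 \<inter> K = K" by blast
    then show ?thesis
      unfolding closedin_def top * GL2_closure_def using True by (auto simp: sym)
  qed (simp add: closedin_def top)
qed

lemma GL2_closure_increasing: "S \<subseteq> carrier GL2 \<Longrightarrow> S \<subseteq> GL2_closure S"
  unfolding GL2_closure_def using mcong_refl by blast

lemma GL2_closure_idem: "GL2_closure (GL2_closure S) \<subseteq> GL2_closure S"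
  unfolding GL2_closure_def by (auto; meson mcong_trans)

lemma subgroup_GL2_closure:
  assumes "subgroup S GL2"
  shows "subgroup (GL2_closure S) GL2"
proof
  interpret S: subgroup S GL2 by fact
  show "GL2_closure S \<subseteq> carrier GL2" by (auto simp: GL2_closure_def)
  show "\<one>\<^bsub>GL2\<^esub> \<in> GL2_closure S"
    using GL2_closure_increasing[OF S.subset] S.one_closed by blast
  show "A \<otimes>\<^bsub>GL2\<^esub> B \<in> GL2_closure S" if A: "A \<in> GL2_closure S" and B: "B \<in> GL2_closure S" for A B
  proof -
    have "\<exists>C\<in>S. mcong (2 ^ n) (A ** B) C" for n
    proof -
      obtain A' B' where "A' \<in> S" "mcong (2 ^ n) A A'" "B' \<in> S" "mcong (2 ^ n) B B'"
        using A B unfolding GL2_closure_def by blast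
      then show ?thesis using S.m_closed[of A' B'] mcong_mult[of "2 ^ n" A A' B B'] by auto
    qed
    then show ?thesis using A B by (auto simp: GL2_closure_def)
  qed
  show "inv\<^bsub>GL2\<^esub> A \<in> GL2_closure S" if A: "A \<in> GL2_closure S" for A
  proof -
    have "\<exists>C\<in>S. mcong (2 ^ n) (inv\<^bsub>GL2\<^esub> A) C" for n
    proof -
      obtain A' where "A' \<in> S" "mcong (2 ^ n) A A'"
        using A unfolding GL2_closure_def by blast
      then show ?thesis using A S.m_inv_closed[of A'] S.subset
        by (intro bexI[of _ "inv\<^bsub>GL2\<^esub> A'"] mcong_inv) (auto simp: GL2_closure_def)
    qed
    then show ?thesis using A by (auto simp: GL2_closure_def)
  qed
qed

definition congruence_subgroup :: "nat \<Rightarrow> mat2 set" where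
  "congruence_subgroup n = {A \<in> carrier GL2. mcong (2 ^ n) A (mat 1)}"

text \<open>
  Two elements of \<open>H\<close> with the same residues lie in the same coset, and there are finitely many
  residues.
\<close>

lemma finite_index_if_congruence_subgroup:
  assumes H: "subgroup H GL2" and M: "subgroup M GL2" "M \<subseteq> H" and n: "congruence_subgroup n \<subseteq> M"
  shows "finite_index (GL2\<lparr>carrier := H\<rparr>) M"
proof -
  interpret H: subgroup H GL2 by fact
  define res where "res A = (residue (A $ 1 $ 1) n, residue (A $ 1 $ 2) n, residue (A $ 2 $ 1) n, residue (A $ 2 $ 2) n)"
    for A :: mat2
  have res_eq: "mcong (2 ^ n) A B" if "res A = res B" for A B
    using that unfolding res_def mcong_def forall_2 by (auto simp: residue_eq_iff)
  have "res ` H \<subseteq> {0..<2 ^ n} \<times> {0..<2 ^ n} \<times> {0..<2 ^ n} \<times> {0..<2 ^ n}"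
    by (auto simp: res_def residue_nonneg residue_less)
  then have fin: "finite (res ` H)" by (rule finite_subset) auto
  define pick where "pick c = (SOME A. A \<in> H \<and> res A = c)" for c
  have pick: "pick (res A) \<in> H \<and> res (pick (res A)) = res A" if "A \<in> H" for A
    unfolding pick_def by (rule someI[of _ A]) (use that in simp)
  have sub: "M #>\<^bsub>GL2\<^esub> A \<subseteq> M #>\<^bsub>GL2\<^esub> B" if "A \<in> H" "B \<in> H" "res A = res B" for A B
  proof -
    have AB: "A \<in> carrier GL2" "B \<in> carrier GL2" using that by auto
    have "mcong (2 ^ n) (A ** inv\<^bsub>GL2\<^esub> B) (B ** inv\<^bsub>GL2\<^esub> B)"
      using that by (intro mcong_mult res_eq mcong_refl)
    then have "A ** inv\<^bsub>GL2\<^esub> B \<in> M"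
      using AB n GL2_mult_closed[of A "inv\<^bsub>GL2\<^esub> B"] by (auto simp: congruence_subgroup_def)
    moreover have "A = (A ** inv\<^bsub>GL2\<^esub> B) ** B"
      using AB by (simp add: matrix_mul_assoc[symmetric])
    ultimately show ?thesis
      using subgroup.m_closed[OF M(1)] unfolding r_coset_def
      by (auto simp: matrix_mul_assoc) (metis GL2_simps(1) matrix_mul_assoc)
  qed
  have "rcosets\<^bsub>GL2\<lparr>carrier := H\<rparr>\<^esub> M \<subseteq> (\<lambda>c. M #>\<^bsub>GL2\<^esub> pick c) ` (res ` H)"
  proof
    fix X assume "X \<in> rcosets\<^bsub>GL2\<lparr>carrier := H\<rparr>\<^esub> M"
    then obtain A where A: "A \<in> H" "X = M #>\<^bsub>GL2\<^esub> A"
      by (auto simp: RCOSETS_def r_coset_def)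
    then have "X = M #>\<^bsub>GL2\<^esub> pick (res A)"
      using sub[of A "pick (res A)"] sub[of "pick (res A)" A] pick[of A] by auto
    then show "X \<in> (\<lambda>c. M #>\<^bsub>GL2\<^esub> pick c) ` (res ` H)" using A by blast
  qed
  then have "finite (rcosets\<^bsub>GL2\<lparr>carrier := H\<rparr>\<^esub> M)"
    using fin by (meson finite_imageI finite_subset)
  moreover have "subgroup M (GL2\<lparr>carrier := H\<rparr>)"
    by (rule GL2.subgroup_incl[OF M(1) H M(2)])
  ultimately show ?thesis by (simp add: finite_index_def)
qed

lemma congruence_subgroup_mono: "m \<le> n \<Longrightarrow> congruence_subgroup n \<subseteq> congruence_subgroup m"
  using mcong_power_le by (auto simp: congruence_subgroup_def)

text \<open>
  Subgroups that contain a congruence subgroup are open.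
\<close>

lemma mem_subgroup_if_mcong:
  assumes H: "subgroup H GL2" "congruence_subgroup n \<subseteq> H" and h: "h \<in> H"
    and g: "g \<in> carrier GL2" "mcong (2 ^ n) g h"
  shows "g \<in> H"
proof -
  interpret H: subgroup H GL2 by fact
  have hc: "h \<in> carrier GL2" using h by simp
  have "mcong (2 ^ n) (g ** inv\<^bsub>GL2\<^esub> h) (h ** inv\<^bsub>GL2\<^esub> h)" by (intro mcong_mult g mcong_refl)
  then have "g ** inv\<^bsub>GL2\<^esub> h \<in> H"
    using H(2) hc g(1) GL2_mult_closed[of g "inv\<^bsub>GL2\<^esub> h"] by (auto simp: congruence_subgroup_def)
  then have "(g ** inv\<^bsub>GL2\<^esub> h) ** h \<in> H" using H.m_closed[OF _ h] by simp
  moreover have "(g ** inv\<^bsub>GL2\<^esub> h) ** h = g" using hc by (simp add: matrix_mul_assoc[symmetric])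
  ultimately show "g \<in> H" by simp
qed

lemma carrier_GL2_if_mcong:
  assumes "h \<in> carrier GL2" "mcong (2 ^ n) g h" "n \<ge> 1"
  shows "g \<in> carrier GL2"
proof -
  have "2 dvd det g - det h" using power_le_dvd[OF mcong_det[OF assms(2)], of 1] assms(3) by simp
  then show ?thesis
    using assms(1) unfolding carrier_GL2_iff padic2_unit_iff padic2_even_diff by blast
qed

lemma GL2_closure_subset:
  assumes H: "subgroup H GL2" "congruence_subgroup n \<subseteq> H" and S: "S \<subseteq> H"
  shows "GL2_closure S \<subseteq> H"
proof
  fix g assume g: "g \<in> GL2_closure S"
  then obtain h where "h \<in> S" "mcong (2 ^ n) g h" by (auto simp: GL2_closure_def)
  then show "g \<in> H"
    using mem_subgroup_if_mcong[OF H, of h g] g S by (auto simp: GL2_closure_def)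
qed

section \<open>Finite-index subgroups contain congruence subgroups\<close>

text \<open>
  By pigeonhole two of the cosets of \<open>1, g, \<dots>, g\<^sup>N\<close> coincide, where \<open>N\<close> is the index, so some positive
  power of \<open>g\<close> with exponent at most \<open>N\<close> lies in \<open>H\<close>. The factorial of \<open>N\<close> is a common multiple of these
  exponents.
\<close>

lemma finite_index_pow:
  assumes "group G" and H: "finite_index G H"
  shows "\<exists>m :: nat. m > 0 \<and> (\<forall>g\<in>carrier G. g [^]\<^bsub>G\<^esub> m \<in> H)"
proof (intro exI conjI ballI)
  interpret group G by fact
  have sub: "subgroup H G" and fin: "finite (rcosets\<^bsub>G\<^esub> H)" using H by (auto simp: finite_index_def)
  interpret H: subgroup H G by fact
  define N where "N = card (rcosets\<^bsub>G\<^esub> H)"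
  show "fact N > (0 :: nat)" by simp
  fix g assume g: "g \<in> carrier G"
  have "(\<lambda>i. H #>\<^bsub>G\<^esub> (g [^]\<^bsub>G\<^esub> i)) ` {0..N} \<subseteq> rcosets\<^bsub>G\<^esub> H"
    using g by (auto simp: RCOSETS_def)
  then have "card ((\<lambda>i. H #>\<^bsub>G\<^esub> (g [^]\<^bsub>G\<^esub> i)) ` {0..N}) \<le> N"
    unfolding N_def using fin by (rule card_mono[rotated])
  then have "\<not> inj_on (\<lambda>i. H #>\<^bsub>G\<^esub> (g [^]\<^bsub>G\<^esub> i)) {0..N}"
    by (intro pigeonhole) simp
  then obtain i j where ij: "i < j" "j \<le> N" "H #>\<^bsub>G\<^esub> (g [^]\<^bsub>G\<^esub> i) = H #>\<^bsub>G\<^esub> (g [^]\<^bsub>G\<^esub> j)"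
    unfolding inj_on_def by (metis atLeastAtMost_iff linorder_neqE_nat)
  have "g [^]\<^bsub>G\<^esub> j \<in> H #>\<^bsub>G\<^esub> (g [^]\<^bsub>G\<^esub> i)"
    unfolding ij(3) by (rule rcos_self) (use g sub in auto)
  then obtain h where h: "h \<in> H" "g [^]\<^bsub>G\<^esub> j = h \<otimes>\<^bsub>G\<^esub> g [^]\<^bsub>G\<^esub> i"
    by (auto simp: r_coset_def)
  have "g [^]\<^bsub>G\<^esub> j = g [^]\<^bsub>G\<^esub> (j - i) \<otimes>\<^bsub>G\<^esub> g [^]\<^bsub>G\<^esub> i"
    using ij(1) g by (simp add: nat_pow_mult)
  then have "h = g [^]\<^bsub>G\<^esub> (j - i)"
    using h g right_cancel[of "g [^]\<^bsub>G\<^esub> i" h "g [^]\<^bsub>G\<^esub> (j - i)"] by auto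
  then have hH: "g [^]\<^bsub>G\<^esub> (j - i) \<in> H" using h(1) by simp
  have "j - i dvd fact N" using ij by (intro dvd_fact) auto
  then obtain c where "fact N = (j - i) * c" by (elim dvdE)
  then have "g [^]\<^bsub>G\<^esub> (fact N :: nat) = (g [^]\<^bsub>G\<^esub> (j - i)) [^]\<^bsub>G\<^esub> c"
    using g by (simp add: nat_pow_pow)
  also have "\<dots> \<in> H"
    using hH by (induction c) auto
  finally show "g [^]\<^bsub>G\<^esub> (fact N :: nat) \<in> H" .
qed

lemma pow_upper: "M2 1 x 0 1 [^]\<^bsub>GL2\<^esub> n = M2 1 (of_nat n * x) 0 1"
  by (induction n) (simp_all add: mat1_M2 M2_mult algebra_simps)

lemma pow_lower: "M2 1 0 x 1 [^]\<^bsub>GL2\<^esub> n = M2 1 0 (of_nat n * x) 1"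
  by (induction n) (simp_all add: mat1_M2 M2_mult algebra_simps)

lemma pow_diag: "M2 u 0 0 1 [^]\<^bsub>GL2\<^esub> (n :: nat) = M2 (u ^ n) 0 0 1"
  by (induction n) (simp_all add: mat1_M2 M2_mult algebra_simps)

text \<open>
  A factorization whose four parameters are small multiples when the matrix is close to 1: the middle
  factors multiply to a matrix with the required upper left entry \<open>p = 1 + ab\<close>, for any such
  splitting, and the outer ones correct the off-diagonal entries.
\<close>

lemma SL2_elementary_factorization:
  assumes "p * s - q * r = 1" "p = 1 + a * b" "p * i = 1"
  shows "M2 p q r s = M2 1 0 ((r - b) * i) 1 ** (M2 1 a 0 1 ** (M2 1 0 b 1 ** M2 1 ((q - a) * i) 0 1))"
proof -
  have "p * ((q - a) * i) + a = (p * i) * (q - a) + a" by (simp add: algebra_simps)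
  then have q: "p * ((q - a) * i) + a = q" using assms(3) by simp
  have "(r - b) * i * p + b = (p * i) * (r - b) + b" by (simp add: algebra_simps)
  then have r: "(r - b) * i * p + b = r" using assms(3) by simp
  have "(r - b) * i * q + (b * ((q - a) * i) + 1) = i * (q * r - a * b) + 1"
    by (simp add: algebra_simps)
  also have "q * r - a * b = p * s - p" using assms(1,2) by (simp add: algebra_simps)
  also have "i * (p * s - p) + 1 = (p * i) * (s - 1) + 1" by (simp add: algebra_simps)
  also have "\<dots> = s" using assms(3) by simp
  finally have s: "(r - b) * i * q + (b * ((q - a) * i) + 1) = s" .
  have "M2 1 a 0 1 ** (M2 1 0 b 1 ** M2 1 ((q - a) * i) 0 1) = M2 p q b (b * ((q - a) * i) + 1)"
    using q assms(2) by (simp add: M2_mult algebra_simps)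
  then show ?thesis
    using r s by (simp add: M2_mult)
qed

lemma diag_det_factorization:
  assumes h: "h \<in> carrier GL2" "mcong m h (mat 1)"
  obtains \<sigma> where "\<sigma> \<in> carrier GL2" "det \<sigma> = 1" "mcong m \<sigma> (mat 1)" "h = \<sigma> ** M2 (det h) 0 0 1"
proof -
  have du: "det h dvd 1" using h(1) by (simp add: carrier_GL2_iff)
  then obtain e where e: "det h * e = 1" using unit_inverse by blast
  have m: "m dvd det h - 1" using mcong_det[OF h(2)] by simp
  have dgc: "M2 (det h) 0 0 1 \<in> carrier GL2" using du by (simp add: M2_carrier_iff)
  define \<sigma> where "\<sigma> = h ** inv\<^bsub>GL2\<^esub> (M2 (det h) 0 0 1)"
  show thesis
  proof
    show "\<sigma> \<in> carrier GL2" using h(1) dgc by (auto simp: \<sigma>_def)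
    show "h = \<sigma> ** M2 (det h) 0 0 1"
      using h(1) dgc by (simp add: \<sigma>_def matrix_mul_assoc[symmetric])
    then have "det h = det \<sigma> * det h" by (metis det_M2 det_mul mult_1_right mult_zero_left diff_zero)
    then have "det h * e = det \<sigma> * (det h * e)" by (metis mult.assoc)
    then show "det \<sigma> = 1" using e by simp
    have "mcong m (M2 (det h) 0 0 1) (mat 1)" using m by (simp add: mat1_M2 mcong_M2)
    then have "mcong m (inv\<^bsub>GL2\<^esub> (M2 (det h) 0 0 1)) (inv\<^bsub>GL2\<^esub> (mat 1))"
      using dgc GL2.one_closed by (intro mcong_inv) auto
    then show "mcong m \<sigma> (mat 1)"
      using mcong_mult[OF h(2)] GL2.inv_one unfolding \<sigma>_def by fastforce
  qed
qed

text \<open>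
  Finite-index subgroups are open. A fixed power \<open>g\<^sup>m\<close> of every \<open>g\<close> lies in \<open>H\<close>, hence so do all elementary
  matrices with entries divisible by \<open>m\<close>. By \<open>SL2_elementary_factorization\<close> these generate all matrices
  of determinant 1 that are close enough to 1; the determinants close to 1 are \<open>m\<close>-th powers by
  Hensel's lemma.
\<close>

lemma finite_index_contains_congruence_subgroup:
  assumes "finite_index GL2 H"
  obtains n where "congruence_subgroup n \<subseteq> H"
proof -
  interpret H: subgroup H GL2 using assms by (simp add: finite_index_def)
  obtain m :: nat where m: "m > 0" "\<forall>g\<in>carrier GL2. g [^]\<^bsub>GL2\<^esub> m \<in> H"
    using finite_index_pow[OF group_GL2 assms] by blast
  obtain k m' where k: "m = 2 ^ k * m'" "odd m'" using m(1) by (rule power2_odd_decomposition)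
  define \<mu> :: padic2 where "\<mu> = of_nat m"
  have upper: "M2 1 (\<mu> * x) 0 1 \<in> H" for x
    using m(2)[rule_format, of "M2 1 x 0 1"] by (simp add: pow_upper \<mu>_def M2_carrier_iff)
  have lower: "M2 1 0 (\<mu> * x) 1 \<in> H" for x
    using m(2)[rule_format, of "M2 1 0 x 1"] by (simp add: pow_lower \<mu>_def M2_carrier_iff)
  have "\<not> 2 dvd (of_nat m' :: padic2)"
    using k(2) power2_dvd_iff[of 1 "of_nat m'"] by (simp add: residue_of_nat) presburger
  then obtain w where w: "(of_nat m' :: padic2) * w = 1"
    unfolding padic2_unit_iff[symmetric] using unit_inverse by blast
  have 2: "(2 ^ k :: padic2) = \<mu> * w"
    unfolding \<mu>_def k(1) using w by (simp add: mult.assoc)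
  have "(2 ^ (2 * k + 1) :: padic2) = \<mu> * \<mu> * (w * w * 2)"
    unfolding mult_2 power_add 2 by (simp add: ac_simps)
  then have \<mu>2: "\<mu> * \<mu> dvd 2 ^ (2 * k + 1)" by (rule dvdI)
  have "congruence_subgroup (2 * k + 1) \<subseteq> H"
  proof
    fix h assume "h \<in> congruence_subgroup (2 * k + 1)"
    then have h: "h \<in> carrier GL2" "mcong (2 ^ (2 * k + 1)) h (mat 1)"
      by (auto simp: congruence_subgroup_def)
    obtain \<sigma> where \<sigma>: "\<sigma> \<in> carrier GL2" "det \<sigma> = 1" "mcong (2 ^ (2 * k + 1)) \<sigma> (mat 1)"
      and h\<sigma>: "h = \<sigma> ** M2 (det h) 0 0 1"
      using diag_det_factorization[OF h] .
    obtain p q r s where pqrs: "\<sigma> = M2 p q r s" by (rule M2_cases)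
    have dv: "2 ^ (2 * k + 1) dvd p - 1" "2 ^ (2 * k + 1) dvd q" "2 ^ (2 * k + 1) dvd r"
      using \<sigma>(3) unfolding pqrs mat1_M2 mcong_M2 by simp_all
    obtain t where "p - 1 = \<mu> * \<mu> * t" using dvd_trans[OF \<mu>2 dv(1)] by (elim dvdE)
    then have p: "p = 1 + \<mu> * (\<mu> * t)" by (simp add: algebra_simps)
    have "\<mu> dvd 2 ^ (2 * k + 1)" using \<mu>2 by (rule dvd_mult_left)
    then obtain q' r' where q: "q = \<mu> * q'" and r: "r = \<mu> * r'"
      using dv(2,3) by (meson dvdE dvd_trans)
    have "2 dvd p - 1" using dv(1) by (rule dvd_trans[rotated]) simp
    then have "\<not> 2 dvd p" using two_not_dvd_one dvd_diff[of 2 p "p - 1"] by auto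
    then obtain i where i: "p * i = 1" unfolding padic2_unit_iff[symmetric] using unit_inverse by blast
    have det: "p * s - q * r = 1" using \<sigma>(2) by (simp add: pqrs det_M2)
    have eq: "(r - \<mu> * t) * i = \<mu> * ((r' - t) * i)" "(q - \<mu>) * i = \<mu> * ((q' - 1) * i)"
      unfolding q r by (simp_all add: algebra_simps)
    have "\<sigma> = M2 1 0 (\<mu> * ((r' - t) * i)) 1 ** (M2 1 \<mu> 0 1 ** (M2 1 0 (\<mu> * t) 1 ** M2 1 (\<mu> * ((q' - 1) * i)) 0 1))"
      unfolding pqrs eq[symmetric] using det p i by (rule SL2_elementary_factorization)
    also have "\<dots> \<in> H"
      using upper[of 1] upper lower H.m_closed by simp
    finally have "\<sigma> \<in> H" .
    have "2 ^ (2 * k + 1) dvd det h - 1" using mcong_det[OF h(2)] by simp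
    then obtain u where u: "u ^ m = det h" using padic2_hensel_power[OF k] by blast
    have "det h dvd 1" using h(1) by (simp add: carrier_GL2_iff)
    then have "u dvd 1" using u m(1) by (metis dvd_trans dvd_power)
    then have "M2 (det h) 0 0 1 \<in> H"
      using m(2)[rule_format, of "M2 u 0 0 1"] by (simp add: pow_diag u M2_carrier_iff)
    with \<open>\<sigma> \<in> H\<close> show "h \<in> H"
      using H.m_closed[of \<sigma> "M2 (det h) 0 0 1"] h\<sigma> by simp
  qed
  then show thesis by (rule that)
qed

section \<open>Approximation by elements of determinant one\<close>

text \<open>
  \<open>1 + yX\<close> for the trace-zero matrix \<open>X\<close> with first row \<open>(p, q)\<close> and lower left entry \<open>r\<close>.
\<close>

definition tangent :: "padic2 \<Rightarrow> padic2 \<Rightarrow> padic2 \<Rightarrow> padic2 \<Rightarrow> mat2" where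
  "tangent y p q r = M2 (1 + y * p) (y * q) (y * r) (1 - y * p)"

text \<open>
  The group realises every trace-zero direction at level \<open>2\<^sup>n\<close>, up to one more digit, by elements of
  determinant 1.
\<close>

definition full_level :: "mat2 set \<Rightarrow> nat \<Rightarrow> bool" where
  "full_level G n \<longleftrightarrow> (\<forall>p q r. \<exists>g\<in>G. det g = 1 \<and> mcong (2 ^ Suc n) g (tangent (2 ^ n) p q r))"

lemma M2_mcongE:
  assumes "mcong m (M2 p q r s) (M2 p' q' r' s')"
  obtains a b c d where "p = p' + m * a" "q = q' + m * b" "r = r' + m * c" "s = s' + m * d"
proof -
  have "\<exists>t. x = x' + m * t" if "m dvd x - x'" for x x' :: padic2
    using that by (metis add.commute diff_add_cancel dvdE)
  then show thesis using that assms unfolding mcong_M2 by metis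
qed

text \<open>
  Squaring \<open>1 + 2\<^sup>n X\<close> gives \<open>1 + 2\<^sup>n\<^sup>+\<^sup>1 X\<close> up to \<open>2\<^sup>2\<^sup>n\<close>, which is negligible for \<open>n \<ge> 2\<close>. So a group that has all
  directions at one level has them at all deeper levels.
\<close>

lemma full_level_Suc:
  assumes G: "subgroup G GL2" and n: "n \<ge> 2" and full: "full_level G n"
  shows "full_level G (Suc n)"
  unfolding full_level_def
proof (intro allI)
  fix p q r
  obtain g where g: "g \<in> G" "det g = 1" "mcong (2 ^ Suc n) g (tangent (2 ^ n) p q r)"
    using full unfolding full_level_def by blast
  obtain i where i: "n = i + 2" using n by (metis le_Suc_ex add.commute)
  define y z :: padic2 where "y = 2 ^ n" and "z = 2 ^ i"
  have yz: "y = 4 * z" "2 ^ Suc n = 2 * y" "2 ^ Suc (Suc n) = 4 * y"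
    by (simp_all add: y_def z_def i)
  obtain g1 g2 g3 g4 where gM: "g = M2 g1 g2 g3 g4" by (rule M2_cases)
  obtain a b c d where abcd: "g1 = 1 + y * p + 2 * y * a" "g2 = y * q + 2 * y * b"
      "g3 = y * r + 2 * y * c" "g4 = 1 - y * p + 2 * y * d"
    using g(3) unfolding gM tangent_def yz y_def[symmetric] by (rule M2_mcongE)
  define P Q R S where "P = p + 2 * a" and "Q = q + 2 * b" and "R = r + 2 * c" and "S = - p + 2 * d"
  have g': "g1 = 1 + y * P" "g2 = y * Q" "g3 = y * R" "g4 = 1 + y * S"
    unfolding abcd P_def Q_def R_def S_def by (simp_all add: algebra_simps)
  have "g1 * g1 + g2 * g3 - (1 + 2 * y * p) = 4 * y * (a + z * (P * P + Q * R))"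
    unfolding g' by (simp add: yz(1) P_def algebra_simps)
  moreover have "g1 * g2 + g2 * g4 - 2 * y * q = 4 * y * (b + z * (Q * (P + S)))"
    unfolding g' by (simp add: yz(1) Q_def algebra_simps)
  moreover have "g3 * g1 + g4 * g3 - 2 * y * r = 4 * y * (c + z * (R * (P + S)))"
    unfolding g' by (simp add: yz(1) R_def algebra_simps)
  moreover have "g3 * g2 + g4 * g4 - (1 - 2 * y * p) = 4 * y * (d + z * (S * S + Q * R))"
    unfolding g' by (simp add: yz(1) S_def algebra_simps)
  ultimately have "mcong (4 * y) (g ** g) (tangent (2 * y) p q r)"
    unfolding gM M2_mult tangent_def mcong_M2 by simp
  moreover have "g ** g \<in> G" using subgroup.m_closed[OF G g(1) g(1)] by simp
  moreover have "det (g ** g) = 1" using g(2) by (simp add: det_mul)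
  ultimately show "\<exists>g\<in>G. det g = 1 \<and> mcong (2 ^ Suc (Suc n)) g (tangent (2 ^ Suc n) p q r)"
    unfolding yz by blast
qed

lemma full_level_ge:
  assumes "subgroup G GL2" "n \<ge> 2" "full_level G n" "m \<ge> n"
  shows "full_level G m"
  using assms(4) by (induction rule: dec_induct) (use assms full_level_Suc in auto)

text \<open>
  A matrix of determinant 1 close to 1 has a nearly trace-zero direction: the trace of the direction is
  minus \<open>2\<^sup>n\<close> times its determinant.
\<close>

lemma SL2_mcong_tangent:
  assumes "det d = 1" "mcong (2 ^ n) d (mat 1)" "n \<ge> 1"
  obtains p q r where "mcong (2 ^ Suc n) d (tangent (2 ^ n) p q r)"
proof -
  obtain d1 d2 d3 d4 where dM: "d = M2 d1 d2 d3 d4" by (rule M2_cases)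
  define y :: padic2 where "y = 2 ^ n"
  have y: "y \<noteq> 0" "2 dvd y" unfolding y_def using padic2_power2_nonzero[of n] assms(3) by (blast, simp)
  obtain P Q R S where "d1 = 1 + y * P" "d2 = 0 + y * Q" "d3 = 0 + y * R" "d4 = 1 + y * S"
    using assms(2) unfolding dM mat1_M2 y_def[symmetric] by (rule M2_mcongE)
  then have d: "d1 = 1 + y * P" "d2 = y * Q" "d3 = y * R" "d4 = 1 + y * S" by simp_all
  have "y * (P + S + y * (P * S - Q * R)) = det d - 1"
    unfolding dM det_M2 d by (simp add: algebra_simps)
  then have "P + S + y * (P * S - Q * R) = 0" using y assms(1) by simp
  then have "S + P = - (y * (P * S - Q * R))" by (simp add: algebra_simps eq_neg_iff_add_eq_0)
  then have "2 dvd S + P" using y(2) by simp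
  then have "y * 2 dvd y * (S + P)" by (rule mult_dvd_mono[OF dvd_refl])
  then have "mcong (y * 2) d (tangent y P Q R)"
    unfolding dM d tangent_def mcong_M2 by (simp add: algebra_simps)
  then show thesis using that unfolding y_def by (simp add: mult.commute)
qed

text \<open>
  Successive approximation: the quotient of \<open>h\<close> by an approximation modulo \<open>2\<^sup>j\<close> is a tangent matrix at
  level \<open>j\<close>, which the group realises one digit further.
\<close>

lemma full_level_dense:
  assumes G: "subgroup G GL2" and N: "N \<ge> 2" "full_level G N"
    and h: "det h = 1" "mcong (2 ^ N) h (mat 1)"
  shows "h \<in> GL2_closure G"
proof -
  interpret G: subgroup G GL2 by fact
  have hc: "h \<in> carrier GL2" using h by (simp add: carrier_GL2_iff)
  have approx: "\<exists>g\<in>G. det g = 1 \<and> mcong (2 ^ j) h g" if "j \<ge> N" for j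
    using that
  proof (induction rule: dec_induct)
    case base
    show ?case using h G.one_closed by (intro bexI[of _ "mat 1"]) simp_all
  next
    case (step j)
    then obtain g where g: "g \<in> G" "det g = 1" "mcong (2 ^ j) h g" by blast
    have gc: "g \<in> carrier GL2" using g(1) G.subset by blast
    define d where "d = inv\<^bsub>GL2\<^esub> g ** h"
    have gd: "g ** d = h" using gc by (simp add: d_def matrix_mul_assoc)
    have "det d = 1" using gd h(1) g(2) by (metis det_mul mult_1_left)
    have "mcong (2 ^ j) d (inv\<^bsub>GL2\<^esub> g ** g)" unfolding d_def by (intro mcong_mult g mcong_refl)
    then have "mcong (2 ^ j) d (mat 1)" using gc by simp
    then obtain p q r where pqr: "mcong (2 ^ Suc j) d (tangent (2 ^ j) p q r)"
      using SL2_mcong_tangent \<open>det d = 1\<close> step N by (metis One_nat_def Suc_1 Suc_leD le_trans)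
    have "full_level G j" using full_level_ge[OF G N] step by simp
    then obtain g' where g': "g' \<in> G" "det g' = 1" "mcong (2 ^ Suc j) g' (tangent (2 ^ j) p q r)"
      unfolding full_level_def by blast
    have "mcong (2 ^ Suc j) d g'" using pqr g'(3) mcong_sym mcong_trans by blast
    then have "mcong (2 ^ Suc j) h (g ** g')"
      unfolding gd[symmetric] by (intro mcong_mult mcong_refl)
    moreover have "g ** g' \<in> G" using G.m_closed[OF g(1) g'(1)] by simp
    ultimately show ?case using g(2) g'(2) by (intro bexI[of _ "g ** g'"]) (simp_all add: det_mul)
  qed
  have "\<exists>g\<in>G. mcong (2 ^ n) h g" for n
  proof -
    obtain g where "g \<in> G" "mcong (2 ^ max n N) h g" using approx[of "max n N"] by auto
    then show ?thesis using mcong_power_le[of "max n N" h g n] by auto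
  qed
  then show ?thesis using hc by (simp add: GL2_closure_def)
qed

text \<open>
  The direction is realised at scale \<open>y\<close> with relative precision \<open>2\<^sup>k\<close>.
\<close>

definition tangent_in :: "mat2 set \<Rightarrow> nat \<Rightarrow> padic2 \<Rightarrow> padic2 \<Rightarrow> padic2 \<Rightarrow> padic2 \<Rightarrow> bool" where
  "tangent_in G k y p q r \<longleftrightarrow> (\<exists>g\<in>G. det g = 1 \<and> mcong (y * 2 ^ k) g (tangent y p q r))"

text \<open>
  The product of \<open>1 + yX\<close> and \<open>1 + yX'\<close> is \<open>1 + y(X + X')\<close> up to \<open>y\<^sup>2\<close>, and \<open>y\<close> is divisible by \<open>2\<^sup>k\<close>. Together
  with \<open>tangent_in_scale\<close> this makes the realised directions a \<open>\<int>\<^sub>2\<close>-module.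
\<close>

lemma tangent_in_add:
  assumes G: "subgroup G GL2" and k: "2 ^ k dvd y"
    and g: "tangent_in G k y p q r" and h: "tangent_in G k y p' q' r'"
  shows "tangent_in G k y (p + p') (q + q') (r + r')"
proof -
  obtain g h where g: "g \<in> G" "det g = 1" "mcong (y * 2 ^ k) g (tangent y p q r)"
    and h: "h \<in> G" "det h = 1" "mcong (y * 2 ^ k) h (tangent y p' q' r')"
    using g h unfolding tangent_in_def by blast
  obtain z where z: "y = 2 ^ k * z" using k by (elim dvdE)
  have "mcong (y * 2 ^ k) (tangent y p q r ** tangent y p' q' r') (tangent y (p + p') (q + q') (r + r'))"
  proof -
    have "(1 + y * p) * (1 + y * p') + y * q * (y * r') - (1 + y * (p + p')) = y * y * (p * p' + q * r')"
      "(1 + y * p) * (y * q') + y * q * (1 - y * p') - y * (q + q') = y * y * (p * q' - q * p')"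
      "y * r * (1 + y * p') + (1 - y * p) * (y * r') - y * (r + r') = y * y * (r * p' - p * r')"
      "y * r * (y * q') + (1 - y * p) * (1 - y * p') - (1 - y * (p + p')) = y * y * (r * q' + p * p')"
      by (simp_all add: algebra_simps)
    moreover have "y * 2 ^ k dvd y * y * c" for c
      using k by (simp add: mult.assoc mult_dvd_mono)
    ultimately show ?thesis
      unfolding tangent_def M2_mult mcong_M2 by simp
  qed
  then have "mcong (y * 2 ^ k) (g ** h) (tangent y (p + p') (q + q') (r + r'))"
    using mcong_mult[OF g(3) h(3)] mcong_trans by blast
  moreover have "g ** h \<in> G" using subgroup.m_closed[OF G g(1) h(1)] by simp
  ultimately show ?thesis
    unfolding tangent_in_def using g(2) h(2) by (intro bexI[of _ "g ** h"]) (simp_all add: det_mul)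
qed

lemma tangent_in_cong:
  assumes "tangent_in G k y p q r" "2 ^ k dvd p - p'" "2 ^ k dvd q - q'" "2 ^ k dvd r - r'"
  shows "tangent_in G k y p' q' r'"
proof -
  have "y * 2 ^ k dvd y * (p - p')" "y * 2 ^ k dvd y * (q - q')" "y * 2 ^ k dvd y * (r - r')"
    using assms by (auto intro!: mult_dvd_mono)
  moreover from this(1) have "y * 2 ^ k dvd - (y * (p - p'))" by simp
  ultimately have "mcong (y * 2 ^ k) (tangent y p q r) (tangent y p' q' r')"
    unfolding tangent_def mcong_M2 by (simp add: algebra_simps)
  then show ?thesis using assms(1) mcong_trans unfolding tangent_in_def by blast
qed

lemma tangent_in_scale:
  assumes G: "subgroup G GL2" and k: "2 ^ k dvd y" and g: "tangent_in G k y p q r"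
  shows "tangent_in G k y (c * p) (c * q) (c * r)"
proof -
  have nat: "tangent_in G k y (of_nat n * p) (of_nat n * q) (of_nat n * r)" for n
  proof (induction n)
    case 0
    show ?case unfolding tangent_in_def
      by (intro bexI[of _ "mat 1"]) (use subgroup.one_closed[OF G] in \<open>simp_all add: tangent_def mat1_M2 [symmetric]\<close>)
  next
    case (Suc n)
    show ?case using tangent_in_add[OF G k g Suc] by (simp add: algebra_simps)
  qed
  obtain n where n: "2 ^ k dvd c - of_nat n" using padic2_nat_approx by blast
  then have "2 ^ k dvd of_nat n - c" using dvd_minus_iff[of "2 ^ k" "c - of_nat n"] by simp
  then have "2 ^ k dvd of_nat n * x - c * x" for x
    by (metis left_diff_distrib dvd_mult2)
  then show ?thesis using tangent_in_cong[OF nat] by blast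
qed

definition det3 :: "'a \<times> 'a \<times> 'a \<Rightarrow> 'a \<times> 'a \<times> 'a \<Rightarrow> 'a \<times> 'a \<times> 'a \<Rightarrow> 'a :: comm_ring_1" where
  "det3 = (\<lambda>(a, b, c) (a', b', c') (a'', b'', c''). a * (b' * c'' - b'' * c') - b * (a' * c'' - a'' * c') + c * (a' * b'' - a'' * b'))"

lemma cramer3:
  fixes p q r p1 q1 r1 p2 q2 r2 p3 q3 r3 :: "'a :: comm_ring_1"
  defines "d1 \<equiv> det3 (p, q, r) (p2, q2, r2) (p3, q3, r3)" and "d2 \<equiv> det3 (p1, q1, r1) (p, q, r) (p3, q3, r3)"
    and "d3 \<equiv> det3 (p1, q1, r1) (p2, q2, r2) (p, q, r)" and "d \<equiv> det3 (p1, q1, r1) (p2, q2, r2) (p3, q3, r3)"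
  shows "d1 * p1 + d2 * p2 + d3 * p3 = d * p"
    and "d1 * q1 + d2 * q2 + d3 * q3 = d * q"
    and "d1 * r1 + d2 * r2 + d3 * r3 = d * r"
  unfolding assms det3_def split_conv by (simp_all add: algebra_simps)

text \<open>
  By Cramer's rule the span of the three directions contains \<open>2\<^sup>e\<close> times every trace-zero direction. Since \<open>e < k\<close>,
  the factor \<open>2\<^sup>e\<close> can be absorbed into the level, and one digit of precision remains.
\<close>

lemma full_level_if_independent_tangents:
  assumes G: "subgroup G GL2"
    and t: "tangent_in G k y p1 q1 r1" "tangent_in G k y p2 q2 r2" "tangent_in G k y p3 q3 r3"
    and y: "y \<noteq> 0" "2 ^ k dvd y" and k: "k \<ge> 2"
    and det: "det3 (p1, q1, r1) (p2, q2, r2) (p3, q3, r3) = 2 ^ e * u" "u dvd 1" "e < k"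
  shows "\<exists>N\<ge>2. full_level G N"
proof -
  obtain v w where v: "y = 2 ^ v * w" "w dvd 1" using y(1) by (rule padic2_valuation)
  obtain w' u' where inv: "w * w' = 1" "u * u' = 1" using v(2) det(2) by (metis dvdE)
  have vk: "k \<le> v"
  proof (rule ccontr)
    assume "\<not> k \<le> v"
    then have "2 ^ Suc v dvd y" using y(2) power_le_dvd[of 2 k y "Suc v"] by simp
    then have "2 ^ (v + 1) dvd 2 ^ v * w" using v(1) by simp
    then have "2 ^ v * 2 dvd 2 ^ v * w" by (simp only: power_add power_one_right)
    then have "2 dvd w" unfolding dvd_mult_cancel_left using padic2_power2_nonzero[of v] by blast
    then show False using v(2) by (simp add: padic2_unit_iff)
  qed
  have all: "tangent_in G k y (2 ^ e * u * c * p) (2 ^ e * u * c * q) (2 ^ e * u * c * r)" for c p q r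
  proof -
    note lin = tangent_in_add[OF G y(2)] and sc = tangent_in_scale[OF G y(2)]
    define \<alpha> \<beta> \<gamma> where "\<alpha> = det3 (p, q, r) (p2, q2, r2) (p3, q3, r3)"
      and "\<beta> = det3 (p1, q1, r1) (p, q, r) (p3, q3, r3)"
      and "\<gamma> = det3 (p1, q1, r1) (p2, q2, r2) (p, q, r)"
    have "tangent_in G k y (\<alpha> * p1 + \<beta> * p2 + \<gamma> * p3) (\<alpha> * q1 + \<beta> * q2 + \<gamma> * q3) (\<alpha> * r1 + \<beta> * r2 + \<gamma> * r3)"
      by (intro lin sc t)
    then have "tangent_in G k y (2 ^ e * u * p) (2 ^ e * u * q) (2 ^ e * u * r)"
      unfolding \<alpha>_def \<beta>_def \<gamma>_def cramer3 det(1) .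
    from sc[OF this, of c] show ?thesis by (simp add: ac_simps)
  qed
  have "full_level G (v + e)"
    unfolding full_level_def
  proof (intro allI)
    fix p q r
    have eq: "2 ^ e * u * (u' * w') = 2 ^ e * w'"
    proof -
      have "2 ^ e * u * (u' * w') = 2 ^ e * (u * u') * w'" by (simp only: ac_simps)
      then show ?thesis using inv by simp
    qed
    have yw: "y * (2 ^ e * w' * x) = 2 ^ (v + e) * x" for x
    proof -
      have "y * (2 ^ e * w' * x) = 2 ^ v * 2 ^ e * (w * w') * x" unfolding v(1) by (simp only: ac_simps)
      then show ?thesis using inv by (simp add: power_add)
    qed
    \<comment> \<open>The factor \<open>u'w'\<close> cancels the units in the determinant and in \<open>y\<close>.\<close>
    obtain g where g: "g \<in> G" "det g = 1"
      "mcong (y * 2 ^ k) g (tangent y (2 ^ e * w' * p) (2 ^ e * w' * q) (2 ^ e * w' * r))"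
      using all[of "u' * w'" p q r] unfolding eq tangent_in_def by blast
    have "2 ^ Suc (v + e) dvd (2 ^ (v + k) :: padic2)" using det(3) by (intro le_imp_power_dvd) simp
    also have "2 ^ (v + k) dvd y * 2 ^ k" by (simp add: v(1) power_add)
    finally have "mcong (2 ^ Suc (v + e)) g (tangent y (2 ^ e * w' * p) (2 ^ e * w' * q) (2 ^ e * w' * r))"
      using g(3) mcong_dvd by blast
    moreover have "tangent y (2 ^ e * w' * p) (2 ^ e * w' * q) (2 ^ e * w' * r) = tangent (2 ^ (v + e)) p q r"
      unfolding tangent_def yw by simp
    ultimately show "\<exists>g\<in>G. det g = 1 \<and> mcong (2 ^ Suc (v + e)) g (tangent (2 ^ (v + e)) p q r)"
      using g by auto
  qed
  moreover have "v + e \<ge> 2" using vk k by simp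
  ultimately show ?thesis by blast
qed

section \<open>Pairs that generate an open subgroup\<close>

text \<open>
  For \<open>A = x + ya\<close> with trace \<open>T\<close> the Cayley-Hamilton theorem gives \<open>A\<^sup>2 = TA - det A\<close>, so the coefficient
  of \<open>a\<close> in \<open>A\<^sup>2\<close> is \<open>Ty\<close>. The trace of \<open>A\<^sup>2\<close> is \<open>T\<^sup>2 - 2 det A\<close>; it cannot vanish, because \<open>T\<close> is even and
  \<open>det A\<close> is odd. So repeated squaring never reaches a scalar matrix, while it converges to 1.
\<close>

lemma near_identity_powers:
  assumes G: "subgroup G GL2" and a: "M2 p q r s \<in> G" and tr: "2 dvd p + s" "p + s \<noteq> 0"
  obtains x y where "M2 (x + y * p) (y * q) (y * r) (x + y * s) \<in> G"
    "mcong (2 ^ k) (M2 (x + y * p) (y * q) (y * r) (x + y * s)) (mat 1)"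
    "2 ^ k dvd y" "y \<noteq> 0"
    "det (M2 (x + y * p) (y * q) (y * r) (x + y * s)) = (p * s - q * r) ^ 2 ^ k"
proof -
  define d where "d = p * s - q * r"
  define A where "A x y = M2 (x + y * p) (y * q) (y * r) (x + y * s)" for x y
  define T where "T x y = 2 * x + y * (p + s)" for x y
  have "d dvd 1" using a subgroup.subset[OF G] by (auto simp: d_def M2_carrier_iff)
  then have d_unit: "d ^ n dvd 1" for n by (metis dvd_power_same power_one)
  have "\<exists>x y. A x y \<in> G \<and> mcong (2 ^ k) (A x y) (mat 1) \<and> 2 ^ k dvd y \<and> y \<noteq> 0 \<and>
      det (A x y) = d ^ 2 ^ k \<and> 2 dvd T x y \<and> T x y \<noteq> 0"
  proof (induction k)
    case 0
    show ?case
      using a tr by (intro exI[of _ 0] exI[of _ 1]) (auto simp: A_def T_def d_def det_M2 mcong_def)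
  next
    case (Suc k)
    then obtain x y where A: "A x y \<in> G" "mcong (2 ^ k) (A x y) (mat 1)" "2 ^ k dvd y" "y \<noteq> 0"
      "det (A x y) = d ^ 2 ^ k" "2 dvd T x y" "T x y \<noteq> 0" by blast
    define x' y' where "x' = x * x - y * y * d" and "y' = y * T x y"
    have sq: "A x y ** A x y = A x' y'"
      unfolding A_def M2_mult x'_def y'_def T_def d_def by (simp add: algebra_simps)
    define E where "E = (x + y * p - 1) * (x + y * s - 1) - y * q * (y * r)"
    have det: "det (A x y) = (x + y * p) * (x + y * s) - y * q * (y * r)"
      unfolding A_def det_M2 ..
    \<comment> \<open>\<open>E\<close> is \<open>det (A - 1) = 1 - T + det A\<close>, so \<open>A\<^sup>2 - 1 = T(A - 1) - E\<close>.\<close>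
    have E: "2 ^ Suc k dvd E"
    proof (cases k)
      case 0
      have "2 dvd det (A x y) - 1"
        using d_unit[of "2 ^ k"] A(5) padic2_parity[of "det (A x y)"] padic2_unit_iff by metis
      from dvd_diff[OF dvd_add[OF this dvd_triv_left[of 2 1]] A(6)]
      have "2 dvd (det (A x y) - 1) + 2 * 1 - T x y" .
      also have "(det (A x y) - 1) + 2 * 1 - T x y = E"
        unfolding det E_def T_def by (simp add: algebra_simps)
      finally show ?thesis using 0 by simp
    next
      case (Suc l)
      have "2 ^ k * 2 ^ k dvd E"
        using A(2) unfolding E_def A_def mat1_M2 mcong_M2 by (auto intro!: dvd_diff mult_dvd_mono)
      moreover have "(2 ^ Suc k :: padic2) dvd 2 ^ k * 2 ^ k"
        unfolding power_add[symmetric] by (rule le_imp_power_dvd) (simp add: Suc)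
      ultimately show ?thesis by (rule dvd_trans[rotated])
    qed
    have TA: "2 ^ Suc k dvd T x y * z" if "2 ^ k dvd z" for z
      using mult_dvd_mono[OF A(6) that] by simp
    have "mcong (2 ^ Suc k) (A x' y') (mat 1)"
    proof -
      have eqs: "x' + y' * p - 1 = T x y * (x + y * p - 1) - E" "y' * q = T x y * (y * q)"
        "y' * r = T x y * (y * r)" "x' + y' * s - 1 = T x y * (x + y * s - 1) - E"
        unfolding x'_def y'_def T_def d_def E_def by (simp_all add: algebra_simps)
      have "2 ^ k dvd x + y * p - 1" "2 ^ k dvd y * q" "2 ^ k dvd y * r" "2 ^ k dvd x + y * s - 1"
        using A(2) unfolding A_def mat1_M2 mcong_M2 by simp_all
      then show ?thesis
        unfolding A_def mat1_M2 mcong_M2 diff_zero eqs using E TA by (blast intro: dvd_diff)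
    qed
    moreover have "A x' y' \<in> G" using sq subgroup.m_closed[OF G A(1) A(1)] by simp
    moreover have "2 ^ Suc k dvd y'" using TA[OF A(3)] by (simp add: y'_def mult.commute)
    moreover have "y' \<noteq> 0" using A by (simp add: y'_def)
    moreover have "det (A x' y') = d ^ 2 ^ Suc k"
      unfolding sq[symmetric] det_mul A(5) by (simp add: power_add[symmetric] mult_2)
    moreover have T': "T x' y' = T x y * T x y - 2 * det (A x y)"
      unfolding det T_def x'_def y'_def d_def by (simp add: algebra_simps)
    moreover have "2 dvd T x' y'" unfolding T' using A(6) by (intro dvd_diff) simp_all
    \<comment> \<open>Otherwise \<open>T\<^sup>2 = 2 det A\<close>, and \<open>det A\<close> would be even.\<close>
    moreover have "T x' y' \<noteq> 0"
    proof
      assume "T x' y' = 0"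
      moreover obtain t where "T x y = 2 * t" using A(6) by (elim dvdE)
      ultimately have "2 * (2 * (t * t)) = 2 * det (A x y)" unfolding T' by (simp add: algebra_simps)
      then have "2 * (t * t) = det (A x y)"
        unfolding mult_cancel_left using padic2_power2_nonzero[of 1] by simp
      then have "2 dvd det (A x y)" by (metis dvdI)
      then show False using d_unit[of "2 ^ k"] A(5) padic2_unit_iff by metis
    qed
    ultimately show ?case by blast
  qed
  then show thesis using that unfolding A_def d_def by blast
qed

text \<open>
  The identity \<open>ABA\<^sup>-\<^sup>1B\<^sup>-\<^sup>1 = 1 + (AB - BA)A\<^sup>-\<^sup>1B\<^sup>-\<^sup>1\<close> is exact, and \<open>A\<^sup>-\<^sup>1B\<^sup>-\<^sup>1\<close> is close to 1. The error is therefore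
  smaller by a factor \<open>2\<^sup>k\<close> than the main term, however small \<open>y\<close> is.
\<close>

lemma tangent_in_commutator:
  assumes G: "subgroup G GL2" and A: "A \<in> G" "mcong (2 ^ k) A (mat 1)" and B: "B \<in> G" "mcong (2 ^ k) B (mat 1)"
    and BA: "B ** A = M2 e f g h" and AB: "A ** B = M2 (e + y * p) (f + y * q) (g + y * r) (h - y * p)"
  shows "tangent_in G k y p q r"
proof -
  have car: "A \<in> carrier GL2" "B \<in> carrier GL2" using A(1) B(1) subgroup.subset[OF G] by auto
  obtain c1 c2 c3 c4 where C: "inv\<^bsub>GL2\<^esub> A ** inv\<^bsub>GL2\<^esub> B = M2 c1 c2 c3 c4" by (rule M2_cases)
  have "(B ** A) ** (inv\<^bsub>GL2\<^esub> A ** inv\<^bsub>GL2\<^esub> B) = B ** (A ** inv\<^bsub>GL2\<^esub> A) ** inv\<^bsub>GL2\<^esub> B"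
    by (simp add: matrix_mul_assoc)
  also have "\<dots> = mat 1" using car by simp
  finally have one: "e * c1 + f * c3 = 1" "e * c2 + f * c4 = 0" "g * c1 + h * c3 = 0" "g * c2 + h * c4 = 1"
    unfolding BA C M2_mult mat1_M2 M2_eq_iff by simp_all
  have "mcong (2 ^ k) (inv\<^bsub>GL2\<^esub> A ** inv\<^bsub>GL2\<^esub> B) (inv\<^bsub>GL2\<^esub> (mat 1) ** inv\<^bsub>GL2\<^esub> (mat 1))"
    using car A(2) B(2) GL2.one_closed by (intro mcong_mult mcong_inv) simp_all
  then have "mcong (2 ^ k) (M2 c1 c2 c3 c4) (M2 1 0 0 1)"
    using GL2.inv_one unfolding C by (simp add: mat1_M2 M2_mult)
  then have c: "2 ^ k dvd c1 - 1" "2 ^ k dvd c2" "2 ^ k dvd c3" "2 ^ k dvd c4 - 1"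
    by (simp_all add: mcong_M2)
  define D where "D = (A ** B) ** (inv\<^bsub>GL2\<^esub> A ** inv\<^bsub>GL2\<^esub> B)"
  have D: "D = M2 (1 + y * (p * c1 + q * c3)) (y * (p * c2 + q * c4)) (y * (r * c1 - p * c3)) (1 + y * (r * c2 - p * c4))"
    unfolding D_def AB C M2_mult M2_eq_iff one(1)[symmetric]
    using one(2,3) one(4)[unfolded one(1)[symmetric]] by (auto simp: algebra_simps)
  have "p * c1 + q * c3 - p = p * (c1 - 1) + q * c3" "p * c2 + q * c4 - q = p * c2 + q * (c4 - 1)"
    "r * c1 - p * c3 - r = r * (c1 - 1) - p * c3" "r * c2 - p * c4 - (- p) = r * c2 - p * (c4 - 1)"
    by (simp_all add: algebra_simps)
  then have "2 ^ k dvd p * c1 + q * c3 - p" "2 ^ k dvd p * c2 + q * c4 - q"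
    "2 ^ k dvd r * c1 - p * c3 - r" "2 ^ k dvd r * c2 - p * c4 - (- p)"
    using c by (metis dvd_add dvd_diff dvd_mult)+
  then have "y * 2 ^ k dvd y * (p * c1 + q * c3 - p)" "y * 2 ^ k dvd y * (p * c2 + q * c4 - q)"
    "y * 2 ^ k dvd y * (r * c1 - p * c3 - r)" "y * 2 ^ k dvd y * (r * c2 - p * c4 - (- p))"
    by (simp_all add: mult_dvd_mono del: diff_minus_eq_add)
  then have "mcong (y * 2 ^ k) D (tangent y p q r)"
    unfolding D tangent_def mcong_M2 by (simp add: algebra_simps)
  moreover have "D \<in> G"
    using subgroup.m_closed[OF G subgroup.m_closed[OF G A(1) B(1)] subgroup.m_closed[OF G subgroup.m_inv_closed[OF G A(1)] subgroup.m_inv_closed[OF G B(1)]]]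
    by (simp add: D_def)
  moreover have "det D = 1"
  proof -
    have "det D = (det A * det (inv\<^bsub>GL2\<^esub> A)) * (det B * det (inv\<^bsub>GL2\<^esub> B))"
      unfolding D_def det_mul by (simp only: ac_simps)
    then show ?thesis using car by (simp add: det_inv_GL2)
  qed
  ultimately show ?thesis unfolding tangent_in_def by blast
qed

text \<open>
  The new parameters are the entries of \<open>aWa\<^sup>-\<^sup>1\<close>, where \<open>W\<close> has the entries \<open>w1\<close>, \<open>w2\<close>, \<open>w3\<close>, \<open>-w1\<close>.
\<close>

lemma tangent_in_conj:
  assumes G: "subgroup G GL2" and a: "M2 p q r s \<in> G" "d * (p * s - q * r) = 1" and t: "tangent_in G k y w1 w2 w3"
  shows "tangent_in G k y (d * ((p * w1 + q * w3) * s - (p * w2 - q * w1) * r))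
      (d * ((p * w2 - q * w1) * p - (p * w1 + q * w3) * q))
      (d * ((r * w1 + s * w3) * s - (r * w2 - s * w1) * r))"
    (is "tangent_in G k y ?c1 ?c2 ?c3")
proof -
  define a where "a = M2 p q r s"
  have aG: "a \<in> G" using a(1) by (simp add: a_def)
  then have ac: "a \<in> carrier GL2" using subgroup.subset[OF G] by auto
  obtain g where g: "g \<in> G" "det g = 1" "mcong (y * 2 ^ k) g (tangent y w1 w2 w3)"
    using t unfolding tangent_in_def by blast
  have "a ** tangent y w1 w2 w3 ** inv\<^bsub>GL2\<^esub> a = tangent y ?c1 ?c2 ?c3"
  proof -
    have "(p * (1 + y * w1) + q * (y * w3)) * (d * s) + (p * (y * w2) + q * (1 - y * w1)) * (- d * r)
      = d * (p * s - q * r) + y * ?c1"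
      "(p * (1 + y * w1) + q * (y * w3)) * (- d * q) + (p * (y * w2) + q * (1 - y * w1)) * (d * p) = y * ?c2"
      "(r * (1 + y * w1) + s * (y * w3)) * (d * s) + (r * (y * w2) + s * (1 - y * w1)) * (- d * r) = y * ?c3"
      "(r * (1 + y * w1) + s * (y * w3)) * (- d * q) + (r * (y * w2) + s * (1 - y * w1)) * (d * p)
      = d * (p * s - q * r) - y * ?c1"
      by (simp_all add: algebra_simps)
    then show ?thesis
      unfolding a_def inv_M2[OF a(2)] tangent_def M2_mult a(2) by simp
  qed
  moreover have "mcong (y * 2 ^ k) (a ** g ** inv\<^bsub>GL2\<^esub> a) (a ** tangent y w1 w2 w3 ** inv\<^bsub>GL2\<^esub> a)"
    by (intro mcong_mult g mcong_refl)
  moreover have "a ** g ** inv\<^bsub>GL2\<^esub> a \<in> G"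
    using subgroup.m_closed[OF G subgroup.m_closed[OF G aG g(1)] subgroup.m_inv_closed[OF G aG]] by simp
  moreover have "det (a ** g ** inv\<^bsub>GL2\<^esub> a) = 1"
  proof -
    have "det (a ** g ** inv\<^bsub>GL2\<^esub> a) = (det a * det (inv\<^bsub>GL2\<^esub> a)) * det g"
      unfolding det_mul by (simp only: ac_simps)
    then show ?thesis using ac g by (simp add: det_inv_GL2)
  qed
  ultimately show ?thesis unfolding tangent_in_def by metis
qed

text \<open>
  Here \<open>w1\<close>, \<open>w2\<close>, \<open>w3\<close> are the entries of \<open>W = ab - ba\<close>, and the other two rows belong to the products of
  \<open>aW\<close> and \<open>bW\<close> with the adjugates of \<open>a\<close> and \<open>b\<close>. As \<open>aW\<close> has trace zero, its product with the adjugate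
  of \<open>a\<close> is \<open>tr a \<cdot> aW - det a \<cdot> W\<close>, which reduces the claim to the rows \<open>W\<close>, \<open>aW\<close>, \<open>bW\<close>. Their
  determinant is linear in the \<open>2 \<times> 2\<close> minors of the rows \<open>(p - s, q, r)\<close> and \<open>(x - w, y, z)\<close>, which are the
  entries of \<open>W\<close> up to sign.
\<close>

lemma det3_conjugates:
  fixes p q r s x y z w :: "'a :: comm_ring_1"
  defines "w1 \<equiv> q * z - r * y" and "w2 \<equiv> y * (p - s) - q * (x - w)" and "w3 \<equiv> r * (x - w) - z * (p - s)"
  shows "det3 (w1, w2, w3)
      ((p * w1 + q * w3) * s - (p * w2 - q * w1) * r, (p * w2 - q * w1) * p - (p * w1 + q * w3) * q, (r * w1 + s * w3) * s - (r * w2 - s * w1) * r)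
      ((x * w1 + y * w3) * w - (x * w2 - y * w1) * z, (x * w2 - y * w1) * x - (x * w1 + y * w3) * y, (z * w1 + w * w3) * w - (z * w2 - w * w1) * z)
    = - ((p + s) * (x + w) * (w1 * w1 + w2 * w3)\<^sup>2)"
proof -
  define d d' where "d = p * s - q * r" and "d' = x * w - y * z"
  have a: "p * w1 + q * w3 + r * w2 - s * w1 = 0" "x * w1 + y * w3 + z * w2 - w * w1 = 0"
    unfolding w1_def w2_def w3_def by (simp_all add: algebra_simps)
  have c: "(p * w1 + q * w3) * s - (p * w2 - q * w1) * r = (p + s) * (p * w1 + q * w3) - d * w1"
    "(p * w2 - q * w1) * p - (p * w1 + q * w3) * q = (p + s) * (p * w2 - q * w1) - d * w2"
    "(r * w1 + s * w3) * s - (r * w2 - s * w1) * r = (p + s) * (r * w1 + s * w3) - d * w3"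
    unfolding d_def w1_def w2_def w3_def by (simp_all add: algebra_simps)
  have c': "(x * w1 + y * w3) * w - (x * w2 - y * w1) * z = (x + w) * (x * w1 + y * w3) - d' * w1"
    "(x * w2 - y * w1) * x - (x * w1 + y * w3) * y = (x + w) * (x * w2 - y * w1) - d' * w2"
    "(z * w1 + w * w3) * w - (z * w2 - w * w1) * z = (x + w) * (z * w1 + w * w3) - d' * w3"
    unfolding d'_def w1_def w2_def w3_def by (simp_all add: algebra_simps)
  \<comment> \<open>Multiples of the first row can be removed from the other rows.\<close>
  have lin: "det3 (a1, a2, a3) (t * b1 - u * a1, t * b2 - u * a2, t * b3 - u * a3) (t' * c1 - u' * a1, t' * c2 - u' * a2, t' * c3 - u' * a3)
      = t * t' * det3 (a1, a2, a3) (b1, b2, b3) (c1, c2, c3)" for a1 a2 a3 b1 b2 b3 c1 c2 c3 t t' u u' :: 'a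
    unfolding det3_def by (simp add: algebra_simps)
  have "det3 (v1, v2, v3) (p * v1 + q * v3, p * v2 - q * v1, r * v1 + s * v3) (x * v1 + y * v3, x * v2 - y * v1, z * v1 + w * v3)
      = - ((v1 * v1 + v2 * v3) * (v1 * (q * z - r * y) + v3 * (y * (p - s) - q * (x - w))))" for v1 v2 v3
    unfolding det3_def split_conv by (simp add: algebra_simps)
  from this[of w1 w2 w3]
  have "det3 (w1, w2, w3) (p * w1 + q * w3, p * w2 - q * w1, r * w1 + s * w3) (x * w1 + y * w3, x * w2 - y * w1, z * w1 + w * w3)
      = - ((w1 * w1 + w2 * w3)\<^sup>2)"
    unfolding w1_def[symmetric] w2_def[symmetric] by (simp add: power2_eq_square mult.commute)
  then show ?thesis unfolding c c' lin by simp
qed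

text \<open>
  The last hypothesis says that \<open>det W \<noteq> 0\<close> for \<open>W = ab - ba\<close>, equivalently that \<open>a\<close> and \<open>b\<close> have no
  common eigenvector over an algebraic closure.
\<close>

lemma full_level_if_generic_pair:
  assumes G: "subgroup G GL2" and a: "M2 p q r s \<in> G" and b: "M2 x y z w \<in> G"
    and tr: "2 dvd p + s" "p + s \<noteq> 0" "2 dvd x + w" "x + w \<noteq> 0"
    and W: "(q * z - r * y) * (q * z - r * y) + (y * (p - s) - q * (x - w)) * (r * (x - w) - z * (p - s)) \<noteq> 0"
  shows "\<exists>N\<ge>2. full_level G N"
proof -
  define w1 w2 w3 where "w1 = q * z - r * y" and "w2 = y * (p - s) - q * (x - w)" and "w3 = r * (x - w) - z * (p - s)"
  obtain d d' where d: "d * (p * s - q * r) = 1" "d' * (x * w - y * z) = 1"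
  proof -
    have dvd: "p * s - q * r dvd 1" "x * w - y * z dvd 1"
      using a b subgroup.subset[OF G] by (auto simp: M2_carrier_iff)
    obtain d where "(p * s - q * r) * d = 1" using unit_inverse[OF dvd(1)] ..
    moreover obtain d' where "(x * w - y * z) * d' = 1" using unit_inverse[OF dvd(2)] ..
    ultimately show ?thesis by (intro that[of d d']) (simp_all only: mult.commute)
  qed
  define c1 c2 c3 where "c1 = (p * w1 + q * w3) * s - (p * w2 - q * w1) * r"
    and "c2 = (p * w2 - q * w1) * p - (p * w1 + q * w3) * q"
    and "c3 = (r * w1 + s * w3) * s - (r * w2 - s * w1) * r"
  define e1 e2 e3 where "e1 = (x * w1 + y * w3) * w - (x * w2 - y * w1) * z"
    and "e2 = (x * w2 - y * w1) * x - (x * w1 + y * w3) * y"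
    and "e3 = (z * w1 + w * w3) * w - (z * w2 - w * w1) * z"
  have "det3 (w1, w2, w3) (d * c1, d * c2, d * c3) (d' * e1, d' * e2, d' * e3) = d * d' * det3 (w1, w2, w3) (c1, c2, c3) (e1, e2, e3)"
    unfolding det3_def by (simp add: algebra_simps)
  also have "det3 (w1, w2, w3) (c1, c2, c3) (e1, e2, e3) = - ((p + s) * (x + w) * (w1 * w1 + w2 * w3)\<^sup>2)"
    unfolding c1_def c2_def c3_def e1_def e2_def e3_def w1_def w2_def w3_def by (rule det3_conjugates)
  finally have det: "det3 (w1, w2, w3) (d * c1, d * c2, d * c3) (d' * e1, d' * e2, d' * e3)
      = d * d' * - ((p + s) * (x + w) * (w1 * w1 + w2 * w3)\<^sup>2)" .
  have "det3 (w1, w2, w3) (d * c1, d * c2, d * c3) (d' * e1, d' * e2, d' * e3) \<noteq> 0"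
  proof -
    have "d \<noteq> 0" "d' \<noteq> 0" using d by auto
    moreover have "w1 * w1 + w2 * w3 \<noteq> 0" using W unfolding w1_def w2_def w3_def .
    moreover have "i * j * - (t * t' * c\<^sup>2) \<noteq> 0" if "i \<noteq> 0" "j \<noteq> 0" "t \<noteq> 0" "t' \<noteq> 0" "c \<noteq> 0"
      for i j t t' c :: padic2
      using that by simp
    ultimately show ?thesis
      unfolding det using tr(2,4) by blast
  qed
  then obtain e u where eu: "det3 (w1, w2, w3) (d * c1, d * c2, d * c3) (d' * e1, d' * e2, d' * e3) = 2 ^ e * u" "u dvd 1"
    by (rule padic2_valuation)
  define k where "k = e + 2"
  obtain m n where A: "M2 (m + n * p) (n * q) (n * r) (m + n * s) \<in> G"
    "mcong (2 ^ k) (M2 (m + n * p) (n * q) (n * r) (m + n * s)) (mat 1)" "2 ^ k dvd n" "n \<noteq> 0"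
    by (rule near_identity_powers[OF G a tr(1,2), of k]) blast
  obtain m' n' where B: "M2 (m' + n' * x) (n' * y) (n' * z) (m' + n' * w) \<in> G"
    "mcong (2 ^ k) (M2 (m' + n' * x) (n' * y) (n' * z) (m' + n' * w)) (mat 1)" "2 ^ k dvd n'" "n' \<noteq> 0"
    by (rule near_identity_powers[OF G b tr(3,4), of k]) blast
  have comm: "tangent_in G k (n * n') w1 w2 w3"
    by (rule tangent_in_commutator[OF G A(1,2) B(1,2) M2_mult])
       (simp add: M2_mult w1_def w2_def w3_def algebra_simps)
  show ?thesis
  proof (rule full_level_if_independent_tangents[OF G comm _ _ _ _ _ eu])
    show "tangent_in G k (n * n') (d * c1) (d * c2) (d * c3)"
      unfolding c1_def c2_def c3_def by (rule tangent_in_conj[OF G a d(1) comm])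
    show "tangent_in G k (n * n') (d' * e1) (d' * e2) (d' * e3)"
      unfolding e1_def e2_def e3_def by (rule tangent_in_conj[OF G b d(2) comm])
  qed (use A B in \<open>simp_all add: k_def\<close>)
qed

text \<open>
  The elements of determinant 1 close to 1 are in the closure already. A power \<open>B\<close> of \<open>b\<close> close to 1
  differs from \<open>diag(det B, 1)\<close> by such an element, so this diagonal matrix lies in the closure; by
  \<open>power_dense\<close> so do all \<open>diag(u, 1)\<close> with \<open>u\<close> close to 1. Together they fill a congruence subgroup.
\<close>

lemma closure_contains_congruence_subgroup:
  assumes G: "subgroup G GL2" and N: "N \<ge> 2" "full_level G N"
    and b: "M2 x y z w \<in> G" "2 dvd x + w" "x + w \<noteq> 0" and det: "x * w - y * z = 1 + 4 * c" "\<not> 2 dvd c"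
  shows "congruence_subgroup (N + 2) \<subseteq> GL2_closure G"
    and "\<And>u. 4 dvd u - 1 \<Longrightarrow> \<exists>g\<in>GL2_closure G. det g = u"
proof -
  interpret M: subgroup "GL2_closure G" GL2 by (rule subgroup_GL2_closure[OF G])
  have G_sub: "G \<subseteq> GL2_closure G" by (rule GL2_closure_increasing[OF subgroup.subset[OF G]])
  define v where "v = 1 + 4 * c"
  have v: "v = 1 + 2 ^ 2 * c" by (simp add: v_def)
  obtain B where B: "B \<in> G" "mcong (2 ^ N) B (mat 1)" "det B = v ^ 2 ^ N"
    using near_identity_powers[OF G b, of N] unfolding det(1) v_def by metis
  have Bc: "B \<in> carrier GL2" using B(1) subgroup.subset[OF G] by blast
  obtain \<sigma> where \<sigma>: "\<sigma> \<in> carrier GL2" "det \<sigma> = 1" "mcong (2 ^ N) \<sigma> (mat 1)" "B = \<sigma> ** M2 (det B) 0 0 1"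
    using diag_det_factorization[OF Bc B(2)] .
  have "\<sigma> \<in> GL2_closure G" by (rule full_level_dense[OF G N \<sigma>(2,3)])
  moreover have "M2 (det B) 0 0 1 = inv\<^bsub>GL2\<^esub> \<sigma> ** B"
    using \<sigma> by (metis GL2_inv(2) matrix_mul_assoc matrix_mul_lid)
  ultimately have dB: "M2 (det B) 0 0 1 \<in> GL2_closure G"
    using M.m_closed[OF M.m_inv_closed, of \<sigma> B] G_sub B(1) by auto
  have dBe: "M2 (det B ^ e) 0 0 1 \<in> GL2_closure G" for e
  proof (induction e)
    case 0 then show ?case using M.one_closed by (simp add: mat1_M2)
  next
    case (Suc e) then show ?case using M.m_closed[OF dB Suc] by (simp add: M2_mult)
  qed
  obtain c' where c': "v ^ 2 ^ N = 1 + 2 ^ (2 + N) * c'" "\<not> 2 dvd c'"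
    using power_two_power_odd[OF v det(2)] by blast
  have diag: "M2 u 0 0 1 \<in> GL2_closure G" if u: "2 ^ (N + 2) dvd u - 1" for u
  proof -
    have "2 dvd u - 1" using power_le_dvd[OF u, of 1] by simp
    then have "\<not> 2 dvd u" using two_not_dvd_one dvd_diff[of 2 u "u - 1"] by auto
    then have "M2 u 0 0 1 \<in> carrier GL2" by (simp add: M2_carrier_iff padic2_unit_iff)
    moreover have "\<exists>A\<in>GL2_closure G. mcong (2 ^ n) (M2 u 0 0 1) A" for n
    proof -
      obtain e where "2 ^ n dvd det B ^ e - u"
        using power_dense[OF c', of u n] u unfolding B(3) by (auto simp: add.commute)
      then have "mcong (2 ^ n) (M2 (det B ^ e) 0 0 1) (M2 u 0 0 1)" by (simp add: mcong_M2)
      then show ?thesis using dBe mcong_sym by blast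
    qed
    ultimately have "M2 u 0 0 1 \<in> GL2_closure (GL2_closure G)"
      unfolding GL2_closure_def[of "GL2_closure G"] by simp
    then show ?thesis using GL2_closure_idem by blast
  qed
  show "congruence_subgroup (N + 2) \<subseteq> GL2_closure G"
  proof
    fix h assume "h \<in> congruence_subgroup (N + 2)"
    then have h: "h \<in> carrier GL2" "mcong (2 ^ (N + 2)) h (mat 1)" by (auto simp: congruence_subgroup_def)
    obtain \<tau> where \<tau>: "\<tau> \<in> carrier GL2" "det \<tau> = 1" "mcong (2 ^ (N + 2)) \<tau> (mat 1)" "h = \<tau> ** M2 (det h) 0 0 1"
      using diag_det_factorization[OF h] .
    have "\<tau> \<in> GL2_closure G"
      by (rule full_level_dense[OF G N \<tau>(2)]) (use mcong_power_le[OF \<tau>(3)] in simp)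
    moreover have "M2 (det h) 0 0 1 \<in> GL2_closure G" using diag mcong_det[OF h(2)] by simp
    ultimately have "\<tau> \<otimes>\<^bsub>GL2\<^esub> M2 (det h) 0 0 1 \<in> GL2_closure G" by (rule M.m_closed)
    then show "h \<in> GL2_closure G" unfolding GL2_simps \<tau>(4)[symmetric] .
  qed
  show "\<exists>g\<in>GL2_closure G. det g = u" if u: "4 dvd u - 1" for u
  proof -
    obtain e where e: "2 ^ (N + 2) dvd v ^ e - u"
      using power_dense[OF v det(2) order_refl, of u "N + 2"] u by auto
    have "v - 1 = 2 * (2 * c)" by (simp add: v_def)
    then have "2 dvd v - 1" by (rule dvdI)
    then have "\<not> 2 dvd v" using two_not_dvd_one dvd_diff[of 2 v "v - 1"] by auto
    then have "v ^ e dvd 1" unfolding padic2_unit_iff[symmetric] by (metis dvd_power_same power_one)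
    then obtain v' where v': "v ^ e * v' = 1" using unit_inverse by blast
    have "2 ^ (N + 2) dvd - (v' * (v ^ e - u))" unfolding dvd_minus_iff using e by (rule dvd_mult)
    also have "- (v' * (v ^ e - u)) = v' * u - 1" using v' by (simp add: algebra_simps)
    finally have "M2 (v' * u) 0 0 1 \<in> GL2_closure G" by (rule diag)
    moreover have "M2 x y z w [^]\<^bsub>GL2\<^esub> e \<in> GL2_closure G \<and> det (M2 x y z w [^]\<^bsub>GL2\<^esub> e) = v ^ e"
    proof (induction e)
      case 0 show ?case using M.one_closed by simp
    next
      case (Suc e)
      then show ?case
        using M.m_closed[of "M2 x y z w [^]\<^bsub>GL2\<^esub> e" "M2 x y z w"] b(1) G_sub det(1)
        by (auto simp: det_mul det_M2 v_def)
    qed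
    ultimately have "M2 x y z w [^]\<^bsub>GL2\<^esub> e ** M2 (v' * u) 0 0 1 \<in> GL2_closure G"
      "det (M2 x y z w [^]\<^bsub>GL2\<^esub> e ** M2 (v' * u) 0 0 1) = v ^ e * (v' * u)"
      using M.m_closed[of "M2 x y z w [^]\<^bsub>GL2\<^esub> e" "M2 (v' * u) 0 0 1"] by (simp_all add: det_mul det_M2)
    moreover have "v ^ e * (v' * u) = u" using v' by (simp add: mult.assoc[symmetric])
    ultimately show ?thesis by metis
  qed
qed

section \<open>Subgroups that contain all squares\<close>

text \<open>
  A commutator is a product of three squares.
\<close>

lemma (in group) commutator_in_if_squares_in:
  assumes "subgroup \<Phi> G" and sq: "\<And>x. x \<in> carrier G \<Longrightarrow> x \<otimes> x \<in> \<Phi>"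
    and xy: "x \<in> carrier G" "y \<in> carrier G"
  shows "x \<otimes> y \<otimes> inv x \<otimes> inv y \<in> \<Phi>"
proof -
  interpret P: subgroup \<Phi> G by fact
  have canc: "x \<otimes> (inv x \<otimes> z) = z" "inv x \<otimes> (x \<otimes> z) = z" if "x \<in> carrier G" "z \<in> carrier G" for x z
    using that by (simp_all add: m_assoc[symmetric])
  have "x \<otimes> y \<otimes> inv x \<otimes> inv y
      = ((x \<otimes> y) \<otimes> (x \<otimes> y)) \<otimes> ((inv y \<otimes> inv x \<otimes> y) \<otimes> (inv y \<otimes> inv x \<otimes> y)) \<otimes> (inv y \<otimes> inv y)"
    using xy by (simp add: m_assoc canc)
  then show ?thesis using sq xy by simp
qed

lemma (in group) normal_if_squares_in:
  assumes \<Phi>: "subgroup \<Phi> G" and sq: "\<And>x. x \<in> carrier G \<Longrightarrow> x \<otimes> x \<in> \<Phi>"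
  shows "\<Phi> \<lhd> G"
proof (rule normal_invI[OF \<Phi>])
  fix x h assume x: "x \<in> carrier G" and h: "h \<in> \<Phi>"
  interpret P: subgroup \<Phi> G by fact
  have hc: "h \<in> carrier G" using h by simp
  have "x \<otimes> h \<otimes> inv x = (x \<otimes> h \<otimes> inv x \<otimes> inv h) \<otimes> h"
    using x hc by (simp add: m_assoc)
  then show "x \<otimes> h \<otimes> inv x \<in> \<Phi>"
    using P.m_closed[OF commutator_in_if_squares_in[OF \<Phi> sq x hc] h] by metis
qed

lemma (in group) generate_pair_exponent_two:
  assumes sq: "\<And>x. x \<in> carrier G \<Longrightarrow> x \<otimes> x = \<one>"
    and ab: "a \<in> carrier G" "b \<in> carrier G" and g: "g \<in> generate G {a, b}"
  shows "g \<in> {\<one>, a, b, a \<otimes> b}"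
proof -
  have inv: "inv x = x" if "x \<in> carrier G" for x
    by (rule inv_equality[OF sq[OF that] that that])
  have comm: "x \<otimes> y = y \<otimes> x" if "x \<in> carrier G" "y \<in> carrier G" for x y
    using inv_mult_group[OF that] inv that by simp
  have sq': "x \<otimes> (x \<otimes> y) = y" if "x \<in> carrier G" "y \<in> carrier G" for x y
    using that sq by (simp add: m_assoc[symmetric])
  have comm': "b \<otimes> a = a \<otimes> b" "b \<otimes> (a \<otimes> b) = a"
    using comm[OF ab(2,1)] sq'[OF ab(2,1)] by simp_all
  show ?thesis
    using g
  proof (induction rule: generate.induct)
    case (inv h)
    then show ?case using \<open>\<And>x. x \<in> carrier G \<Longrightarrow> inv x = x\<close> ab by auto
  next
    case (eng h1 h2)
    then show ?case using ab sq sq' comm' by (auto simp: m_assoc)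
  qed auto
qed

text \<open>
  The quotient by \<open>\<Phi>\<close> has exponent two, so \<open>a\<close> and \<open>b\<close> generate at most four classes.
\<close>

lemma (in group) generate_pair_mod_squares:
  assumes \<Phi>: "subgroup \<Phi> G" and sq: "\<And>x. x \<in> carrier G \<Longrightarrow> x \<otimes> x \<in> \<Phi>"
    and ab: "a \<in> carrier G" "b \<in> carrier G" and g: "g \<in> generate G {a, b}"
  shows "\<exists>h\<in>{\<one>, a, b, a \<otimes> b}. h \<otimes> g \<in> \<Phi>"
proof -
  interpret P: normal \<Phi> G by (rule normal_if_squares_in[OF \<Phi> sq])
  interpret Q: group "G Mod \<Phi>" by (rule P.factorgroup_is_group)
  define \<pi> where "\<pi> x = \<Phi> #> x" for x
  have hom: "\<pi> \<in> hom G (G Mod \<Phi>)"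
    using P.r_coset_hom_Mod unfolding \<pi>_def[abs_def] .
  interpret \<pi>: group_hom G "G Mod \<Phi>" \<pi>
    by unfold_locales (rule hom)
  have \<pi>_one: "\<pi> x = \<one>\<^bsub>G Mod \<Phi>\<^esub> \<longleftrightarrow> x \<in> \<Phi>" if "x \<in> carrier G" for x
    using coset_join1[OF _ that \<Phi>] coset_join2[OF that \<Phi>] P.subset unfolding \<pi>_def FactGroup_def by auto
  have sq_Q: "X \<otimes>\<^bsub>G Mod \<Phi>\<^esub> X = \<one>\<^bsub>G Mod \<Phi>\<^esub>" if X: "X \<in> carrier (G Mod \<Phi>)" for X
  proof -
    have "X \<in> \<pi> ` carrier G"
      using X unfolding \<pi>_def[abs_def] carrier_FactGroup .
    then obtain x where x: "X = \<pi> x" "x \<in> carrier G" by (rule imageE)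
    then show ?thesis
      using sq[OF x(2)] \<pi>_one[of "x \<otimes> x"] \<pi>.hom_mult[OF x(2) x(2)] by simp
  qed
  have gc: "g \<in> carrier G" using g ab generate_incl[of "{a, b}"] by auto
  have "\<pi> g \<in> generate (G Mod \<Phi>) {\<pi> a, \<pi> b}"
    using \<pi>.generate_img[of "{a, b}"] ab g by auto
  then have "\<pi> g \<in> {\<one>\<^bsub>G Mod \<Phi>\<^esub>, \<pi> a, \<pi> b, \<pi> a \<otimes>\<^bsub>G Mod \<Phi>\<^esub> \<pi> b}"
    using Q.generate_pair_exponent_two[OF sq_Q \<pi>.hom_closed[OF ab(1)] \<pi>.hom_closed[OF ab(2)]] by blast
  then have "\<exists>h\<in>{\<one>, a, b, a \<otimes> b}. \<pi> g = \<pi> h"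
    using \<pi>.hom_one \<pi>.hom_mult[OF ab] by auto
  then obtain h where h: "h \<in> {\<one>, a, b, a \<otimes> b}" "\<pi> g = \<pi> h" by blast
  have hc: "h \<in> carrier G" using h(1) ab by auto
  have "\<pi> (h \<otimes> g) = \<one>\<^bsub>G Mod \<Phi>\<^esub>"
    using \<pi>.hom_mult[OF hc gc] h(2) sq_Q[OF \<pi>.hom_closed[OF hc]] by metis
  then show ?thesis using \<pi>_one[of "h \<otimes> g"] h(1) hc gc by blast
qed

text \<open>
  The analogue, for a group with a central filtration \<open>F\<close> whose layers have exponent two, of the fact
  that a proper subgroup of a 2-group lies in a subgroup of index two. Take an \<open>i\<close> with \<open>M = K F\<^sub>i\<close>
  but not \<open>M = K F\<^sub>i\<^sub>+\<^sub>1\<close>, and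
  \<open>N = M \<inter> K F\<^sub>i\<^sub>+\<^sub>1\<close>: for \<open>g = xf\<close> with \<open>f\<close> in \<open>F\<^sub>i\<close> the square of \<open>g\<close> is \<open>x\<^sup>2\<close> modulo \<open>F\<^sub>i\<^sub>+\<^sub>1\<close>.
\<close>

lemma (in group) proper_subgroup_containing_squares:
  assumes F: "\<And>k. subgroup (F k) G" "\<And>k. F (Suc k) \<subseteq> F k"
    and F_comm: "\<And>k x y. x \<in> F 0 \<Longrightarrow> y \<in> F k \<Longrightarrow> x \<otimes> y \<otimes> inv x \<otimes> inv y \<in> F (Suc k)"
    and F_sq: "\<And>k y. y \<in> F k \<Longrightarrow> y \<otimes> y \<in> F (Suc k)"
    and K: "subgroup K G" and M: "subgroup M G" and KM: "K \<subseteq> M" "M \<subseteq> F 0"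
    and g: "g \<in> M" "\<And>x f. x \<in> K \<Longrightarrow> f \<in> F n \<Longrightarrow> g \<noteq> x \<otimes> f"
  obtains N m where "subgroup N G" "K \<subseteq> N" "N \<subset> M" "\<And>x. x \<in> M \<Longrightarrow> x \<otimes> x \<in> N" "M \<inter> F m \<subseteq> N"
proof -
  interpret K: subgroup K G by fact
  interpret M: subgroup M G by fact
  have Fc: "x \<in> carrier G" if "x \<in> F k" for x k using that F(1) subgroup.subset by blast
  define D where "D i \<longleftrightarrow> (\<forall>g\<in>M. \<exists>x\<in>K. \<exists>f\<in>F i. g = x \<otimes> f)" for i
  have "D 0"
    unfolding D_def using KM K.one_closed by (metis M.mem_carrier l_one subsetD)
  moreover have "\<not> D n" unfolding D_def using g by blast
  ultimately obtain i where i: "D i" "\<not> D (Suc i)" by (metis nat_induct)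
  have canc: "x \<otimes> (inv x \<otimes> z) = z" "inv x \<otimes> (x \<otimes> z) = z" if "x \<in> carrier G" "z \<in> carrier G" for x z
    using that by (simp_all add: m_assoc[symmetric])
  have conj: "x \<otimes> f \<otimes> inv x \<in> F k" if "x \<in> F 0" "f \<in> F k" for x f k
  proof -
    have "x \<otimes> f \<otimes> inv x = (x \<otimes> f \<otimes> inv x \<otimes> inv f) \<otimes> f"
      using that Fc by (simp add: m_assoc)
    moreover have "x \<otimes> f \<otimes> inv x \<otimes> inv f \<in> F k" using F_comm[OF that] F(2) by blast
    ultimately show ?thesis using subgroup.m_closed[OF F(1) _ that(2)] by metis
  qed
  have conj': "inv x \<otimes> f \<otimes> x \<in> F k" if "x \<in> F 0" "f \<in> F k" for x f k
    using conj[of "inv x" f k] that subgroup.m_inv_closed[OF F(1)] Fc[OF that(1)] by simp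
  have KF: "x \<in> F 0" "x \<in> carrier G" if "x \<in> K" for x using that KM by auto
  define N where "N = {g \<in> M. \<exists>x\<in>K. \<exists>f\<in>F (Suc i). g = x \<otimes> f}"
  have "subgroup N G"
  proof
    show "N \<subseteq> carrier G" unfolding N_def using M.subset by blast
    show "\<one> \<in> N"
      unfolding N_def using K.one_closed M.one_closed subgroup.one_closed[OF F(1)]
      by (auto intro!: bexI[of _ \<one>])
    fix g assume "g \<in> N"
    then obtain x f where x: "x \<in> K" and f: "f \<in> F (Suc i)" and gx: "g = x \<otimes> f" and gM: "g \<in> M"
      unfolding N_def by blast
    have c: "x \<in> carrier G" "f \<in> carrier G" using x f Fc by auto
    have "inv g = inv x \<otimes> (x \<otimes> inv f \<otimes> inv x)"
      unfolding gx using c by (simp add: inv_mult_group m_assoc canc)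
    moreover have "x \<otimes> inv f \<otimes> inv x \<in> F (Suc i)"
      using conj KF x f subgroup.m_inv_closed[OF F(1)] by blast
    ultimately show "inv g \<in> N" unfolding N_def using gM x by blast
    fix h assume "h \<in> N"
    then obtain y e where y: "y \<in> K" and e: "e \<in> F (Suc i)" and hy: "h = y \<otimes> e" and hM: "h \<in> M"
      unfolding N_def by blast
    have c': "y \<in> carrier G" "e \<in> carrier G" using y e Fc by auto
    have "g \<otimes> h = (x \<otimes> y) \<otimes> ((inv y \<otimes> f \<otimes> y) \<otimes> e)"
      unfolding gx hy using c c' by (simp add: m_assoc canc)
    moreover have "(inv y \<otimes> f \<otimes> y) \<otimes> e \<in> F (Suc i)"
      using conj'[OF KF(1)[OF y] f] e subgroup.m_closed[OF F(1)] by blast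
    ultimately show "g \<otimes> h \<in> N" unfolding N_def using gM hM x y by blast
  qed
  moreover have "K \<subseteq> N"
  proof
    fix x assume x: "x \<in> K"
    then have "x = x \<otimes> \<one>" by simp
    then show "x \<in> N" unfolding N_def using KM(1) x subgroup.one_closed[OF F(1)] by blast
  qed
  moreover have "N \<subset> M" using i(2) unfolding N_def D_def by blast
  moreover have "g \<otimes> g \<in> N" if gM: "g \<in> M" for g
  proof -
    obtain x f where x: "x \<in> K" and f: "f \<in> F i" and gx: "g = x \<otimes> f"
      using i(1)[unfolded D_def, rule_format, OF gM] by blast
    have c: "x \<in> carrier G" "f \<in> carrier G" using x f Fc by auto
    have "g \<otimes> g = (x \<otimes> x) \<otimes> ((inv x \<otimes> f \<otimes> inv (inv x) \<otimes> inv f) \<otimes> (f \<otimes> f))"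
      unfolding gx using c by (simp add: m_assoc canc)
    moreover have "inv x \<otimes> f \<otimes> inv (inv x) \<otimes> inv f \<in> F (Suc i)"
      using F_comm KF(1)[OF x] f subgroup.m_inv_closed[OF F(1)] by blast
    ultimately show ?thesis unfolding N_def
      using gM x F_sq[OF f] subgroup.m_closed[OF F(1)] M.m_closed by blast
  qed
  moreover have "M \<inter> F (Suc i) \<subseteq> N"
  proof
    fix x assume x: "x \<in> M \<inter> F (Suc i)"
    then have "x = \<one> \<otimes> x" by simp
    then show "x \<in> N" unfolding N_def using x K.one_closed by blast
  qed
  ultimately show thesis by (rule that)
qed

section \<open>The Iwahori filtration\<close>

lemma matrix_diff_distribs:
  fixes A B C :: mat2
  shows "A ** (B - C) = A ** B - A ** C" and "(A - B) ** C = A ** C - B ** C"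
  by (simp_all add: vec_eq_iff matrix_matrix_mult_def sum_subtractf algebra_simps)

text \<open>
  The \<open>m\<close>-th power of the Jacobson radical of the Iwahori order, which is the ring of matrices with
  even lower left entry (the case \<open>m = 0\<close>). Its square is twice the order.
\<close>

definition rad_power :: "nat \<Rightarrow> mat2 set" where
  "rad_power m = {A. 2 ^ ((m + 1) div 2) dvd A $ 1 $ 1 \<and> 2 ^ (m div 2) dvd A $ 1 $ 2 \<and>
     2 ^ (m div 2 + 1) dvd A $ 2 $ 1 \<and> 2 ^ ((m + 1) div 2) dvd A $ 2 $ 2}"

lemma power_mult_dvd:
  fixes x y :: padic2
  assumes "2 ^ i dvd x" "2 ^ j dvd y" "k \<le> i + j"
  shows "2 ^ k dvd x * y"
proof -
  have "2 ^ (i + j) dvd x * y" unfolding power_add by (rule mult_dvd_mono[OF assms(1,2)])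
  then show ?thesis using assms(3) by (rule power_le_dvd)
qed

text \<open>
  Rounding of the half-integral exponents is the only issue: it works out in every entry.
\<close>

lemma rad_power_mult:
  assumes A: "A \<in> rad_power m" and B: "B \<in> rad_power n"
  shows "A ** B \<in> rad_power (m + n)"
proof -
  have le: "(m + n + 1) div 2 \<le> (m + 1) div 2 + (n + 1) div 2" "(m + n + 1) div 2 \<le> m div 2 + (n div 2 + 1)"
    "(m + n) div 2 \<le> (m + 1) div 2 + n div 2" "(m + n) div 2 \<le> m div 2 + (n + 1) div 2"
    "(m + n) div 2 + 1 \<le> (m div 2 + 1) + (n + 1) div 2" "(m + n) div 2 + 1 \<le> (m + 1) div 2 + (n div 2 + 1)"
    "(m + n + 1) div 2 \<le> (m div 2 + 1) + n div 2"
    by presburger+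
  note A = A[unfolded rad_power_def mem_Collect_eq] and B = B[unfolded rad_power_def mem_Collect_eq]
  show ?thesis
    unfolding rad_power_def mem_Collect_eq matrix_matrix_mult_def sum_2 vec_lambda_beta
    using A B by (intro conjI dvd_add; elim conjE) (blast intro: power_mult_dvd le)+
qed

lemma rad_power_add: "A \<in> rad_power m \<Longrightarrow> B \<in> rad_power m \<Longrightarrow> A + B \<in> rad_power m"
  by (simp add: rad_power_def)

lemma rad_power_diff: "A \<in> rad_power m \<Longrightarrow> B \<in> rad_power m \<Longrightarrow> A - B \<in> rad_power m"
  by (simp add: rad_power_def)

lemma rad_power_mono: "m \<le> n \<Longrightarrow> A \<in> rad_power n \<Longrightarrow> A \<in> rad_power m"
  unfolding rad_power_def mem_Collect_eq
  by (elim conjE; intro conjI; erule power_le_dvd; simp add: div_le_mono)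

lemma rad_power_double:
  assumes "A \<in> rad_power m"
  shows "A + A \<in> rad_power (Suc m)"
proof -
  have double: "2 ^ k dvd x + x" if "2 ^ i dvd x" "k \<le> 1 + i" for x :: padic2 and i k
    using power_mult_dvd[of 1 2 i x k] that by (simp flip: mult_2)
  have le: "(Suc m + 1) div 2 \<le> 1 + (m + 1) div 2" "Suc m div 2 \<le> 1 + m div 2" "Suc m div 2 + 1 \<le> 1 + (m div 2 + 1)"
    by presburger+
  show ?thesis
    using assms unfolding rad_power_def mem_Collect_eq vector_add_component
    by (blast intro: double le)
qed

text \<open>
  The index is shifted by one: the filtration starts with \<open>1\<close> plus the radical, a Sylow pro-2 subgroup.
\<close>

definition iwahori :: "nat \<Rightarrow> mat2 set" where
  "iwahori k = {g \<in> carrier GL2. g - mat 1 \<in> rad_power (Suc k)}"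

lemma iwahori_carrier: "g \<in> iwahori k \<Longrightarrow> g \<in> carrier GL2"
  by (simp add: iwahori_def)

lemma iwahori_Suc: "iwahori (Suc k) \<subseteq> iwahori k"
  unfolding iwahori_def using rad_power_mono[of "Suc k" "Suc (Suc k)"] by auto

lemma iwahori_inv_rad:
  assumes "g \<in> iwahori k"
  shows "inv\<^bsub>GL2\<^esub> g \<in> rad_power 0"
proof -
  obtain p q r s where g: "g = M2 p q r s" by (rule M2_cases)
  have "g - mat 1 \<in> rad_power 1"
    using assms rad_power_mono[of 1 "Suc k"] by (simp add: iwahori_def)
  then have r: "2 dvd r" by (simp add: g rad_power_def mat_def)
  have "p * s - q * r dvd 1" using iwahori_carrier[OF assms] by (simp add: g M2_carrier_iff)
  then obtain e where "e * (p * s - q * r) = 1" using unit_inverse by (metis mult.commute)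
  from inv_M2[OF this] show ?thesis using r by (simp add: g rad_power_def)
qed

text \<open>
  Passes from differences, where the filtration is additive, to quotients in the group.
\<close>

lemma iwahori_quotient:
  assumes x: "x \<in> carrier GL2" and g: "g \<in> iwahori k" and d: "x - g \<in> rad_power m"
  shows "x ** inv\<^bsub>GL2\<^esub> g - mat 1 \<in> rad_power m"
proof -
  have "(x - g) ** inv\<^bsub>GL2\<^esub> g \<in> rad_power (m + 0)"
    by (rule rad_power_mult[OF d iwahori_inv_rad[OF g]])
  then show ?thesis using iwahori_carrier[OF g] by (simp add: matrix_diff_distribs)
qed

lemma iwahori_mult:
  assumes "g \<in> iwahori k" "h \<in> iwahori k"
  shows "g ** h \<in> iwahori k"
proof -
  have u: "g - mat 1 \<in> rad_power (Suc k)" and v: "h - mat 1 \<in> rad_power (Suc k)"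
    using assms by (auto simp: iwahori_def)
  have "g ** h - mat 1 = (g - mat 1) ** (h - mat 1) + (g - mat 1) + (h - mat 1)"
    by (simp add: matrix_diff_distribs)
  moreover have "(g - mat 1) ** (h - mat 1) \<in> rad_power (Suc k)"
    using rad_power_mult[OF u v] by (rule rad_power_mono[rotated]) simp
  ultimately have "g ** h - mat 1 \<in> rad_power (Suc k)"
    using u v by (simp only: rad_power_add)
  then show ?thesis using assms by (auto simp: iwahori_def)
qed

lemma iwahori_inv:
  assumes "g \<in> iwahori k"
  shows "inv\<^bsub>GL2\<^esub> g \<in> iwahori k"
proof -
  have "mat 1 - g \<in> rad_power (Suc k)"
    using assms rad_power_diff[of "mat 1 - mat 1" "Suc k" "g - mat 1"] by (simp add: iwahori_def rad_power_def)
  from iwahori_quotient[OF _ assms this] have "inv\<^bsub>GL2\<^esub> g - mat 1 \<in> rad_power (Suc k)"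
    using GL2.one_closed by simp
  then show ?thesis using iwahori_carrier[OF assms] by (simp add: iwahori_def)
qed

lemma iwahori_square:
  assumes "g \<in> iwahori k"
  shows "g ** g \<in> iwahori (Suc k)"
proof -
  have u: "g - mat 1 \<in> rad_power (Suc k)" using assms by (simp add: iwahori_def)
  have "(g - mat 1) ** (g - mat 1) \<in> rad_power (Suc (Suc k))"
    using rad_power_mult[OF u u] by (rule rad_power_mono[rotated]) simp
  moreover have "g ** g - mat 1 = (g - mat 1 + (g - mat 1)) + (g - mat 1) ** (g - mat 1)"
    unfolding matrix_diff_distribs matrix_mul_lid matrix_mul_rid by (simp only: algebra_simps)
  ultimately have "g ** g - mat 1 \<in> rad_power (Suc (Suc k))"
    using rad_power_double[OF u] by (simp only: rad_power_add)
  then show ?thesis using iwahori_carrier[OF assms] by (auto simp: iwahori_def)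
qed

text \<open>
  Writing \<open>x = 1 + u\<close> and \<open>y = 1 + v\<close>, one has \<open>xy - yx = uv - vu\<close>, which lies one step deeper than \<open>v\<close>.
\<close>

lemma iwahori_commutator:
  assumes x: "x \<in> iwahori 0" and y: "y \<in> iwahori k"
  shows "x ** y ** inv\<^bsub>GL2\<^esub> x ** inv\<^bsub>GL2\<^esub> y \<in> iwahori (Suc k)"
proof -
  have c: "x \<in> carrier GL2" "y \<in> carrier GL2" using assms iwahori_carrier by auto
  have u: "x - mat 1 \<in> rad_power 1" and v: "y - mat 1 \<in> rad_power (Suc k)"
    using assms by (auto simp: iwahori_def)
  have y0: "y \<in> iwahori 0" using y rad_power_mono[of 1 "Suc k"] by (simp add: iwahori_def)
  have "x ** y - y ** x = (x - mat 1) ** (y - mat 1) - (y - mat 1) ** (x - mat 1)"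
    by (simp add: matrix_diff_distribs)
  moreover have "(x - mat 1) ** (y - mat 1) \<in> rad_power (Suc (Suc k))"
    using rad_power_mult[OF u v] by simp
  moreover have "(y - mat 1) ** (x - mat 1) \<in> rad_power (Suc (Suc k))"
    using rad_power_mult[OF v u] by simp
  ultimately have "x ** y - y ** x \<in> rad_power (Suc (Suc k))" by (simp add: rad_power_diff)
  from iwahori_quotient[OF _ iwahori_mult[OF y0 x] this]
  have "x ** y ** inv\<^bsub>GL2\<^esub> (y ** x) - mat 1 \<in> rad_power (Suc (Suc k))"
    using c by blast
  moreover have "inv\<^bsub>GL2\<^esub> (y ** x) = inv\<^bsub>GL2\<^esub> x ** inv\<^bsub>GL2\<^esub> y"
    using GL2.inv_mult_group[of y x] c by simp
  moreover have "x ** y ** (inv\<^bsub>GL2\<^esub> x ** inv\<^bsub>GL2\<^esub> y) \<in> carrier GL2"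
    using c by (intro GL2_mult_closed GL2.inv_closed)
  ultimately show ?thesis by (simp add: iwahori_def matrix_mul_assoc)
qed

lemma iwahori_one: "mat 1 \<in> iwahori k"
  using GL2.one_closed by (simp add: iwahori_def rad_power_def)

lemma iwahori_subset_congruence_subgroup: "iwahori (2 * n) \<subseteq> congruence_subgroup n"
proof
  fix g assume g: "g \<in> iwahori (2 * n)"
  then have "2 ^ (n + 1) dvd (g - mat 1) $ 1 $ 1" "2 ^ n dvd (g - mat 1) $ 1 $ 2"
      "2 ^ (n + 1) dvd (g - mat 1) $ 2 $ 1" "2 ^ (n + 1) dvd (g - mat 1) $ 2 $ 2"
    by (auto simp: iwahori_def rad_power_def)
  then have "2 ^ n dvd (g - mat 1) $ i $ j" for i j
    using exhaust_2[of i] exhaust_2[of j] power_le_dvd[of 2 "n + 1" _ n] by auto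
  then show "g \<in> congruence_subgroup n"
    using g by (simp add: congruence_subgroup_def mcong_def iwahori_def)
qed

lemma congruence_subgroup_subset_iwahori: "congruence_subgroup (Suc k) \<subseteq> iwahori k"
proof
  fix g assume g: "g \<in> congruence_subgroup (Suc k)"
  then have "2 ^ Suc k dvd (g - mat 1) $ i $ j" for i j
    by (simp add: congruence_subgroup_def mcong_def)
  then have "2 ^ m dvd (g - mat 1) $ i $ j" if "m \<le> Suc k" for i j m
    using power_le_dvd that by blast
  then have "g - mat 1 \<in> rad_power (Suc k)" unfolding rad_power_def mem_Collect_eq
    by (intro conjI \<open>\<And>m i j. m \<le> Suc k \<Longrightarrow> 2 ^ m dvd (g - mat 1) $ i $ j\<close>) presburger+
  then show "g \<in> iwahori k" using g by (simp add: iwahori_def congruence_subgroup_def)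
qed

definition iwahori_conj :: "mat2 \<Rightarrow> nat \<Rightarrow> mat2 set" where
  "iwahori_conj c k = {g \<in> carrier GL2. c ** g ** inv\<^bsub>GL2\<^esub> c \<in> iwahori k}"

context
  fixes c :: mat2
  assumes c: "c \<in> carrier GL2"
begin

lemma conj_mult: "c ** (g ** h) ** inv\<^bsub>GL2\<^esub> c = (c ** g ** inv\<^bsub>GL2\<^esub> c) ** (c ** h ** inv\<^bsub>GL2\<^esub> c)"
proof -
  have "(c ** g ** inv\<^bsub>GL2\<^esub> c) ** (c ** h ** inv\<^bsub>GL2\<^esub> c) = c ** g ** (inv\<^bsub>GL2\<^esub> c ** c) ** h ** inv\<^bsub>GL2\<^esub> c"
    by (simp only: matrix_mul_assoc)
  then show ?thesis using c by (simp add: matrix_mul_assoc)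
qed

lemma conj_inv:
  assumes "g \<in> carrier GL2"
  shows "c ** inv\<^bsub>GL2\<^esub> g ** inv\<^bsub>GL2\<^esub> c = inv\<^bsub>GL2\<^esub> (c ** g ** inv\<^bsub>GL2\<^esub> c)"
  using GL2.inv_mult_group[of "c ** g" "inv\<^bsub>GL2\<^esub> c"] GL2.inv_mult_group[of c g] assms c
  by (simp add: GL2_mult_closed matrix_mul_assoc)

lemma subgroup_iwahori_conj: "subgroup (iwahori_conj c k) GL2"
proof
  show "iwahori_conj c k \<subseteq> carrier GL2" by (auto simp: iwahori_conj_def)
  show "\<one>\<^bsub>GL2\<^esub> \<in> iwahori_conj c k"
    using c iwahori_one GL2.one_closed by (simp add: iwahori_conj_def)
  show "g \<otimes>\<^bsub>GL2\<^esub> h \<in> iwahori_conj c k" if "g \<in> iwahori_conj c k" "h \<in> iwahori_conj c k" for g h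
    using that iwahori_mult by (auto simp: iwahori_conj_def conj_mult)
  show "inv\<^bsub>GL2\<^esub> g \<in> iwahori_conj c k" if "g \<in> iwahori_conj c k" for g
    using that iwahori_inv by (auto simp: iwahori_conj_def conj_inv)
qed

lemma iwahori_conj_Suc: "iwahori_conj c (Suc k) \<subseteq> iwahori_conj c k"
  using iwahori_Suc by (auto simp: iwahori_conj_def)

lemma iwahori_conj_square: "g \<in> iwahori_conj c k \<Longrightarrow> g ** g \<in> iwahori_conj c (Suc k)"
  using iwahori_square by (auto simp: iwahori_conj_def conj_mult)

lemma iwahori_conj_commutator:
  assumes "x \<in> iwahori_conj c 0" "y \<in> iwahori_conj c k"
  shows "x ** y ** inv\<^bsub>GL2\<^esub> x ** inv\<^bsub>GL2\<^esub> y \<in> iwahori_conj c (Suc k)"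
proof -
  have "x \<in> carrier GL2" "y \<in> carrier GL2" using assms by (auto simp: iwahori_conj_def)
  moreover from this have "x ** y ** inv\<^bsub>GL2\<^esub> x ** inv\<^bsub>GL2\<^esub> y \<in> carrier GL2"
    by (intro GL2_mult_closed GL2.inv_closed)
  ultimately show ?thesis
    using assms iwahori_commutator by (simp add: iwahori_conj_def conj_mult conj_inv)
qed

lemma congruence_subgroup_conj:
  assumes "g \<in> carrier GL2"
  shows "c ** g ** inv\<^bsub>GL2\<^esub> c \<in> congruence_subgroup n \<longleftrightarrow> g \<in> congruence_subgroup n"
proof
  have *: "d ** h ** inv\<^bsub>GL2\<^esub> d \<in> congruence_subgroup n" if "d \<in> carrier GL2" "h \<in> congruence_subgroup n" for d h
  proof -
    have "mcong (2 ^ n) (d ** h ** inv\<^bsub>GL2\<^esub> d) (d ** mat 1 ** inv\<^bsub>GL2\<^esub> d)"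
      using that by (intro mcong_mult mcong_refl) (simp add: congruence_subgroup_def)
    then show ?thesis using that by (auto simp: congruence_subgroup_def)
  qed
  show "g \<in> congruence_subgroup n \<Longrightarrow> c ** g ** inv\<^bsub>GL2\<^esub> c \<in> congruence_subgroup n"
    using * c by blast
  assume "c ** g ** inv\<^bsub>GL2\<^esub> c \<in> congruence_subgroup n"
  from *[OF GL2.inv_closed[OF c] this]
  have "inv\<^bsub>GL2\<^esub> c ** (c ** g ** inv\<^bsub>GL2\<^esub> c) ** c \<in> congruence_subgroup n" using c by simp
  moreover have "inv\<^bsub>GL2\<^esub> c ** (c ** g ** inv\<^bsub>GL2\<^esub> c) ** c = (inv\<^bsub>GL2\<^esub> c ** c) ** g ** (inv\<^bsub>GL2\<^esub> c ** c)"
    by (simp only: matrix_mul_assoc)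
  ultimately show "g \<in> congruence_subgroup n" using c by simp
qed

lemma iwahori_conj_subset_congruence_subgroup: "iwahori_conj c (2 * n) \<subseteq> congruence_subgroup n"
  using iwahori_subset_congruence_subgroup congruence_subgroup_conj by (auto simp: iwahori_conj_def)

lemma congruence_subgroup_subset_iwahori_conj: "congruence_subgroup (Suc k) \<subseteq> iwahori_conj c k"
proof
  fix g assume g: "g \<in> congruence_subgroup (Suc k)"
  then have gc: "g \<in> carrier GL2" by (simp add: congruence_subgroup_def)
  then show "g \<in> iwahori_conj c k"
    using congruence_subgroup_conj[OF gc] g congruence_subgroup_subset_iwahori by (auto simp: iwahori_conj_def)
qed

end

section \<open>Proper closed subgroups of a two-generated group\<close>

text \<open>
  With \<open>N\<close> from \<open>proper_subgroup_containing_squares\<close>, let \<open>\<Phi>\<close> consist of the elements of \<open>N\<close> with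
  determinant 1 modulo 8. It contains all squares of \<open>M\<close>, so every element of \<open>M\<close> lies in one of the
  cosets given by \<open>1\<close>, \<open>a\<close>, \<open>b\<close>, \<open>ab\<close>, and the determinant modulo 8 tells which. An element of \<open>K\<close> with
  the determinant of \<open>a\<close> thus lies in the coset of \<open>a\<close>; as it is in \<open>N\<close>, so is \<open>a\<close>, and likewise \<open>b\<close>.
  Then \<open>N\<close> is all of \<open>M\<close>.
\<close>

lemma no_proper_closed_subgroup_with_full_det:
  assumes c: "c \<in> carrier GL2"
    and ab: "a \<in> iwahori_conj c 0" "b \<in> iwahori_conj c 0"
    and det: "\<not> 8 dvd det a - 1" "\<not> 8 dvd det b - 1" "\<not> 8 dvd det a * det b - 1"
    and M: "M = GL2_closure (generate GL2 {a, b})"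
    and K: "closed_subgroup K" "K \<subset> M"
    and full: "det a \<in> det ` K" "det b \<in> det ` K"
  shows False
proof -
  define F where "F = iwahori_conj c"
  have F: "subgroup (F k) GL2" "F (Suc k) \<subseteq> F k" for k
    unfolding F_def using c by (rule subgroup_iwahori_conj, rule iwahori_conj_Suc)
  have abc: "a \<in> carrier GL2" "b \<in> carrier GL2" using ab by (auto simp: iwahori_conj_def)
  define G where "G = generate GL2 {a, b}"
  have G: "subgroup G GL2" unfolding G_def using abc by (intro GL2.generate_is_subgroup) auto
  have M: "M = GL2_closure G" by (simp add: M G_def)
  have Ms: "subgroup M GL2" unfolding M by (rule subgroup_GL2_closure[OF G])
  interpret M: subgroup M GL2 by fact
  have GM: "G \<subseteq> M" unfolding M by (rule GL2_closure_increasing[OF subgroup.subset[OF G]])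
  have "G \<subseteq> F 0"
    unfolding G_def using ab F by (intro GL2.generate_subgroup_incl) (auto simp: F_def)
  then have MF: "M \<subseteq> F 0"
    unfolding M using GL2_closure_subset[OF F(1)] congruence_subgroup_subset_iwahori_conj[OF c, of 0] F_def by blast
  have Ks: "subgroup K GL2" "GL2_closure K \<subseteq> K"
    using K(1) unfolding closed_subgroup_def closedin_GL2_topology by auto
  obtain g where g: "g \<in> M" "g \<notin> K" using K(2) by blast
  then have "g \<notin> GL2_closure K" using Ks(2) by blast
  then obtain n where n: "\<And>x. x \<in> K \<Longrightarrow> \<not> mcong (2 ^ n) g x"
    using g(1) M.subset unfolding GL2_closure_def by blast
  \<comment> \<open>Step \<open>2n\<close> of the filtration is trivial modulo \<open>2\<^sup>n\<close>, so \<open>g\<close> stays outside \<open>K F\<^sub>2\<^sub>n\<close>.\<close>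
  have gn: "g \<noteq> x \<otimes>\<^bsub>GL2\<^esub> f" if x: "x \<in> K" and f: "f \<in> F (2 * n)" for x f
  proof
    assume gx: "g = x \<otimes>\<^bsub>GL2\<^esub> f"
    have "mcong (2 ^ n) f (mat 1)"
      using f iwahori_conj_subset_congruence_subgroup[OF c, of n] by (auto simp: F_def congruence_subgroup_def)
    then have "mcong (2 ^ n) (x ** f) (x ** mat 1)" by (intro mcong_mult mcong_refl)
    then show False using n[OF x] gx by simp
  qed
  obtain N m where N: "subgroup N GL2" "K \<subseteq> N" "N \<subset> M" and sq: "\<And>x. x \<in> M \<Longrightarrow> x \<otimes>\<^bsub>GL2\<^esub> x \<in> N"
    and m: "M \<inter> F m \<subseteq> N"
  proof (rule GL2.proper_subgroup_containing_squares[OF F _ _ Ks(1) Ms _ MF g(1) gn])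
    show "x \<otimes>\<^bsub>GL2\<^esub> y \<otimes>\<^bsub>GL2\<^esub> inv\<^bsub>GL2\<^esub> x \<otimes>\<^bsub>GL2\<^esub> inv\<^bsub>GL2\<^esub> y \<in> F (Suc k)" if "x \<in> F 0" "y \<in> F k" for k x y
      using iwahori_conj_commutator[OF c] that by (simp add: F_def)
    show "y \<otimes>\<^bsub>GL2\<^esub> y \<in> F (Suc k)" if "y \<in> F k" for k y
      using iwahori_conj_square[OF c] that by (simp add: F_def)
    show "K \<subseteq> M" using K(2) by blast
  qed blast+
  interpret N: subgroup N GL2 by fact
  define \<Phi> where "\<Phi> = {x \<in> N. 8 dvd det x - 1}"
  have \<Phi>: "subgroup \<Phi> GL2"
  proof
    show "\<Phi> \<subseteq> carrier GL2" unfolding \<Phi>_def using N.subset by blast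
    show "\<one>\<^bsub>GL2\<^esub> \<in> \<Phi>" unfolding \<Phi>_def using N.one_closed by simp
    show "x \<otimes>\<^bsub>GL2\<^esub> y \<in> \<Phi>" if x: "x \<in> \<Phi>" and y: "y \<in> \<Phi>" for x y
    proof -
      have eq: "det (x ** y) - 1 = (det x - 1) * det y + (det y - 1)" by (simp add: det_mul algebra_simps)
      have "8 dvd det (x ** y) - 1"
        unfolding eq using x y by (intro dvd_add dvd_mult2) (auto simp: \<Phi>_def)
      then show ?thesis using x y N.m_closed[of x y] by (simp add: \<Phi>_def)
    qed
    show "inv\<^bsub>GL2\<^esub> x \<in> \<Phi>" if x: "x \<in> \<Phi>" for x
    proof -
      have "det (inv\<^bsub>GL2\<^esub> x) - 1 = - (det (inv\<^bsub>GL2\<^esub> x) * (det x - 1))"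
        using x N.subset det_inv_GL2[of x] by (auto simp: \<Phi>_def algebra_simps)
      then show ?thesis using x by (auto simp: \<Phi>_def)
    qed
  qed
  have sq\<Phi>: "x ** x \<in> \<Phi>" if "x \<in> M" for x
  proof -
    have "x \<in> carrier GL2" using that M.subset by blast
    then have "\<not> 2 dvd det x" unfolding carrier_GL2_iff padic2_unit_iff .
    from unit_square_mod_8[OF this] show ?thesis
      using sq[OF that] by (simp add: \<Phi>_def det_mul)
  qed
  interpret GM: group "GL2\<lparr>carrier := M\<rparr>" by (rule M.subgroup_is_group[OF group_GL2])
  have \<Phi>M: "subgroup \<Phi> (GL2\<lparr>carrier := M\<rparr>)"
    by (rule GL2.subgroup_incl[OF \<Phi> Ms]) (use N(3) in \<open>auto simp: \<Phi>_def\<close>)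
  have abM: "a \<in> M" "b \<in> M" using GM unfolding G_def by (auto intro: generate.incl)
  have dec: "\<exists>h\<in>{mat 1, a, b, a ** b}. h ** x \<in> \<Phi>" if x: "x \<in> M" for x
  proof -
    \<comment> \<open>Precision \<open>m + 1\<close> puts the quotient into \<open>F\<^sub>m\<close>, precision 3 makes its determinant 1 modulo 8.\<close>
    obtain y where y: "y \<in> G" "mcong (2 ^ (m + 3)) x y"
      using x unfolding M GL2_closure_def by blast
    have car: "x \<in> carrier GL2" "y \<in> carrier GL2" using x y(1) M.subset GM by auto
    have yx: "inv\<^bsub>GL2\<^esub> y ** x \<in> M"
      using M.m_closed[OF M.m_inv_closed, of y x] x y(1) GM by auto
    have "mcong (2 ^ (m + 3)) (inv\<^bsub>GL2\<^esub> y ** x) (inv\<^bsub>GL2\<^esub> y ** y)"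
      by (intro mcong_mult mcong_refl y)
    then have near: "mcong (2 ^ (m + 3)) (inv\<^bsub>GL2\<^esub> y ** x) (mat 1)" using car by simp
    then have "inv\<^bsub>GL2\<^esub> y ** x \<in> congruence_subgroup (Suc m)"
      using mcong_power_le[of "m + 3" _ _ "Suc m"] yx M.subset by (auto simp: congruence_subgroup_def)
    then have "inv\<^bsub>GL2\<^esub> y ** x \<in> N"
      using congruence_subgroup_subset_iwahori_conj[OF c, of m] yx m by (auto simp: F_def)
    moreover have "8 dvd det (inv\<^bsub>GL2\<^esub> y ** x) - 1"
      using mcong_det[OF mcong_power_le[OF near, of 3]] by simp
    ultimately have yx\<Phi>: "inv\<^bsub>GL2\<^esub> y ** x \<in> \<Phi>" by (simp add: \<Phi>_def)
    have "y \<in> generate (GL2\<lparr>carrier := M\<rparr>) {a, b}"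
      using y(1) GL2.generate_consistent[OF _ Ms, of "{a, b}"] abM by (simp add: G_def)
    from GM.generate_pair_mod_squares[OF \<Phi>M _ _ _ this]
    have "\<exists>h\<in>{mat 1, a, b, a ** b}. h ** y \<in> \<Phi>"
      using sq\<Phi> abM by simp
    then obtain h where h: "h \<in> {mat 1, a, b, a ** b}" "h ** y \<in> \<Phi>" by blast
    have "(h ** y) ** (inv\<^bsub>GL2\<^esub> y ** x) \<in> \<Phi>"
      using subgroup.m_closed[OF \<Phi> h(2) yx\<Phi>] by simp
    moreover have "(h ** y) ** (inv\<^bsub>GL2\<^esub> y ** x) = h ** (y ** inv\<^bsub>GL2\<^esub> y) ** x"
      by (simp only: matrix_mul_assoc)
    ultimately show ?thesis using h(1) car by auto
  qed
  have odd: "\<not> 2 dvd det a" "\<not> 2 dvd det b"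
    using abc unfolding carrier_GL2_iff padic2_unit_iff .
  have cancel: "h \<in> N" if "h ** x \<in> \<Phi>" "x \<in> K" "h \<in> carrier GL2" for h x
  proof -
    have "x \<in> N" using that(2) N(2) by blast
    then have "(h ** x) ** inv\<^bsub>GL2\<^esub> x \<in> N"
      using N.m_closed[OF _ N.m_inv_closed, of "h ** x" x] that(1) by (simp add: \<Phi>_def)
    moreover have "(h ** x) ** inv\<^bsub>GL2\<^esub> x = h"
      using \<open>x \<in> N\<close> N.subset by (simp add: matrix_mul_assoc[symmetric] subset_iff)
    ultimately show ?thesis by simp
  qed
  have mod8: "8 dvd v - 1" if "8 dvd u * u * v - 1" "\<not> 2 dvd u" for u v :: padic2
  proof -
    from dvd_diff[OF that(1) dvd_mult2[OF unit_square_mod_8[OF that(2)]]]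
    have "8 dvd (u * u * v - 1) - (u * u - 1) * v" .
    then show ?thesis by (simp add: algebra_simps)
  qed
  obtain x where x: "x \<in> K" "det x = det a" using full(1) by auto
  obtain h where h: "h \<in> {mat 1, a, b, a ** b}" "h ** x \<in> \<Phi>" using dec x(1) K(2) by blast
  have "8 dvd det h * det a - 1" using h(2) x(2) by (simp add: \<Phi>_def det_mul)
  then have "h = a"
    using h(1) det mod8[of "det a" "det b"] odd by (auto simp: det_mul ac_simps)
  then have aN: "a \<in> N" using cancel h(2) x(1) abc by blast
  obtain x' where x': "x' \<in> K" "det x' = det b" using full(2) by auto
  obtain h' where h': "h' \<in> {mat 1, a, b, a ** b}" "h' ** x' \<in> \<Phi>" using dec x'(1) K(2) by blast
  have "8 dvd det h' * det b - 1" using h'(2) x'(2) by (simp add: \<Phi>_def det_mul)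
  then have "h' = b"
    using h'(1) det mod8[of "det b" "det a"] odd by (auto simp: det_mul ac_simps)
  then have bN: "b \<in> N" using cancel h'(2) x'(1) abc by blast
  have "M \<subseteq> N"
  proof
    fix x assume x: "x \<in> M"
    obtain h where h: "h \<in> {mat 1, a, b, a ** b}" "h ** x \<in> \<Phi>" using dec[OF x] by blast
    have hN: "h \<in> N" using h(1) aN bN N.one_closed N.m_closed[OF aN bN] by auto
    then have "inv\<^bsub>GL2\<^esub> h ** (h ** x) \<in> N"
      using N.m_closed[OF N.m_inv_closed, of h "h ** x"] h(2) by (simp add: \<Phi>_def)
    moreover have "inv\<^bsub>GL2\<^esub> h ** (h ** x) = x"
      using hN N.subset by (simp add: matrix_mul_assoc subset_iff)
    ultimately show "x \<in> N" by simp
  qed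
  then show False using N(3) by blast
qed

section \<open>Choice of the two generators\<close>

text \<open>
  The diagonal entries are odd as soon as the lower left entry is even, because the determinant is odd.
\<close>

lemma iwahori_0_iff:
  assumes "M2 p q r s \<in> carrier GL2"
  shows "M2 p q r s \<in> iwahori 0 \<longleftrightarrow> 2 dvd r"
  using assms unfolding carrier_GL2_M2_odd
  by (auto simp: iwahori_def rad_power_def mat_def carrier_GL2_M2_odd padic2_even_simps)

text \<open>
  Modulo 2 the line spanned by \<open>(1, 0)\<close>, \<open>(0, 1)\<close> or \<open>(1, 1)\<close> is mapped to itself; every \<open>i \<ge> 2\<close> encodes
  the last one.
\<close>

definition stable_line :: "nat \<Rightarrow> mat2 \<Rightarrow> bool" where
  "stable_line i g \<longleftrightarrow> 2 dvd (if i = 0 then g $ 2 $ 1 else if i = 1 then g $ 1 $ 2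
     else g $ 1 $ 1 + g $ 2 $ 1 - g $ 1 $ 2 - g $ 2 $ 2)"

text \<open>
  Conjugation by a matrix that moves the stable line modulo 2 to the first coordinate axis.
\<close>

lemma stable_line_iwahori_conj:
  "\<exists>c\<in>carrier GL2. \<forall>g\<in>carrier GL2. stable_line i g \<longrightarrow> g \<in> iwahori_conj c 0"
proof -
  have *: "\<exists>c\<in>carrier GL2. \<forall>g\<in>carrier GL2. stable_line i g \<longrightarrow> g \<in> iwahori_conj c 0"
    if e: "e * (x * w - y * z) = 1"
      and st: "\<And>p q r s. \<not> 2 dvd p * s - q * r \<Longrightarrow> stable_line i (M2 p q r s) \<Longrightarrow>
        2 dvd (z * p + w * r) * (e * w) + (z * q + w * s) * (- e * z)" for e x y z w
  proof -
    define c where "c = M2 x y z w"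
    have ci: "inv\<^bsub>GL2\<^esub> c = M2 (e * w) (- e * y) (- e * z) (e * x)" unfolding c_def by (rule inv_M2[OF e])
    have c: "c \<in> carrier GL2"
      using e unfolding c_def M2_carrier_iff by (metis dvdI mult.commute)
    have "g \<in> iwahori_conj c 0" if g: "g \<in> carrier GL2" "stable_line i g" for g
    proof -
      obtain p q r s where pqrs: "g = M2 p q r s" by (rule M2_cases)
      have car: "c ** g ** inv\<^bsub>GL2\<^esub> c \<in> carrier GL2" using c g by (intro GL2_mult_closed GL2.inv_closed)
      then have "c ** g ** inv\<^bsub>GL2\<^esub> c \<in> iwahori 0"
        unfolding pqrs c_def ci[unfolded c_def] M2_mult
        by (subst iwahori_0_iff) (use st g in \<open>simp_all add: pqrs carrier_GL2_M2_odd\<close>)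
      then show ?thesis using g by (simp add: iwahori_conj_def)
    qed
    then show ?thesis using c by blast
  qed
  consider "i = 0" | "i = 1" | "i > 1" by linarith
  then show ?thesis
  proof cases
    case 1
    \<comment> \<open>The conjugators are the identity, the swap of coordinates and a lower unipotent matrix.\<close>
    show ?thesis by (rule *[of 1 1 1 0 0]) (use 1 in \<open>simp_all add: stable_line_def\<close>)
  next
    case 2
    show ?thesis by (rule *[of "- 1" 0 0 1 1]) (use 2 in \<open>simp_all add: stable_line_def\<close>)
  next
    case 3
    show ?thesis
    proof (rule *[of 1 1 1 0 1])
      show "2 dvd (1 * p + 1 * r) * (1 * 1) + (1 * q + 1 * s) * (- 1 * 1)" if "stable_line i (M2 p q r s)" for p q r s
        using that 3 unfolding stable_line_def by (simp add: algebra_simps)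
    qed simp
  qed
qed

lemma even_trace_if_stable_line:
  assumes "M2 p q r s \<in> carrier GL2" "stable_line i (M2 p q r s)"
  shows "2 dvd p + s"
  using assms unfolding carrier_GL2_M2_odd stable_line_def
  by (auto simp: padic2_even_simps split: if_splits)

lemma stable_line_if_even_trace:
  assumes "M2 p q r s \<in> carrier GL2" "2 dvd p + s"
  shows "\<exists>i. stable_line i (M2 p q r s)"
proof -
  have "stable_line 0 (M2 p q r s) \<or> stable_line 1 (M2 p q r s) \<or> stable_line 2 (M2 p q r s)"
    using assms unfolding carrier_GL2_M2_odd stable_line_def
    by (auto simp: padic2_even_simps)
  then show ?thesis by blast
qed

text \<open>
  Modulo 2, an invertible matrix of odd trace has order 3.
\<close>

lemma stable_line_cube:
  assumes "M2 p q r s \<in> carrier GL2" "\<not> 2 dvd p + s"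
  shows "stable_line i (M2 p q r s ** M2 p q r s ** M2 p q r s)"
  using assms unfolding carrier_GL2_M2_odd stable_line_def M2_mult
  by (auto simp: padic2_even_simps)

text \<open>
  Two distinct involutions of the symmetric group on three lines have a product of order 3.
\<close>

lemma common_stable_line_or_odd_trace:
  assumes "M2 p q r s \<in> carrier GL2" "2 dvd p + s" "M2 x y z w \<in> carrier GL2" "2 dvd x + w"
  shows "(\<exists>i. stable_line i (M2 p q r s) \<and> stable_line i (M2 x y z w)) \<or> \<not> 2 dvd (p * x + q * z) + (r * y + s * w)"
proof -
  have "(stable_line 0 (M2 p q r s) \<and> stable_line 0 (M2 x y z w)) \<or> (stable_line 1 (M2 p q r s) \<and> stable_line 1 (M2 x y z w))
    \<or> (stable_line 2 (M2 p q r s) \<and> stable_line 2 (M2 x y z w)) \<or> \<not> 2 dvd (p * x + q * z) + (r * y + s * w)"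
    using assms unfolding carrier_GL2_M2_odd stable_line_def
    by (simp add: padic2_even_simps) blast
  then show ?thesis by blast
qed

text \<open>
  Passing to cubes kills elements of order 3 modulo 2 and keeps determinants up to squares. If \<open>a\<close> and
  \<open>b\<close> act as different involutions, \<open>a\<close> is replaced by the cube of \<open>ab\<close>, which acts trivially on the lines.
\<close>

lemma common_stable_line:
  assumes a: "a \<in> carrier GL2" and b: "b \<in> carrier GL2"
  obtains i a' b' where "a' \<in> {a, a ** a ** a, (a ** b) ** (a ** b) ** (a ** b)}" "b' \<in> {b, b ** b ** b}"
    "stable_line i a'" "stable_line i b'"
proof -
  have dich: "2 dvd g $ 1 $ 1 + g $ 2 $ 2 \<and> (\<exists>i. stable_line i g) \<or> (\<forall>i. stable_line i (g ** g ** g))"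
    if "g \<in> carrier GL2" for g
  proof -
    obtain p q r s where g: "g = M2 p q r s" by (rule M2_cases)
    show ?thesis
      using that stable_line_if_even_trace[of p q r s] stable_line_cube[of p q r s] unfolding g
      by (cases "2 dvd p + s") simp_all
  qed
  show thesis
  proof (cases "\<forall>i. stable_line i (a ** a ** a)")
    case True
    then show thesis using dich[OF b] that[of "a ** a ** a"] by blast
  next
    case a3: False
    show thesis
    proof (cases "\<forall>i. stable_line i (b ** b ** b)")
      case True
      then show thesis using dich[OF a] a3 that[of a "b ** b ** b"] by blast
    next
      case b3: False
      have ab: "a ** b \<in> carrier GL2" using a b by (rule GL2_mult_closed)
      show thesis
      proof (cases "\<exists>i. stable_line i a \<and> stable_line i b")
        case True
        then show thesis using that[of a b] by blast
      next
        case False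
        have "\<not> 2 dvd (a ** b) $ 1 $ 1 + (a ** b) $ 2 $ 2"
          using False dich[OF a] dich[OF b] a3 b3 a b common_stable_line_or_odd_trace
          by (cases a rule: M2_cases; cases b rule: M2_cases) (simp add: M2_mult, blast)
        then have "\<forall>i. stable_line i ((a ** b) ** (a ** b) ** (a ** b))" using dich[OF ab] by blast
        then show thesis using dich[OF b] b3 that[of "(a ** b) ** (a ** b) ** (a ** b)" b] by blast
      qed
    qed
  qed
qed

lemma perturb_nonzero: "\<exists>x'. 2 ^ n dvd x' - x \<and> x' + y \<noteq> (0 :: padic2)"
proof (cases "x + y = 0")
  case True
  have "x + 2 ^ n + y = 2 ^ n" using True by (simp add: algebra_simps)
  then have "x + 2 ^ n + y \<noteq> 0" using padic2_power2_nonzero[of n] by metis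
  then show ?thesis by (intro exI[of _ "x + 2 ^ n"]) simp
next
  case False
  then show ?thesis by (intro exI[of _ x]) simp
qed

text \<open>
  A nonzero polynomial has finitely many roots, and \<open>x + 2\<^sup>n\<^sup>+\<^sup>j\<close> takes infinitely many values.
\<close>

lemma perturb_poly_nonzero:
  assumes "f \<noteq> (0 :: padic2 poly)"
  shows "\<exists>x'. 2 ^ n dvd x' - x \<and> poly f x' \<noteq> 0"
proof (rule ccontr)
  assume contra: "\<not> ?thesis"
  have "(\<lambda>j. x + 2 ^ (n + j)) ` UNIV \<subseteq> {x. poly f x = 0}"
    using contra by (auto simp: power_add)
  then have "finite (range (\<lambda>j. x + 2 ^ (n + j)))"
    using poly_roots_finite[OF assms] finite_subset by blast
  moreover have "inj (\<lambda>j. x + 2 ^ (n + j) :: padic2)"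
  proof (rule injI)
    have aux: "\<not> i < j" if "x + 2 ^ (n + i) = x + (2 :: padic2) ^ (n + j)" for i j
    proof
      assume "i < j"
      then have "(2 :: padic2) ^ (n + j) = 2 ^ (n + i) * 2 ^ (j - i)" by (simp flip: power_add)
      then have "(2 :: padic2) ^ (n + i) * 1 = 2 ^ (n + i) * 2 ^ (j - i)" using that by simp
      then have "1 = (2 :: padic2) ^ (j - i)"
        unfolding mult_cancel_left using padic2_power2_nonzero by blast
      moreover have "(2 :: padic2) dvd 2 ^ (j - i)" using \<open>i < j\<close> by (intro dvd_power) simp
      ultimately show False using two_not_dvd_one by metis
    qed
    fix i j assume "x + 2 ^ (n + i) = x + (2 :: padic2) ^ (n + j)"
    then show "i = j" using aux[of i j] aux[of j i] by simp
  qed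
  ultimately show False using finite_imageD infinite_UNIV_nat by blast
qed

text \<open>
  As a polynomial in the upper left entry of \<open>b\<close>, the negative of the determinant
  of \<open>ab - ba\<close> has leading coefficient \<open>-q'r'\<close>, so it is a nonzero polynomial once \<open>q'\<close> and \<open>r'\<close> are nonzero.
\<close>

lemma generic_perturbation:
  obtains p' q' r' x' where "mcong (2 ^ n) (M2 p' q' r' s) (M2 p q r s)" "mcong (2 ^ n) (M2 x' y z w) (M2 x y z w)"
    "p' + s \<noteq> 0" "x' + w \<noteq> 0"
    "(q' * z - r' * y) * (q' * z - r' * y) + (y * (p' - s) - q' * (x' - w)) * (r' * (x' - w) - z * (p' - s)) \<noteq> 0"
proof -
  obtain p' where p': "2 ^ n dvd p' - p" "p' + s \<noteq> 0" using perturb_nonzero by blast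
  obtain q' where q': "2 ^ n dvd q' - q" "q' \<noteq> 0" using perturb_nonzero[of n q 0] by auto
  obtain r' where r': "2 ^ n dvd r' - r" "r' \<noteq> 0" using perturb_nonzero[of n r 0] by auto
  define m u where "m = q' * z - r' * y" and "u = p' - s"
  define f where "f = [: m * m + (y * u + q' * w) * (- r' * w - z * u), r' * (y * u + q' * w) - q' * (- r' * w - z * u), - (q' * r') :]"
  have f: "poly f X = m * m + (y * u - q' * (X - w)) * (r' * (X - w) - z * u)" for X
    unfolding f_def by (simp add: algebra_simps)
  have "f \<noteq> 0" unfolding f_def using q'(2) r'(2) by simp
  moreover have "[: w, 1 :] \<noteq> (0 :: padic2 poly)" by simp
  ultimately have "f * [: w, 1 :] \<noteq> 0" by (rule no_zero_divisors)
  then obtain x' where x': "2 ^ n dvd x' - x" "poly (f * [: w, 1 :]) x' \<noteq> 0" using perturb_poly_nonzero by blast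
  from x'(2) have "poly f x' * poly [: w, 1 :] x' \<noteq> 0" unfolding poly_mult .
  then have "poly f x' \<noteq> 0" "poly [: w, 1 :] x' \<noteq> 0" by auto
  then have "poly f x' \<noteq> 0" "x' + w \<noteq> 0" by (simp_all add: add.commute)
  then show thesis
    using that[of p' q' r' x'] p' q'(1) r'(1) x'(1) unfolding f m_def u_def by (simp add: mcong_M2)
qed

section \<open>Existence of minimal subgroups\<close>

theorem theorem1p4:
  fixes H :: "mat2 set"
  assumes "finite_index GL2 H" and "det ` H = Z2_units"
  shows "\<exists>M. minimal_subgroup M \<and> M \<subseteq> H \<and> finite_index (GL2\<lparr>carrier := H\<rparr>) M"
proof -
  have H: "subgroup H GL2" using assms(1) by (simp add: finite_index_def)
  interpret H: subgroup H GL2 by fact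
  obtain n0 where n0: "congruence_subgroup n0 \<subseteq> H"
    using finite_index_contains_congruence_subgroup[OF assms(1)] .
  \<comment> \<open>At least 3, so that changes modulo \<open>2\<^sup>n\<close> do not affect determinants modulo 8.\<close>
  define n where "n = n0 + 3"
  have n: "congruence_subgroup n \<subseteq> H" "n \<ge> 3"
    using n0 congruence_subgroup_mono[of n0 n] by (auto simp: n_def)
  have "- 1 \<in> Z2_units" "5 \<in> Z2_units"
  proof -
    have "\<not> 2 dvd 2 * 2 + (1 :: padic2)" by (simp only: padic2_even_simps dvd_triv_left) simp
    then have "\<not> 2 dvd (5 :: padic2)" by simp
    then show "5 \<in> Z2_units" unfolding Z2_units_def mem_Collect_eq padic2_unit_iff .
    show "- 1 \<in> Z2_units" by (simp add: Z2_units_def)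
  qed
  then obtain a0 b0 where ab0: "a0 \<in> H" "det a0 = - 1" "b0 \<in> H" "det b0 = 5"
    unfolding assms(2)[symmetric] by (metis imageE)
  obtain i a1 b1 where a1: "a1 \<in> {a0, a0 ** a0 ** a0, (a0 ** b0) ** (a0 ** b0) ** (a0 ** b0)}"
    and b1: "b1 \<in> {b0, b0 ** b0 ** b0}" and st: "stable_line i a1" "stable_line i b1"
    using common_stable_line[of a0 b0] ab0 by (metis H.mem_carrier)
  have Hm: "x ** y \<in> H" if "x \<in> H" "y \<in> H" for x y using H.m_closed[OF that] by simp
  have ab1: "a1 \<in> H" "b1 \<in> H" using a1 b1 ab0 Hm by auto
  have ab1c: "a1 \<in> carrier GL2" "b1 \<in> carrier GL2" using ab1 by auto
  have det1: "4 dvd det a1 - 3" "8 dvd det b1 - 5"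
  proof -
    \<comment> \<open>The cubes of \<open>-1\<close> and of \<open>-1 \<cdot> 5\<close> are \<open>-1\<close> and \<open>-125\<close>.\<close>
    have "det a1 \<in> {- 1, - 125}" using a1 ab0 by (auto simp: det_mul)
    moreover have "(- 1) - 3 = 4 * (- 1 :: padic2)" "(- 125) - 3 = 4 * (- 32 :: padic2)" by simp_all
    ultimately show "4 dvd det a1 - 3" by (metis dvd_triv_left empty_iff insert_iff)
    have "det b1 \<in> {5, 125}" using b1 ab0 by (auto simp: det_mul)
    moreover have "125 - 5 = 8 * (15 :: padic2)" "5 - 5 = 8 * (0 :: padic2)" by simp_all
    ultimately show "8 dvd det b1 - 5" by (metis dvd_triv_left empty_iff insert_iff)
  qed
  obtain p q r s where a1M: "a1 = M2 p q r s" by (rule M2_cases)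
  obtain x y z w where b1M: "b1 = M2 x y z w" by (rule M2_cases)
  obtain p' q' r' x' where cong: "mcong (2 ^ n) (M2 p' q' r' s) a1" "mcong (2 ^ n) (M2 x' y z w) b1"
    and tr: "p' + s \<noteq> 0" "x' + w \<noteq> 0"
    and W: "(q' * z - r' * y) * (q' * z - r' * y) + (y * (p' - s) - q' * (x' - w)) * (r' * (x' - w) - z * (p' - s)) \<noteq> 0"
    using generic_perturbation[of n s p q r y z w x] unfolding a1M b1M by blast
  define a b where "a = M2 p' q' r' s" and "b = M2 x' y z w"
  have car: "M2 p' q' r' s \<in> carrier GL2" "M2 x' y z w \<in> carrier GL2"
    using carrier_GL2_if_mcong ab1c cong n(2) by (meson le_trans one_le_numeral)+
  have abH: "a \<in> H" "b \<in> H"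
    using mem_subgroup_if_mcong[OF H n(1)] ab1 car cong unfolding a_def b_def by blast+
  have even: "2 dvd p' + s" "2 dvd x' + w"
  proof -
    have "2 dvd p' - p" "2 dvd x' - x"
      using mcong_power_le[OF cong(1), of 1] mcong_power_le[OF cong(2), of 1] n(2) by (simp_all add: a1M b1M mcong_M2)
    moreover have "2 dvd p + s" "2 dvd x + w"
      using even_trace_if_stable_line st ab1c unfolding a1M b1M by blast+
    ultimately show "2 dvd p' + s" "2 dvd x' + w" unfolding padic2_even_simps by blast+
  qed
  have det: "4 dvd det a - 3" "8 dvd det b - 5"
  proof -
    have "2 ^ 3 dvd det a - det a1" "2 ^ 3 dvd det b - det b1"
      using power_le_dvd[OF mcong_det n(2)] cong unfolding a_def b_def by blast+
    then have d: "8 dvd det a - det a1" "8 dvd det b - det b1" by simp_all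
    have "4 * 2 dvd det a - det a1" using d(1) by simp
    then have "4 dvd det a - det a1" by (rule dvd_mult_left)
    from dvd_add[OF this det1(1)] show "4 dvd det a - 3" by simp
    from dvd_add[OF d(2) det1(2)] show "8 dvd det b - 5" by simp
  qed
  obtain c where c: "c \<in> carrier GL2" "a1 \<in> iwahori_conj c 0" "b1 \<in> iwahori_conj c 0"
    using stable_line_iwahori_conj[of i] st ab1c by blast
  have "congruence_subgroup n \<subseteq> iwahori_conj c 0"
    using congruence_subgroup_subset_iwahori_conj[OF c(1), of 0] congruence_subgroup_mono[of 1 n] n(2) by simp
  then have ab_conj: "a \<in> iwahori_conj c 0" "b \<in> iwahori_conj c 0"
    using mem_subgroup_if_mcong[OF subgroup_iwahori_conj[OF c(1)]] c(2,3) car cong unfolding a_def b_def by blast+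

  define G where "G = generate GL2 {a, b}"
  define M where "M = GL2_closure G"
  have abc: "a \<in> carrier GL2" "b \<in> carrier GL2" using abH by auto
  have G: "subgroup G GL2" unfolding G_def using abc by (intro GL2.generate_is_subgroup) auto
  have abG: "a \<in> G" "b \<in> G" unfolding G_def by (auto intro: generate.incl)
  have M: "subgroup M GL2" unfolding M_def by (rule subgroup_GL2_closure[OF G])
  interpret M: subgroup M GL2 by fact
  have GM: "G \<subseteq> M" unfolding M_def by (rule GL2_closure_increasing[OF subgroup.subset[OF G]])
  have GH: "G \<subseteq> H" unfolding G_def using abH by (intro GL2.generate_subgroup_incl[OF _ H]) auto
  then have MH: "M \<subseteq> H" unfolding M_def by (rule GL2_closure_subset[OF H n(1)])
  obtain N where N: "N \<ge> 2" "full_level G N"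
    using full_level_if_generic_pair[OF G abG[unfolded a_def b_def] even(1) tr(1) even(2) tr(2) W] by blast
  obtain d where d: "det b = 1 + 4 * d" "\<not> 2 dvd d" using generator_dets_mod_8(4)[OF det] by blast
  have d': "x' * w - y * z = 1 + 4 * d" using d(1) by (simp add: b_def det_M2)
  note open_M = closure_contains_congruence_subgroup[OF G N abG(2)[unfolded b_def] even(2) tr(2) d' d(2), folded M_def]
  have det_M: "det ` M = Z2_units"
  proof
    show "det ` M \<subseteq> Z2_units"
      using M.subset by (auto simp: Z2_units_def carrier_GL2_iff subset_iff)
    show "Z2_units \<subseteq> det ` M"
    proof
      fix u assume "u \<in> Z2_units"
      then have "\<not> 2 dvd u" by (simp add: Z2_units_def padic2_unit_iff)
      then have "2 dvd u - 1" by (meson padic2_parity)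
      then obtain t where t: "u - 1 = 2 * t" by (elim dvdE)
      show "u \<in> det ` M"
      \<comment> \<open>Units congruent to 1 modulo 4 are reached by \<open>open_M\<close>; the others after a shift by \<open>det a\<close>.\<close>
      proof (cases "2 dvd t")
        case True
        then have "2 * 2 dvd 2 * t" by (rule mult_dvd_mono[OF dvd_refl])
        then have "4 dvd u - 1" unfolding t by simp
        then show ?thesis using open_M(2) by (metis imageI)
      next
        case False
        then have "2 * 2 dvd 2 * (t - 1)"
          by (intro mult_dvd_mono) (simp_all add: padic2_even_simps)
        also have "2 * (t - 1) = u - 3" using t by (simp add: algebra_simps)
        finally have u3: "4 dvd u - 3" by simp
        have "4 dvd (u - 3) * det a + 3 * (det a - 3) + 4 * 2"
          using u3 det(1) by (intro dvd_add dvd_mult2 dvd_mult) simp_all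
        also have "(u - 3) * det a + 3 * (det a - 3) + 4 * 2 = u * det a - 1" by (simp add: algebra_simps)
        finally obtain g where g: "g \<in> M" "det g = u * det a" using open_M(2) by blast
        have "g ** inv\<^bsub>GL2\<^esub> a \<in> M"
          using M.m_closed[OF g(1) M.m_inv_closed] abG(1) GM by auto
        moreover have "det (g ** inv\<^bsub>GL2\<^esub> a) = u"
          using det_inv_GL2[OF abc(1)] g(2) by (simp add: det_mul mult.assoc)
        ultimately show ?thesis by (metis imageI)
      qed
    qed
  qed
  have fin: "finite_index (GL2\<lparr>carrier := H\<rparr>) M"
    by (rule finite_index_if_congruence_subgroup[OF H M MH open_M(1)])
  have "finite_index (GL2\<lparr>carrier := carrier GL2\<rparr>) M"
    by (rule finite_index_if_congruence_subgroup[OF GL2.subgroup_self M M.subset open_M(1)])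
  then have fin': "finite_index GL2 M" by simp
  have "minimal_subgroup M"
    unfolding minimal_subgroup_def
  proof (intro conjI allI impI fin' det_M)
    fix K assume "maximal_closed_subgroup K M"
    then have K: "closed_subgroup K" "K \<subset> M" by (auto simp: maximal_closed_subgroup_def)
    have "det ` K \<noteq> Z2_units"
    proof
      assume full: "det ` K = Z2_units"
      have "det a \<in> det ` K" "det b \<in> det ` K"
        using abc unfolding full by (auto simp: Z2_units_def carrier_GL2_iff)
      then show False
        using no_proper_closed_subgroup_with_full_det[OF c(1) ab_conj generator_dets_mod_8(1-3)[OF det] _ K]
        by (simp add: M_def G_def)
    qed
    moreover have "det ` K \<subseteq> Z2_units" using K(2) det_M by blast
    ultimately show "det ` K \<subset> Z2_units" by blast
  qed
  then show ?thesis using MH fin by blast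
qed

end
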